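(* Let $p$ be an odd prime and $B_p$ the quaternion algebra over $\mathbb{Q}$ ramified exactly at $p$ and $\infty$. Suppose $\mathcal{O}_1,\mathcal{O}_2$ are orders of $B_p$, each of index $r$ in some (not necessarily the same) maximal order of $B_p$. Suppose the Gross lattices $\mathcal{O}_1^T$ and $\mathcal{O}_2^T$ have the same successive minima $D_1\le D_2\le D_3$, and that $D_1\ge 8r^2$. Then $\mathcal{O}_1\simeq\mathcal{O}_2$.
   Context: On $B_p$ let $\overline{x}$ be the canonical involution, $N(x)=x\overline{x}$ the reduced norm, $\mathrm{Tr}(x)=x+\overline{x}$ the reduced trace. For an order $\mathcal{O}$, its Gross lattice is $\mathcal{O}^T=\{2x-\mathrm{Tr}(x):x\in\mathcal{O}\}$, a rank-$3$ lattice with the positive definite quadratic form $N$. Successive minima (non-standard normalization): for a lattice $\Lambda$ of rank $k$ with positive definite quadratic form $Q$ and $1\le i\le k$, the $i$-th successive minimum is the minimum value $D_i$ such that the $\mathbb{Z}$-module generated by $\{v\in\Lambda: Q(v)\le D_i\}$ has rank at least $i$. *)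

theory Defs
  imports "HOL-Number_Theory.Number_Theory" "HOL-Library.Product_Plus"
begin

text \<open>Elements of a quaternion algebra (a,b)_Q written in the basis 1, i, j, k = ij,
  with i^2 = a, j^2 = b, ij = -ji.  Coordinates (x0,x1,x2,x3) mean x0 + x1 i + x2 j + x3 k.
  Addition is the componentwise one (from Product_Plus).\<close>
type_synonym quat = "rat \<times> rat \<times> rat \<times> rat"

definition qone :: quat where "qone = (1, 0, 0, 0)"

definition qscal :: "rat \<Rightarrow> quat \<Rightarrow> quat" where
  "qscal c x = (case x of (x0, x1, x2, x3) \<Rightarrow> (c * x0, c * x1, c * x2, c * x3))"

definition qconj :: "quat \<Rightarrow> quat" where
  "qconj x = (case x of (x0, x1, x2, x3) \<Rightarrow> (x0, - x1, - x2, - x3))"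

definition qmul :: "rat \<Rightarrow> rat \<Rightarrow> quat \<Rightarrow> quat \<Rightarrow> quat" where
  "qmul a b x y = (case x of (x0, x1, x2, x3) \<Rightarrow> case y of (y0, y1, y2, y3) \<Rightarrow>
     (x0*y0 + a*x1*y1 + b*x2*y2 - a*b*x3*y3,
      x0*y1 + x1*y0 - b*x2*y3 + b*x3*y2,
      x0*y2 + x2*y0 + a*x1*y3 - a*x3*y1,
      x0*y3 + x3*y0 + x1*y2 - x2*y1))"

text \<open>Pizer's standard presentation of B_p (p odd prime), the quaternion algebra over Q
  ramified exactly at p and infinity:
  p = 3 mod 4: (-1,-p);  p = 5 mod 8: (-2,-p);  p = 1 mod 8: (-p,-q) with q the least
  prime, q = 3 mod 4, with Legendre symbol (p/q) = -1.\<close>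
definition pizer_q :: "nat \<Rightarrow> nat" where
  "pizer_q p = (LEAST q. prime q \<and> q mod 4 = 3 \<and> Legendre (int p) (int q) = -1)"

definition Bp_a :: "nat \<Rightarrow> rat" where
  "Bp_a p = (if p mod 4 = 3 then -1 else if p mod 8 = 5 then -2 else - of_nat p)"

definition Bp_b :: "nat \<Rightarrow> rat" where
  "Bp_b p = (if p mod 4 = 3 then - of_nat p else if p mod 8 = 5 then - of_nat p
             else - of_nat (pizer_q p))"

definition bmul :: "nat \<Rightarrow> quat \<Rightarrow> quat \<Rightarrow> quat" where
  "bmul p = qmul (Bp_a p) (Bp_b p)"

text \<open>reduced norm N(x) = x * conj x (a scalar; we take its rational coordinate) and
  reduced trace Tr(x) = x + conj x (as an element of B_p)\<close>
definition rnorm :: "nat \<Rightarrow> quat \<Rightarrow> rat" where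
  "rnorm p x = fst (bmul p x (qconj x))"

definition rtrace :: "quat \<Rightarrow> quat" where
  "rtrace x = x + qconj x"

definition is_order :: "nat \<Rightarrow> quat set \<Rightarrow> bool" where
  "is_order p Ord \<longleftrightarrow> qone \<in> Ord \<and> (\<forall>x\<in>Ord. \<forall>y\<in>Ord. bmul p x y \<in> Ord) \<and>
     (\<exists>e :: nat \<Rightarrow> quat.
        (\<forall>c :: nat \<Rightarrow> rat. (\<Sum>i<4. qscal (c i) (e i)) = 0 \<longrightarrow> (\<forall>i<4. c i = 0)) \<and>
        Ord = {(\<Sum>i<4. qscal (of_int (n i)) (e i)) | n :: nat \<Rightarrow> int. True})"

definition is_maximal_order :: "nat \<Rightarrow> quat set \<Rightarrow> bool" where
  "is_maximal_order p M \<longleftrightarrow> is_order p M \<and> (\<forall>M'. is_order p M' \<and> M \<subseteq> M' \<longrightarrow> M' = M)"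

definition order_index :: "quat set \<Rightarrow> quat set \<Rightarrow> nat" where
  "order_index Ord M = card ((\<lambda>x. (\<lambda>y. x + y) ` Ord) ` M)"

definition gross_lattice :: "quat set \<Rightarrow> quat set" where
  "gross_lattice Ord = (\<lambda>x. (x + x) - rtrace x) ` Ord"

inductive_set zmod_gen :: "quat set \<Rightarrow> quat set" for S where
  zero: "0 \<in> zmod_gen S"
| gen: "x \<in> S \<Longrightarrow> x \<in> zmod_gen S"
| add: "x \<in> zmod_gen S \<Longrightarrow> y \<in> zmod_gen S \<Longrightarrow> x + y \<in> zmod_gen S"
| neg: "x \<in> zmod_gen S \<Longrightarrow> - x \<in> zmod_gen S"

definition rank_at_least :: "quat set \<Rightarrow> nat \<Rightarrow> bool" where
  "rank_at_least M i \<longleftrightarrow> (\<exists>v :: nat \<Rightarrow> quat. (\<forall>k<i. v k \<in> M) \<and>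
     (\<forall>c :: nat \<Rightarrow> int. (\<Sum>k<i. qscal (of_int (c k)) (v k)) = 0 \<longrightarrow> (\<forall>k<i. c k = 0)))"

definition is_succ_min :: "nat \<Rightarrow> quat set \<Rightarrow> nat \<Rightarrow> rat \<Rightarrow> bool" where
  "is_succ_min p L i D \<longleftrightarrow>
     rank_at_least (zmod_gen {v \<in> L. rnorm p v \<le> D}) i \<and>
     (\<forall>D'. rank_at_least (zmod_gen {v \<in> L. rnorm p v \<le> D'}) i \<longrightarrow> D \<le> D')"

definition order_iso :: "nat \<Rightarrow> quat set \<Rightarrow> quat set \<Rightarrow> bool" where
  "order_iso p O1 O2 \<longleftrightarrow> (\<exists>f. bij_betw f O1 O2 \<and> f qone = qone \<and>
     (\<forall>x\<in>O1. \<forall>y\<in>O1. f (x + y) = f x + f y \<and> f (bmul p x y) = bmul p (f x) (f y)))"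

end

theory Submission
  imports Defs "HOL-Analysis.Infinite_Sum"
begin

text \<open>An order is recovered from its Gross lattice, and an isometry of determinant 1 between Gross lattices is
  multiplicative, so it suffices to recover the Gram matrix of a basis from \<open>D1 \<le> D2 \<le> D3\<close>. In rank three
  the vectors realizing the successive minima form a basis, with Gram matrix
  \<open>(D1, x, y; x, D2, z; y, z, D3)\<close>, say. Its determinant is \<open>4 p\<^sup>2 r\<^sup>2\<close>, because every maximal order has
  reduced discriminant \<open>p\<close>; and \<open>4 p\<close> divides \<open>D1 D2 - x\<^sup>2\<close>, \<open>D1 D3 - y\<^sup>2\<close> and \<open>D2 D3 - z\<^sup>2\<close>, because
  commutators in an order have norm divisible by \<open>p\<close>. By reduction theory \<open>3 D1 D2 D3\<close> is at most eight
  times the determinant, so \<open>D1 \<ge> 8 r\<^sup>2\<close> forces \<open>D2 < 2 p\<close>. Hence \<open>x\<close>, \<open>y\<close>, \<open>z\<close> have absolute value less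
  than \<open>p\<close> and are determined up to sign by their squares modulo \<open>4 p\<close>; the determinant fixes the sign of \<open>x y z\<close>,
  and the remaining signs are changes of basis.

  That every maximal order has reduced discriminant \<open>p\<close> is proved one prime at a time: at \<open>l \<noteq> p\<close> a maximal
  order is conjugate to an explicit local order of unit discriminant, and at \<open>p\<close> it consists of the elements of
  integral norm, since the norm form is anisotropic there.\<close>

section \<open>An auxiliary prime\<close>

text \<open>The proof begins with analytic number theory because, for p = 1 modulo 8, the
  presentation of the algebra contains a least prime of a prescribed kind: nothing can be computed
  with it before such a prime is known to exist. Local arguments stay inside the rational algebra,
  over the integers localized at a prime; a local order equal to its own trace dual takes the place
  of a matrix ring. Constants: the determinant 4 p^2 r^2 gives 3 D1 D2 D3 <= 32 p^2 r^2, so D1 >= 8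
  r^2 yields 24 D2^2 <= 32 p^2, and an off-diagonal Gram entry is at most D2/2 in absolute value.
  The factor 4 in the modulus 4 p matters: modulo p alone, |x| and p - |x| have the same square, and
  only parity separates them. The Gram matrix does not see orientation, while an isometry of
  determinant -1 would reverse products. Negating all three basis vectors, an odd number, repairs
  this.\<close>

lemma Legendre_in: "Legendre a p \<in> {-1, 0, 1}"
  by (simp add: Legendre_def)

text \<open>Two values in {-1, 0, 1} differ by at most 2, so modulo anything larger a congruence is
  an equality. This turns Euler's criterion into identities between symbols.\<close>

lemma Legendre_eqI:
  assumes "2 < (p::int)" "[Legendre a p = x] (mod p)" "x \<in> {-1, 0, 1}"
  shows "Legendre a p = x"
proof -
  have d: "p dvd Legendre a p - x"
    using assms(2) by (simp add: cong_iff_dvd_diff)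
  have "\<bar>Legendre a p - x\<bar> < p"
    using assms(1,3) Legendre_in[of a p] by auto
  with d show ?thesis
    using dvd_imp_le_int[of "Legendre a p - x" p] by force
qed

lemma Legendre_mult:
  assumes "prime (p::nat)" "2 < p"
  shows "Legendre (a * b) (int p) = Legendre a (int p) * Legendre b (int p)"
proof (rule Legendre_eqI)
  have "[Legendre (a * b) (int p) = (a * b) ^ ((p - 1) div 2)] (mod int p)"
    using euler_criterion assms by blast
  moreover have "[Legendre a (int p) * Legendre b (int p) = a ^ ((p - 1) div 2) * b ^ ((p - 1) div 2)] (mod int p)"
    using euler_criterion assms cong_mult by blast
  ultimately show "[Legendre (a * b) (int p) = Legendre a (int p) * Legendre b (int p)] (mod int p)"
    by (metis cong_sym cong_trans power_mult_distrib)
  show "Legendre a (int p) * Legendre b (int p) \<in> {-1, 0, 1}"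
    using Legendre_in[of a "int p"] Legendre_in[of b "int p"] by auto
qed (use assms in simp)

lemma Legendre_cong:
  assumes "[a = b] (mod m)"
  shows "Legendre a m = Legendre b m"
proof -
  have "[a = 0] (mod m) \<longleftrightarrow> [b = 0] (mod m)" "QuadRes m a \<longleftrightarrow> QuadRes m b"
    using assms unfolding QuadRes_def by (metis cong_sym cong_trans)+
  thus ?thesis by (simp add: Legendre_def)
qed

lemma Legendre_minus_one:
  assumes "prime (p::nat)" "2 < p"
  shows "Legendre (- 1) (int p) = (if p mod 4 = 1 then 1 else - 1)"
proof (rule Legendre_eqI)
  have odd: "odd p" using assms prime_odd_nat by blast
  have "even ((p - 1) div 2) \<longleftrightarrow> p mod 4 = 1"
    using odd by presburger
  hence "(- 1::int) ^ ((p - 1) div 2) = (if p mod 4 = 1 then 1 else - 1)"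
    by simp
  thus "[Legendre (- 1) (int p) = (if p mod 4 = 1 then 1 else - 1)] (mod int p)"
    using euler_criterion[OF assms, of "-1"] by simp
qed (use assms in auto)

text \<open>With i a square root of -1 modulo p, the complex identity 2 = -i (1 + i)^2 becomes a
  congruence. Raised to the even power (p - 1)/2 = 2k it leaves (-1)^k times (1 + i)^(p - 1), and
  Fermat removes the last factor.\<close>

lemma Legendre_two:
  assumes "prime (p::nat)" "p mod 4 = 1"
  shows "Legendre 2 (int p) = (if p mod 8 = 1 then 1 else - 1)"
proof (rule Legendre_eqI)
  have p2: "2 < p" using assms prime_ge_2_nat[of p] by (cases "p = 2") auto
  have "Legendre (- 1) (int p) = 1" using Legendre_minus_one[OF assms(1) p2] assms(2) by simp
  then obtain i :: int where i: "[i\<^sup>2 = - 1] (mod int p)"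
    unfolding Legendre_def QuadRes_def by (auto split: if_splits)
  define k where "k = (p - 1) div 4"
  have pk: "p = 4 * k + 1" using assms(2) unfolding k_def by presburger
  have hk: "(p - 1) div 2 = 2 * k" using pk by simp
  have id: "2 = - i * (1 + i)\<^sup>2 + (i\<^sup>2 + 1) * (i + 2)"
    by (simp add: power2_eq_square algebra_simps)
  have "int p dvd i\<^sup>2 + 1" using i by (simp add: cong_iff_dvd_diff)
  hence c2: "[2 = - i * (1 + i)\<^sup>2] (mod int p)"
    by (subst id) (simp add: cong_iff_dvd_diff)
  have ndvd: "\<not> int p dvd 1 + i"
  proof
    assume "int p dvd 1 + i"
    hence "int p dvd - i * (1 + i)\<^sup>2" by (simp add: power2_eq_square)
    hence "int p dvd 2" using c2 cong_dvd_iff by blast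
    hence "int p \<le> 2" using zdvd_imp_le by fastforce
    thus False using p2 by simp
  qed
  have f: "[(1 + i) ^ (p - 1) = 1] (mod int p)"
  proof -
    define m where "m = nat ((1 + i) mod int p)"
    have mi: "int m = (1 + i) mod int p" using p2 by (simp add: m_def)
    have "\<not> p dvd m"
      using ndvd mi by (metis dvd_mod_iff int_dvd_int_iff dvd_refl)
    hence "[m ^ (p - 1) = 1] (mod p)" using fermat_theorem[OF assms(1)] by blast
    hence "[int m ^ (p - 1) = 1] (mod int p)"
      by (metis cong_int_iff of_nat_1 of_nat_power)
    moreover have "[int m = 1 + i] (mod int p)" using mi by (simp add: cong_def)
    ultimately show ?thesis
      by (metis cong_pow cong_sym cong_trans)
  qed
  have "[(2::int) ^ (2 * k) = (- i * (1 + i)\<^sup>2) ^ (2 * k)] (mod int p)"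
    using c2 cong_pow by blast
  also have "(- i * (1 + i)\<^sup>2) ^ (2 * k) = (i\<^sup>2) ^ k * (1 + i) ^ (p - 1)"
    using pk by (simp add: power_mult_distrib power_mult [symmetric])
  also have "[\<dots> = (- 1) ^ k * 1] (mod int p)"
    using i f by (intro cong_mult cong_pow) auto
  also have "(- 1) ^ k * 1 = (if p mod 8 = 1 then 1 else - 1::int)"
  proof -
    have "even k \<longleftrightarrow> p mod 8 = 1" using pk by presburger
    thus ?thesis by simp
  qed
  finally have "[(2::int) ^ ((p - 1) div 2) = (if p mod 8 = 1 then 1 else - 1)] (mod int p)"
    by (simp only: hk)
  thus "[Legendre 2 (int p) = (if p mod 8 = 1 then 1 else - 1)] (mod int p)"
    using euler_criterion[OF assms(1) p2, of 2] cong_trans by blast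
  show "2 < int p" using p2 by simp
qed auto

section \<open>Divisor convolutions of completely multiplicative functions\<close>

lemma divisors_prime_power_mult:
  fixes q m k :: nat
  assumes q: "prime q" and nq: "\<not> q dvd m"
  shows "bij_betw (\<lambda>(i, d). q ^ i * d) ({..k} \<times> {d. d dvd m}) {d. d dvd q ^ k * m}"
proof (rule bij_betwI')
  fix x y assume xy: "x \<in> {..k} \<times> {d. d dvd m}" "y \<in> {..k} \<times> {d. d dvd m}"
  obtain i d j e where [simp]: "x = (i, d)" "y = (j, e)" by (cases x, cases y)
  have nd: "\<not> q dvd d" "\<not> q dvd e" using xy nq dvd_trans by auto
  have mult: "multiplicity q (q ^ i' * d') = i'" if "\<not> q dvd d'" for i' d'
    using that q by (intro multiplicity_decomposeI) (auto simp: prime_gt_0_nat)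
  show "(case x of (i, d) \<Rightarrow> q ^ i * d) = (case y of (i, d) \<Rightarrow> q ^ i * d) \<longleftrightarrow> x = y"
    using mult[OF nd(1), of i] mult[OF nd(2), of j] q by (auto simp: prime_gt_0_nat)
next
  fix x assume "x \<in> {..k} \<times> {d. d dvd m}"
  thus "(case x of (i, d) \<Rightarrow> q ^ i * d) \<in> {d. d dvd q ^ k * m}"
    by (auto intro!: mult_dvd_mono le_imp_power_dvd)
next
  fix n assume "n \<in> {d. d dvd q ^ k * m}"
  hence "n dvd q ^ k * m" by simp
  then obtain a b where ab: "n = a * b" "a dvd q ^ k" "b dvd m"
    by (metis division_decomp)
  then obtain i where "i \<le> k" "a = q ^ i"
    using divides_primepow_nat[OF q] by auto
  thus "\<exists>x\<in>{..k} \<times> {d. d dvd m}. n = (case x of (i, d) \<Rightarrow> q ^ i * d)"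
    using ab by (intro bexI[of _ "(i, b)"]) auto
qed

text \<open>Multiplicativity of the Dirichlet convolution, in the form that splits off one full
  prime power at a time; the induction below peels an integer in this way.\<close>

lemma divisor_convolution_prime_power_mult:
  fixes f h :: "nat \<Rightarrow> int" and q m k :: nat
  assumes q: "prime q" and nq: "\<not> q dvd m"
    and fm: "\<And>x y. f (x * y) = f x * f y" and hm: "\<And>x y. h (x * y) = h x * h y"
    and f1: "f 1 = 1" and h1: "h 1 = 1"
  shows "(\<Sum>d | d dvd q ^ k * m. f d * h (q ^ k * m div d)) =
    (\<Sum>i\<le>k. f q ^ i * h q ^ (k - i)) * (\<Sum>d | d dvd m. f d * h (m div d))"
proof -
  have fp: "f (x ^ i) = f x ^ i" and hp: "h (x ^ i) = h x ^ i" for x i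
    by (induction i) (use f1 h1 in \<open>auto simp: fm hm\<close>)
  have q0: "q > 0" using q prime_gt_0_nat by blast
  have summand: "f (q ^ i * d) * h (q ^ k * m div (q ^ i * d)) = f q ^ i * h q ^ (k - i) * (f d * h (m div d))"
    if "i \<le> k" "d dvd m" for i d
  proof -
    have k: "q ^ k = q ^ i * q ^ (k - i)" and md: "m = d * (m div d)"
      using that by (simp_all flip: power_add)
    have "q ^ k * m = (q ^ i * d) * (q ^ (k - i) * (m div d))"
      using arg_cong2[OF k md, of "(*)"] by (simp only: mult_ac)
    moreover have "d > 0" using that(2) nq by (cases "d = 0") auto
    ultimately have "q ^ k * m div (q ^ i * d) = q ^ (k - i) * (m div d)"
      using q0 by simp
    thus ?thesis by (simp add: fm hm fp hp)
  qed
  have "(\<Sum>d | d dvd q ^ k * m. f d * h (q ^ k * m div d)) =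
      (\<Sum>(i, d)\<in>{..k} \<times> {d. d dvd m}. f (q ^ i * d) * h (q ^ k * m div (q ^ i * d)))"
    using sum.reindex_bij_betw[OF divisors_prime_power_mult[OF q nq, of k], symmetric]
    by (simp add: case_prod_beta')
  also have "\<dots> = (\<Sum>(i, d)\<in>{..k} \<times> {d. d dvd m}. (f q ^ i * h q ^ (k - i)) * (f d * h (m div d)))"
    using summand by (intro sum.cong) auto
  also have "\<dots> = (\<Sum>i\<le>k. f q ^ i * h q ^ (k - i)) * (\<Sum>d | d dvd m. f d * h (m div d))"
    by (simp add: sum_product sum.cartesian_product)
  finally show ?thesis .
qed

text \<open>Both bounds survive multiplication of integers, so the local factors at prime powers
  decide. The condition on multiplicities characterizes perfect squares.\<close>

lemma divisor_convolution_nonneg: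
  fixes f h :: "nat \<Rightarrow> int"
  assumes fm: "\<And>x y. f (x * y) = f x * f y" and hm: "\<And>x y. h (x * y) = h x * h y"
    and f1: "f 1 = 1" and h1: "h 1 = 1"
    and pos: "\<And>q k. prime q \<Longrightarrow> (\<Sum>i\<le>k. f q ^ i * h q ^ (k - i)) \<ge> (if even k then 1 else 0)"
  shows "n > 0 \<Longrightarrow> (\<Sum>d | d dvd n. f d * h (n div d)) \<ge>
      (if \<forall>q. prime q \<longrightarrow> even (multiplicity q n) then 1 else 0)"
proof (induction n rule: less_induct)
  case (less n)
  show ?case
  proof (cases "n = 1")
    case True
    thus ?thesis using f1 h1 by simp
  next
    case False
    then obtain q where q: "prime q" "q dvd n" using prime_factor_nat by blast
    define k where "k = multiplicity q n"
    obtain m where m: "n = q ^ k * m" "\<not> q dvd m"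
      using multiplicity_decompose'[of n q] less.prems q(1) unfolding k_def
      by (metis not_prime_unit less_numeral_extra(3))
    have m0: "m > 0" using m less.prems by (cases m) auto
    have k0: "k > 0" using q m by (cases k) auto
    have "q ^ k > 1" using k0 q(1) prime_gt_1_nat one_less_power by blast
    hence mn: "m < n" using m m0 by simp
    let ?S = "\<lambda>n. \<forall>q. prime q \<longrightarrow> even (multiplicity q n)"
    let ?g = "\<lambda>n. \<Sum>d | d dvd n. f d * h (n div d)"
    have IH: "?g m \<ge> (if ?S m then 1 else 0)" using less.IH[OF mn m0] .
    have eq: "?g n = (\<Sum>i\<le>k. f q ^ i * h q ^ (k - i)) * ?g m"
      using divisor_convolution_prime_power_mult[OF q(1) m(2) fm hm f1 h1, of k] m(1) by simp
    have S: "even k \<and> ?S m" if "?S n"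
    proof
      show "even k" using that q(1) by (simp add: k_def)
      show "?S m"
      proof (intro allI impI)
        fix s :: nat assume s: "prime s"
        show "even (multiplicity s m)"
        proof (cases "s = q")
          case True thus ?thesis using m(2) by (simp add: not_dvd_imp_multiplicity_0)
        next
          case False
          hence "multiplicity s (q ^ k) = 0"
            using s q(1) by (metis not_dvd_imp_multiplicity_0 prime_dvd_power primes_dvd_imp_eq)
          hence "multiplicity s n = multiplicity s m"
            using m(1) s m0 q(1) by (simp add: prime_elem_multiplicity_mult_distrib)
          thus ?thesis using that s by metis
        qed
      qed
    qed
    define H where "H = (\<Sum>i\<le>k. f q ^ i * h q ^ (k - i))"
    have H: "H \<ge> (if even k then 1 else 0)" using pos[OF q(1)] by (simp add: H_def)
    have H0: "H \<ge> 0" "?g m \<ge> 0" using H IH by (auto split: if_splits)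
    show ?thesis
    proof (cases "?S n")
      case True
      hence "H \<ge> 1" "?g m \<ge> 1" using S H IH by auto
      hence "H * ?g m \<ge> 1 * 1" by (intro mult_mono) auto
      thus ?thesis using True eq H_def by simp
    next
      case False
      thus ?thesis using mult_nonneg_nonneg[OF H0] unfolding eq H_def by (simp only: if_False)
    qed
  qed
qed

section \<open>The character modulo 4 and its Lambert series\<close>

definition chi4 :: "nat \<Rightarrow> int" where
  "chi4 n = (if n mod 4 = 1 then 1 else if n mod 4 = 3 then - 1 else 0)"

lemma chi4_mult: "chi4 (m * n) = chi4 m * chi4 n"
proof -
  have "m mod 4 \<in> {0, 1, 2, 3}" "n mod 4 \<in> {0, 1, 2, 3}" by auto
  moreover have "(m * n) mod 4 = ((m mod 4) * (n mod 4)) mod 4" by (simp add: mod_mult_eq)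
  ultimately show ?thesis unfolding chi4_def by (elim insertE emptyE) simp_all
qed

lemma chi4_add_two: "chi4 (n + 2) = - chi4 n"
proof -
  have "(n + 2) mod 4 = ((n mod 4) + 2) mod 4" by presburger
  moreover have "n mod 4 \<in> {0, 1, 2, 3}" by auto
  ultimately show ?thesis unfolding chi4_def by (elim insertE emptyE) simp_all
qed

lemma abs_chi4_le: "\<bar>chi4 n\<bar> \<le> 1"
  by (simp add: chi4_def)

text \<open>Shifting the index by two negates the character, so the sum S satisfies S = y - y^2 S.
  The index 0 may be dropped because \<open>chi4 0 = 0\<close>.\<close>

lemma chi4_power_series:
  fixes y :: real
  assumes "0 \<le> y" "y < 1"
  shows "((\<lambda>n. of_int (chi4 n) * y ^ n) has_sum (y / (1 + y\<^sup>2))) {1..}"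
proof -
  let ?f = "\<lambda>n. of_int (chi4 n) * y ^ n"
  have le: "norm (?f n) \<le> y ^ n" for n
    using abs_chi4_le[of n] assms by (simp add: abs_mult mult_left_le_one_le flip: of_int_abs)
  have sm: "summable (\<lambda>n. norm (?f n))"
    by (rule summable_comparison_test'[OF summable_geometric[of y], of 0]) (use le assms in auto)
  have s: "summable ?f" by (rule summable_norm_cancel[OF sm])
  have "suminf ?f = (\<Sum>n. ?f (n + 2)) + (\<Sum>i<2. ?f i)"
    by (rule suminf_split_initial_segment[OF s])
  also have "(\<lambda>n. ?f (n + 2)) = (\<lambda>n. - (y\<^sup>2) * ?f n)"
    by (intro ext, subst chi4_add_two) (simp add: power_add power2_eq_square)
  also have "suminf \<dots> = - (y\<^sup>2) * suminf ?f"
    using suminf_mult[OF s] by blast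
  also have "(\<Sum>i<2. ?f i) = y" by (simp add: numeral_2_eq_2 chi4_def)
  finally have "suminf ?f * (1 + y\<^sup>2) = y" by (simp add: algebra_simps)
  moreover have "1 + y\<^sup>2 \<noteq> 0" by (smt (verit) zero_le_power2)
  ultimately have "suminf ?f = y / (1 + y\<^sup>2)" by (simp add: field_simps)
  hence "(?f has_sum (y / (1 + y\<^sup>2))) UNIV"
    using norm_summable_imp_has_sum[OF sm summable_sums[OF s]] by simp
  moreover have "(?f has_sum (y / (1 + y\<^sup>2))) UNIV \<longleftrightarrow> (?f has_sum (y / (1 + y\<^sup>2))) {1..}"
    by (rule has_sum_cong_neutral) (auto simp: chi4_def not_le)
  ultimately show ?thesis by simp
qed

text \<open>The difference factors as y - z times (1 - y z) / ((1 + y^2)(1 + z^2)), and on the unit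
  interval the second factor lies between 0 and 1.\<close>

lemma Lipschitz_chi4_sum:
  fixes y z :: real
  assumes "0 \<le> z" "z \<le> y" "y \<le> 1"
  shows "\<bar>y / (1 + y\<^sup>2) - z / (1 + z\<^sup>2)\<bar> \<le> y - z"
proof -
  have d: "1 + y\<^sup>2 \<ge> 1" "1 + z\<^sup>2 \<ge> 1" by auto
  have yz: "0 \<le> 1 - y * z" "1 - y * z \<le> 1"
    using assms mult_mono[of y 1 z 1] by auto
  have eq: "y / (1 + y\<^sup>2) - z / (1 + z\<^sup>2) = (y - z) * ((1 - y * z) / ((1 + y\<^sup>2) * (1 + z\<^sup>2)))"
    using d sum_power2_eq_zero_iff[of 1 y] sum_power2_eq_zero_iff[of 1 z]
    by (subst diff_frac_eq) (auto simp: power2_eq_square algebra_simps intro!: arg_cong2[of _ _ _ _ "(/)"])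
  have "1 * 1 \<le> (1 + y\<^sup>2) * (1 + z\<^sup>2)" using d by (intro mult_mono) auto
  hence "(1 - y * z) / ((1 + y\<^sup>2) * (1 + z\<^sup>2)) \<le> 1" "0 \<le> (1 - y * z) / ((1 + y\<^sup>2) * (1 + z\<^sup>2))"
    using yz by (auto intro!: divide_nonneg_nonneg simp only: divide_le_eq_1)
  thus ?thesis
    unfolding eq abs_mult using assms by (simp only: abs_of_nonneg mult_left_le diff_ge_0_iff_ge)
qed

text \<open>Summation by parts: the weights vary by no more than the monotone sequence x^b does,
  whose total variation is at most 1. The bound does not depend on x, which is what the limit x to 1
  requires.\<close>

lemma abel_bound:
  fixes h e :: "nat \<Rightarrow> real" and x C :: real
  assumes h: "\<And>B. \<bar>\<Sum>b=1..B. h b\<bar> \<le> C"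
    and e: "\<And>b. \<bar>e b - e (Suc b)\<bar> \<le> x ^ b - x ^ Suc b" "\<And>b. \<bar>e b\<bar> \<le> 1"
    and x: "0 \<le> x" "x \<le> 1"
  shows "\<bar>\<Sum>b=1..B. h b * e b\<bar> \<le> 2 * C"
proof -
  have C: "C \<ge> 0" using h[of 0] by simp
  \<comment> \<open>The boundary term is kept on the left so that each induction step adds only one
    variation of \<open>e\<close>, and the bounds on these telescope.\<close>
  have "\<bar>(\<Sum>b=1..B. h b * e b) - (\<Sum>b=1..B. h b) * e (Suc B)\<bar> \<le> C * (1 - x ^ Suc B)"
  proof (induction B)
    case 0
    thus ?case using C x by simp
  next
    case (Suc B)
    define S where "S = (\<Sum>b=1..Suc B. h b)"
    have eq: "(\<Sum>b=1..Suc B. h b * e b) - S * e (Suc (Suc B)) =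
        ((\<Sum>b=1..B. h b * e b) - (\<Sum>b=1..B. h b) * e (Suc B)) + S * (e (Suc B) - e (Suc (Suc B)))"
      by (simp add: S_def algebra_simps)
    have "\<bar>S * (e (Suc B) - e (Suc (Suc B)))\<bar> \<le> C * (x ^ Suc B - x ^ Suc (Suc B))"
      unfolding abs_mult using h[of "Suc B"] e(1)[of "Suc B"] C by (intro mult_mono) (auto simp: S_def)
    hence "\<bar>(\<Sum>b=1..Suc B. h b * e b) - S * e (Suc (Suc B))\<bar> \<le>
        C * (1 - x ^ Suc B) + C * (x ^ Suc B - x ^ Suc (Suc B))"
      using Suc.IH unfolding eq by linarith
    thus ?case by (simp add: S_def algebra_simps)
  qed
  moreover have "C * (1 - x ^ Suc B) \<le> C"
    using C x by (simp add: mult_left_le del: power_Suc)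
  moreover have "\<bar>(\<Sum>b=1..B. h b) * e (Suc B)\<bar> \<le> C * 1"
    unfolding abs_mult using h[of B] e(2)[of "Suc B"] C by (intro mult_mono) auto
  ultimately show ?thesis by linarith
qed

lemma has_sum_finite_approx:
  fixes l :: "'a :: {metric_space, comm_monoid_add}"
  assumes "(f has_sum l) A" "\<epsilon> > 0"
  obtains X where "finite X" "X \<subseteq> A"
    "\<And>Y. finite Y \<Longrightarrow> X \<subseteq> Y \<Longrightarrow> Y \<subseteq> A \<Longrightarrow> dist (sum f Y) l < \<epsilon>"
proof -
  have "eventually (\<lambda>Y. dist (sum f Y) l < \<epsilon>) (finite_subsets_at_top A)"
    using assms unfolding has_sum_def by (rule tendstoD)
  thus ?thesis
    using that unfolding eventually_finite_subsets_at_top by metis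
qed

text \<open>The double series of h(b) chi4(a) x^(a b) is evaluated twice. Row by row it stays
  bounded uniformly in x; grouped by n = a b its coefficients are nonnegative and at least 1 at
  squares, so the first N squares alone contribute N x^(N^2). Letting x tend to 1 for a large fixed
  N is contradictory.\<close>

lemma no_nonneg_chi4_convolution:
  fixes h :: "nat \<Rightarrow> int" and C :: int
  assumes h: "\<And>b. \<bar>h b\<bar> \<le> 1" "\<And>B. \<bar>\<Sum>b=1..B. h b\<bar> \<le> C"
    and nonneg: "\<And>n. n > 0 \<Longrightarrow> (\<Sum>d | d dvd n. chi4 d * h (n div d)) \<ge> 0"
    and square: "\<And>m. m > 0 \<Longrightarrow> (\<Sum>d | d dvd m\<^sup>2. chi4 d * h (m\<^sup>2 div d)) \<ge> 1"
  shows False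
proof -
  define g where "g = (\<lambda>n. \<Sum>d | d dvd n. chi4 d * h (n div d))"
  have bound: "of_nat N * x ^ N\<^sup>2 \<le> 2 * real_of_int C + 2" if x: "0 < x" "x < 1" for N :: nat and x :: real
  proof -
    define A :: "nat set" where "A = {1..}"
    define u where "u = (\<lambda>(b, a). of_int (h b * chi4 a) * x ^ (a * b))"
    define e where "e = (\<lambda>b. x ^ b / (1 + (x ^ b)\<^sup>2))"
    have xb: "0 \<le> x ^ b" "x ^ b \<le> 1" for b using x by (auto simp: power_le_one)
    have geo: "((\<lambda>n. x ^ n) has_sum (x / (1 - x))) A"
    proof -
      have "(\<lambda>n. x ^ Suc n) sums (x * (1 / (1 - x)))"
        unfolding power_Suc using x by (intro sums_mult geometric_sums) auto
      hence "((\<lambda>n. x ^ Suc n) has_sum (x / (1 - x))) UNIV"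
        using x by (intro sums_nonneg_imp_has_sum) auto
      hence "((\<lambda>n. x ^ n) has_sum (x / (1 - x))) (Suc ` UNIV)"
        by (subst has_sum_reindex) (auto simp: o_def)
      moreover have "Suc ` UNIV = A" by (auto simp: A_def image_iff Suc_le_eq gr0_conv_Suc)
      ultimately show ?thesis by simp
    qed
    \<comment> \<open>A product majorant: for a, b >= 1 one has a b >= a + b - 1, hence x^(a b) <=
      x^a x^b / x.\<close>
    have "(\<lambda>(b, a). x ^ b * x ^ a / x) summable_on A \<times> A"
    proof (rule summable_on_SigmaI)
      show "((\<lambda>a. case (b, a) of (b, a) \<Rightarrow> x ^ b * x ^ a / x) has_sum (x ^ b * (1 / (1 - x)))) A"
        if "b \<in> A" for b
        using has_sum_cmult_right[OF geo, of "x ^ b / x"] x by simp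
      show "(\<lambda>b. x ^ b * (1 / (1 - x))) summable_on A"
        using has_sum_cmult_left[OF geo] has_sum_imp_summable by blast
    qed (use x in auto)
    hence "(\<lambda>z. norm (u z)) summable_on A \<times> A"
    proof (rule abs_summable_on_comparison_test')
      fix z assume "z \<in> A \<times> A"
      then obtain a b where z: "z = (b, a)" "a \<ge> 1" "b \<ge> 1" by (auto simp: A_def)
      obtain a' b' where ab: "a = Suc a'" "b = Suc b'" using z by (metis Suc_le_D One_nat_def)
      have "x ^ (a * b) \<le> x ^ (a' + b' + 1)" using x ab by (intro power_decreasing) auto
      also have "\<dots> = x ^ b * x ^ a / x" using x ab by (simp add: power_add)
      finally have le: "x ^ (a * b) \<le> x ^ b * x ^ a / x" .
      have "\<bar>h b * chi4 a\<bar> \<le> 1 * 1"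
        unfolding abs_mult using h(1)[of b] abs_chi4_le[of a] by (intro mult_mono) auto
      hence "\<bar>real_of_int (h b * chi4 a)\<bar> \<le> 1" by linarith
      hence "\<bar>real_of_int (h b * chi4 a)\<bar> * x ^ (a * b) \<le> 1 * x ^ (a * b)"
        using x by (intro mult_right_mono) auto
      hence "\<bar>real_of_int (h b * chi4 a)\<bar> * x ^ (a * b) \<le> x ^ b * x ^ a / x"
        using le by linarith
      thus "norm (u z) \<le> (case z of (b, a) \<Rightarrow> x ^ b * x ^ a / x)"
        using z x by (simp add: u_def abs_mult[of "real_of_int (h b * chi4 a)"] del: of_int_mult)
    qed
    hence "u summable_on A \<times> A" by (rule abs_summable_summable)
    then obtain T where T: "(u has_sum T) (A \<times> A)" by (auto simp: summable_on_def)
    \<comment> \<open>Rows first: the inner sum over a is the power series of \<open>chi4\<close> at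
      y = x^b.\<close>
    have "((\<lambda>b. of_int (h b) * e b) has_sum T) A"
    proof (rule has_sum_Sigma'[where A = A and B = "\<lambda>_. A" and f = u])
      show "(u has_sum T) (A \<times> A)" by (rule T)
    next
      fix b assume "b \<in> A"
      hence "x ^ b < 1" using x by (auto simp: A_def power_Suc_less_one intro!: power_less_one_iff[THEN iffD2])
      from has_sum_cmult_right[OF chi4_power_series[OF xb(1) this], of "of_int (h b)"]
      show "((\<lambda>a. u (b, a)) has_sum of_int (h b) * e b) A"
        by (simp add: u_def e_def A_def power_mult[symmetric] mult_ac)
    qed
    then obtain X where X: "finite X" "X \<subseteq> A"
        "\<And>Y. finite Y \<Longrightarrow> X \<subseteq> Y \<Longrightarrow> Y \<subseteq> A \<Longrightarrow> dist (\<Sum>b\<in>Y. of_int (h b) * e b) T < 1"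
      by (rule has_sum_finite_approx[OF _ zero_less_one]) blast
    obtain B where B: "X \<subseteq> {1..B}"
    proof
      show "X \<subseteq> {1..Max (insert 0 X)}" using X(1,2) by (auto simp: A_def)
    qed
    have "dist (\<Sum>b=1..B. of_int (h b) * e b) T < 1"
      by (rule X(3)) (use B in \<open>auto simp: A_def\<close>)
    moreover have "\<bar>\<Sum>b=1..B. of_int (h b) * e b\<bar> \<le> 2 * real_of_int C"
    proof (rule abel_bound[where x = x])
      fix b
      show "\<bar>\<Sum>b=1..b. real_of_int (h b)\<bar> \<le> real_of_int C"
        using h(2)[of b] by (metis of_int_abs of_int_le_iff of_int_sum)
      show "\<bar>e b - e (Suc b)\<bar> \<le> x ^ b - x ^ Suc b"
        unfolding e_def using x xb by (intro Lipschitz_chi4_sum power_decreasing) auto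
      have "\<bar>x ^ b / (1 + (x ^ b)\<^sup>2) - 0 / (1 + 0\<^sup>2)\<bar> \<le> x ^ b - 0"
        using xb by (intro Lipschitz_chi4_sum) auto
      thus "\<bar>e b\<bar> \<le> 1" using xb(2)[of b] by (simp add: e_def)
    qed (use x in auto)
    ultimately have T_le: "T \<le> 2 * real_of_int C + 1" by (simp add: dist_real_def)
    obtain F where F: "finite F" "F \<subseteq> A \<times> A"
        "\<And>Y. finite Y \<Longrightarrow> F \<subseteq> Y \<Longrightarrow> Y \<subseteq> A \<times> A \<Longrightarrow> dist (sum u Y) T < 1"
      using T by (rule has_sum_finite_approx[OF _ zero_less_one]) blast
    \<comment> \<open>K is large enough for two purposes: the fibres a b = n with n <= K cover the
      approximating set F, and all squares up to N^2 occur among these n.\<close>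
    define K where "K = Max (insert (N\<^sup>2) ((\<lambda>(b, a). a * b) ` F))"
    have K: "N\<^sup>2 \<le> K" "\<And>b a. (b, a) \<in> F \<Longrightarrow> a * b \<le> K"
      unfolding K_def using F(1) by (auto intro!: Max_ge)
    define G where "G = (\<lambda>n::nat. (\<lambda>d. (n div d, d)) ` {d. d dvd n})"
    have Gmem: "(b, a) \<in> G n \<longleftrightarrow> a * b = n" if "n > 0" for a b n
      unfolding G_def using that by (auto simp: image_iff)
    have sumG: "sum u (G n) = of_int (g n) * x ^ n" if "n > 0" for n
    proof -
      have "sum u (G n) = (\<Sum>d | d dvd n. of_int (chi4 d * h (n div d)) * x ^ n)"
        unfolding G_def by (subst sum.reindex) (auto simp: inj_on_def u_def mult_ac intro!: sum.cong)
      thus ?thesis by (simp add: g_def sum_distrib_right)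
    qed
    have "dist (sum u (\<Union>n\<in>{1..K}. G n)) T < 1"
    proof (rule F(3))
      show "finite (\<Union>n\<in>{1..K}. G n)" by (auto simp: G_def)
      show "F \<subseteq> (\<Union>n\<in>{1..K}. G n)"
      proof clarify
        fix b a assume ba: "(b, a) \<in> F"
        hence "a \<ge> 1" "b \<ge> 1" using F(2) by (auto simp: A_def)
        hence "a * b \<ge> 1" by simp
        thus "(b, a) \<in> (\<Union>n\<in>{1..K}. G n)" using Gmem[of "a * b" b a] K(2)[OF ba] by auto
      qed
      show "(\<Union>n\<in>{1..K}. G n) \<subseteq> A \<times> A"
      proof clarify
        fix n b a assume "n \<in> {1..K}" "(b, a) \<in> G n"
        hence "a * b > 0" using Gmem[of n b a] by auto
        thus "b \<in> A \<and> a \<in> A" by (auto simp: A_def Suc_le_eq)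
      qed
    qed
    moreover have "sum u (\<Union>n\<in>{1..K}. G n) = (\<Sum>n=1..K. of_int (g n) * x ^ n)"
    proof (subst sum.UNION_disjoint)
      show "\<forall>i\<in>{1..K}. \<forall>j\<in>{1..K}. i \<noteq> j \<longrightarrow> G i \<inter> G j = {}"
        using Gmem by (auto simp: Suc_le_eq)
      show "\<forall>i\<in>{1..K}. finite (G i)" by (auto simp: G_def)
      show "(\<Sum>n=1..K. sum u (G n)) = (\<Sum>n=1..K. of_int (g n) * x ^ n)"
        by (intro sum.cong sumG) auto
    qed simp
    moreover have "real N * x ^ N\<^sup>2 \<le> (\<Sum>n=1..K. of_int (g n) * x ^ n)"
    proof -
      have "real N * x ^ N\<^sup>2 = (\<Sum>m=1..N. x ^ N\<^sup>2)" by simp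
      also have "\<dots> \<le> (\<Sum>m=1..N. of_int (g (m\<^sup>2)) * x ^ m\<^sup>2)"
      proof (rule sum_mono)
        fix m assume m: "m \<in> {1..N}"
        have "x ^ N\<^sup>2 \<le> x ^ m\<^sup>2" using x m by (intro power_decreasing) auto
        moreover have "g (m\<^sup>2) \<ge> 1" using square[of m] m by (simp add: g_def)
        hence "1 * x ^ m\<^sup>2 \<le> of_int (g (m\<^sup>2)) * x ^ m\<^sup>2"
          using x by (intro mult_right_mono) auto
        ultimately show "x ^ N\<^sup>2 \<le> of_int (g (m\<^sup>2)) * x ^ m\<^sup>2" by simp
      qed
      also have "\<dots> = (\<Sum>n\<in>(\<lambda>m. m\<^sup>2) ` {1..N}. of_int (g n) * x ^ n)"
        by (subst sum.reindex) (auto simp: inj_on_def)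
      also have "\<dots> \<le> (\<Sum>n=1..K. of_int (g n) * x ^ n)"
      proof (rule sum_mono2)
        show "(\<lambda>m. m\<^sup>2) ` {1..N} \<subseteq> {1..K}"
          using K(1) by (auto intro: order_trans[OF power_mono])
        show "0 \<le> of_int (g n) * x ^ n" if "n \<in> {1..K} - (\<lambda>m. m\<^sup>2) ` {1..N}" for n
        proof -
          have "g n \<ge> 0" using nonneg[of n] that by (simp add: g_def)
          thus ?thesis using x by simp
        qed
      qed simp
      finally show ?thesis .
    qed
    ultimately show ?thesis using T_le by (simp add: dist_real_def)
  qed
  \<comment> \<open>In the limit \<open>bound\<close> reads N <= 2 C + 2: twice C from Abel
    summation and 1 for each of the two finite approximations. This N is the first to violate
    it.\<close>
  define N where "N = nat (2 * C + 3)"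
  have C0: "C \<ge> 0" using h(2)[of 0] by simp
  have "((\<lambda>x::real. of_nat N * x ^ N\<^sup>2) \<longlongrightarrow> of_nat N * 1 ^ N\<^sup>2) (at_left 1)"
    by (intro tendsto_intros)
  moreover have "\<forall>\<^sub>F x::real in at_left 1. of_nat N * x ^ N\<^sup>2 \<le> 2 * real_of_int C + 2"
    using eventually_at_left_real[of 0 "1::real"] bound by (auto elim!: eventually_mono)
  ultimately have "of_nat N * (1::real) ^ N\<^sup>2 \<le> 2 * real_of_int C + 2"
    using tendsto_upperbound trivial_limit_at_left_real by blast
  thus False using C0 by (simp add: N_def)
qed

section \<open>Character sums modulo p\<close>

lemma abs_periodic_sum_le:
  fixes h :: "nat \<Rightarrow> int" and p :: nat
  assumes h: "\<And>b. \<bar>h b\<bar> \<le> 1" and per: "\<And>b. h (b + p) = h b"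
    and p: "p > 0" and zero: "(\<Sum>b<p. h b) = 0"
  shows "\<bar>\<Sum>b<B. h b\<bar> \<le> int p"
proof (induction B rule: less_induct)
  case (less B)
  show ?case
  proof (cases "B < p")
    case True
    have "\<bar>\<Sum>b<B. h b\<bar> \<le> (\<Sum>b<B. 1)" using h by (intro sum_norm_le[of _ h, simplified] order_trans[OF
        sum_abs] sum_mono) auto
    thus ?thesis using True by simp
  next
    case False
    have "(\<Sum>b<p + n. h b) = (\<Sum>b<p. h b) + (\<Sum>b<n. h (p + b))" for n
      by (induction n) auto
    from this[of "B - p"] have "(\<Sum>b<B. h b) = (\<Sum>b<B - p. h b)" using False zero per by (simp add: add.commute)
    thus ?thesis using less.IH[of "B - p"] False p by simp
  qed
qed

text \<open>Multiplication by a primitive root permutes the residues and negates every term: a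
  primitive root is a nonresidue, since otherwise Euler's criterion would make its order divide (p -
  1)/2.\<close>

lemma sum_Legendre_zero:
  assumes p: "prime p" "2 < p"
  shows "(\<Sum>b<p. Legendre (int b) (int p)) = 0"
proof -
  obtain g where g: "residue_primroot p g"
    using prime_primitive_root_exists[of p] p prime_gt_1_nat by auto
  have cop: "coprime p g" and ord: "ord p g = totient p"
    using g by (auto simp: residue_primroot_def)
  have "Legendre (int g) (int p) = - 1"
  proof (rule ccontr)
    assume "Legendre (int g) (int p) \<noteq> - 1"
    moreover have "\<not> p dvd g" using cop p by (metis coprime_absorb_left not_prime_unit)
    hence "\<not> [int g = 0] (mod int p)" by (simp add: cong_0_iff)
    ultimately have "Legendre (int g) (int p) = 1" by (auto simp: Legendre_def split: if_splits)
    hence "[int g ^ ((p - 1) div 2) = 1] (mod int p)"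
      using euler_criterion[OF p, of "int g"] by (simp add: cong_sym)
    hence "[g ^ ((p - 1) div 2) = 1] (mod p)"
      by (metis cong_int_iff of_nat_1 of_nat_power)
    hence "ord p g dvd (p - 1) div 2" by (rule iffD1[OF ord_divides])
    moreover have "(p - 1) div 2 > 0" using p by simp
    ultimately have "p - 1 \<le> (p - 1) div 2"
      using ord p(1) by (metis dvd_imp_le totient_prime)
    thus False using p by simp
  qed
  have bij: "bij_betw (\<lambda>b. g * b mod p) {..<p} {..<p}"
    unfolding bij_betw_def
  proof
    show inj: "inj_on (\<lambda>b. g * b mod p) {..<p}"
    proof (rule inj_onI)
      fix x y assume xy: "x \<in> {..<p}" "y \<in> {..<p}" "g * x mod p = g * y mod p"
      hence "[x = y] (mod p)"
        using cop by (simp add: cong_def[symmetric] cong_mult_lcancel_nat coprime_commute)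
      thus "x = y" using xy by (simp add: cong_def)
    qed
    show "(\<lambda>b. g * b mod p) ` {..<p} = {..<p}"
      by (rule endo_inj_surj[OF _ _ inj]) (use p in auto)
  qed
  have "(\<Sum>b<p. Legendre (int b) (int p)) = (\<Sum>b<p. Legendre (int (g * b mod p)) (int p))"
    using sum.reindex_bij_betw[OF bij, of "\<lambda>b. Legendre (int b) (int p)"] by simp
  also have "\<dots> = (\<Sum>b<p. Legendre (int g) (int p) * Legendre (int b) (int p))"
  proof (intro sum.cong refl)
    fix b
    have "Legendre (int (g * b mod p)) (int p) = Legendre (int g * int b) (int p)"
      by (intro Legendre_cong) (simp add: cong_def zmod_int)
    thus "Legendre (int (g * b mod p)) (int p) = Legendre (int g) (int p) * Legendre (int b) (int p)"
      using Legendre_mult[OF p] by simp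
  qed
  also have "\<dots> = - (\<Sum>b<p. Legendre (int b) (int p))"
    using \<open>Legendre (int g) (int p) = - 1\<close> by (simp add: sum_negf)
  finally show ?thesis by simp
qed

text \<open>This shows that Pizer's auxiliary prime exists. Suppose not. Then at every prime the convolution of the
  characters modulo 4 and modulo \<open>p\<close> is nonnegative on prime powers and positive on even ones, so its
  Lambert series dominates the sum of \<open>x\<close> to the power \<open>m\<^sup>2\<close> over all \<open>m\<close>, which is unbounded as \<open>x\<close> tends to 1.
  Summing first over the character modulo 4 and then by Abel summation bounds the same series.\<close>

lemma exists_prime_3_mod_4_nonresidue:
  assumes p: "prime p" "p mod 8 = 1"
  shows "\<exists>q. prime q \<and> q mod 4 = 3 \<and> Legendre (int p) (int q) = - 1"
proof (rule ccontr)
  assume none: "\<not> ?thesis"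
  have p2: "2 < p" using p prime_ge_2_nat[of p] by (cases "p = 2") auto
  have p4: "p mod 4 = 1" using p(2) by presburger
  define h where "h = (\<lambda>n. Legendre (int n) (int p))"
  have hm: "h (x * y) = h x * h y" for x y
    using Legendre_mult[OF p(1) p2] by (simp add: h_def)
  have h1: "h 1 = 1"
    using p2 unfolding h_def Legendre_def QuadRes_def by (auto simp: cong_0_iff intro!: exI[of _ 1])
  have h_le: "\<bar>h b\<bar> \<le> 1" for b using Legendre_in[of "int b" "int p"] by (auto simp: h_def)
  have hper: "h (b + p) = h b" for b
    unfolding h_def by (intro Legendre_cong) (simp add: cong_def)
  have h0: "h 0 = 0" by (simp add: h_def Legendre_def)
  have pos: "(\<Sum>i\<le>k. chi4 q ^ i * h q ^ (k - i)) \<ge> (if even k then 1 else 0)"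
    if q: "prime q" for q k
  proof -
    \<comment> \<open>If the second character vanishes at the prime, only the term i = k survives,
      because 0^0 = 1.\<close>
    have one: "(\<Sum>i\<le>k. x ^ i * 0 ^ (k - i)) = x ^ k" for x :: int
    proof -
      have "(\<Sum>i\<le>k. x ^ i * 0 ^ (k - i)) = (\<Sum>i\<in>{k}. x ^ i * 0 ^ (k - i))"
        by (intro sum.mono_neutral_right) auto
      thus ?thesis by simp
    qed
    have pm: "(\<Sum>i\<le>k. (- 1) ^ i) = (if even k then 1 else 0 :: int)" for k :: nat
      by (induction k) auto
    have rev: "(\<Sum>i\<le>k. x ^ i * y ^ (k - i)) = (\<Sum>i\<le>k. y ^ i * x ^ (k - i))" for x y :: int
      by (subst sum.nat_diff_reindex[symmetric, where n = "Suc k", unfolded lessThan_Suc_atMost])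
        (auto simp: mult.commute intro!: sum.cong)
    consider "q = 2" | "q = p" | "q \<noteq> p" "q mod 4 = 1" | "q \<noteq> p" "q mod 4 = 3"
    proof -
      have "q = 2 \<or> odd q" using q prime_odd_nat prime_ge_2_nat[of q] by (cases "q = 2") auto
      hence "q = 2 \<or> q mod 4 = 1 \<or> q mod 4 = 3" by presburger
      thus ?thesis using that by blast
    qed
    thus ?thesis
    proof cases
      case 1
      \<comment> \<open>Here p = 1 modulo 8 enters: with 2 a nonresidue the sum would be -1 at odd
        powers of 2.\<close>
      have "h q = 1" using 1 Legendre_two[OF p(1) p4] p(2) by (simp add: h_def)
      moreover have "chi4 q = 0" using 1 by (simp add: chi4_def)
      ultimately show ?thesis using one[of 1] rev[of 0 1] by simp
    next
      case 2
      have "h q = 0" using 2 by (simp add: h_def Legendre_def cong_0_iff)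
      moreover have "chi4 q = 1" using 2 p4 by (simp add: chi4_def)
      ultimately show ?thesis using one[of 1] by simp
    next
      case 3
      have c: "chi4 q = 1" using 3 by (simp add: chi4_def)
      have "h q \<in> {-1, 0, 1}" using Legendre_in by (simp add: h_def)
      thus ?thesis
      proof (elim insertE emptyE)
        assume "h q = - 1" thus ?thesis using c rev[of 1 "-1"] pm[of k] by simp
      next
        assume "h q = 0" thus ?thesis using c one[of 1] by simp
      next
        assume "h q = 1" thus ?thesis using c by simp
      qed
    next
      case 4
      have c: "chi4 q = - 1" using 4 by (simp add: chi4_def)
      have q2: "2 < q" using 4 q prime_ge_2_nat[of q] by (cases "q = 2") auto
      have "even ((p - 1) div 2 * ((q - 1) div 2))" using p4 by (simp add: even_mult_iff) presburger
      hence "Legendre (int p) (int q) * h q = 1"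
        using Quadratic_Reciprocity[OF p(1) p2 q q2] 4 by (simp add: h_def)
      \<comment> \<open>The only use of the assumption that no auxiliary prime exists. By
        reciprocity it forces h q = 1 at every q = 3 modulo 4, so the local sum alternates between 1
        and 0.\<close>
      moreover have "Legendre (int p) (int q) \<noteq> - 1" using none q 4 by blast
      ultimately have "h q = 1" using Legendre_in[of "int p" "int q"] by auto
      thus ?thesis using c pm[of k] by simp
    qed
  qed
  note conv = divisor_convolution_nonneg[of chi4 h, OF chi4_mult hm _ h1 pos]
  have chi1: "chi4 1 = 1" by (simp add: chi4_def)
  show False
  proof (rule no_nonneg_chi4_convolution[where h = h and C = "int p"])
    show "\<bar>h b\<bar> \<le> 1" for b by (rule h_le)
  next
    fix B
    have "(\<Sum>b=1..B. h b) = (\<Sum>b<Suc B. h b)"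
      using h0 by (simp add: lessThan_Suc_atMost atMost_atLeast0 sum.atLeast_Suc_atMost)
    thus "\<bar>\<Sum>b=1..B. h b\<bar> \<le> int p"
      using abs_periodic_sum_le[of h p, OF h_le hper, of "Suc B"] sum_Legendre_zero[OF p(1) p2] p2
      by (simp add: h_def)
  next
    fix n :: nat assume "n > 0"
    thus "(\<Sum>d | d dvd n. chi4 d * h (n div d)) \<ge> 0"
      using conv[OF chi1, of n] by (auto split: if_splits)
  next
    fix m :: nat assume "m > 0"
    moreover have "\<forall>q. prime q \<longrightarrow> even (multiplicity q (m\<^sup>2))"
      using \<open>m > 0\<close> by (simp add: prime_elem_multiplicity_power_distrib)
    ultimately show "(\<Sum>d | d dvd m\<^sup>2. chi4 d * h (m\<^sup>2 div d)) \<ge> 1"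
      using conv[OF chi1, of "m\<^sup>2"] by (simp only: if_True) simp
  qed
qed

section \<open>Orders and triangular bases\<close>

abbreviation (input) "q0 x \<equiv> fst x"
abbreviation (input) "q1 x \<equiv> fst (snd x)"
abbreviation (input) "q2 x \<equiv> fst (snd (snd x))"
abbreviation (input) "q3 x \<equiv> snd (snd (snd x))"

lemma qscal_coords [simp]:
  "q0 (qscal c x) = c * q0 x" "q1 (qscal c x) = c * q1 x"
  "q2 (qscal c x) = c * q2 x" "q3 (qscal c x) = c * q3 x"
  by (simp_all add: qscal_def case_prod_beta)

lemma qconj_coords [simp]:
  "q0 (qconj x) = q0 x" "q1 (qconj x) = - q1 x" "q2 (qconj x) = - q2 x" "q3 (qconj x) = - q3 x"
  by (simp_all add: qconj_def case_prod_beta)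

lemma qone_coords [simp]: "q0 qone = 1" "q1 qone = 0" "q2 qone = 0" "q3 qone = 0"
  by (simp_all add: qone_def)

lemma qmul_coords [simp]:
  "q0 (qmul a b x y) = q0 x * q0 y + a * q1 x * q1 y + b * q2 x * q2 y - a * b * q3 x * q3 y"
  "q1 (qmul a b x y) = q0 x * q1 y + q1 x * q0 y - b * q2 x * q3 y + b * q3 x * q2 y"
  "q2 (qmul a b x y) = q0 x * q2 y + q2 x * q0 y + a * q1 x * q3 y - a * q3 x * q1 y"
  "q3 (qmul a b x y) = q0 x * q3 y + q3 x * q0 y + q1 x * q2 y - q2 x * q1 y"
  by (simp_all add: qmul_def case_prod_beta)

lemma quat_eq_iff: "(x :: quat) = y \<longleftrightarrow> q0 x = q0 y \<and> q1 x = q1 y \<and> q2 x = q2 y \<and> q3 x = q3 y"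
  by (auto simp: prod_eq_iff)

lemma qscal_simps [simp]: "qscal 1 x = x" "qscal 0 x = 0" "qscal c 0 = 0" "qscal c (qscal d x) = qscal (c * d) x"
  "qscal (- c) x = - qscal c x" "qscal c (- x) = - qscal c x"
  by (auto simp: quat_eq_iff)

lemma qscal_add_right: "qscal c (x + y) = qscal c x + qscal c y"
  and qscal_add_left: "qscal (c + d) x = qscal c x + qscal d x"
  and qscal_diff_left: "qscal (c - d) x = qscal c x - qscal d x"
  by (auto simp: quat_eq_iff algebra_simps)

abbreviation (input) qcomb :: "rat \<Rightarrow> rat \<Rightarrow> rat \<Rightarrow> rat \<Rightarrow> quat \<Rightarrow> quat \<Rightarrow> quat \<Rightarrow> quat" where
  "qcomb c0 c1 c2 c3 u v w \<equiv> qscal c0 qone + qscal c1 u + qscal c2 v + qscal c3 w"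

abbreviation (input) zcomb :: "int \<Rightarrow> int \<Rightarrow> int \<Rightarrow> int \<Rightarrow> quat \<Rightarrow> quat \<Rightarrow> quat \<Rightarrow> quat" where
  "zcomb n0 n1 n2 n3 u v w \<equiv> qcomb (of_int n0) (of_int n1) (of_int n2) (of_int n3) u v w"

abbreviation (input) in_zspan :: "quat \<Rightarrow> quat \<Rightarrow> quat \<Rightarrow> quat \<Rightarrow> bool" where
  "in_zspan x u v w \<equiv> \<exists>n1 n2 n3 :: int. x = qscal (of_int n1) u + qscal (of_int n2) v + qscal (of_int n3) w"

text \<open>The determinant of the imaginary parts, equivalently of the four vectors 1, x, y,
  z.\<close>

definition vdet :: "quat \<Rightarrow> quat \<Rightarrow> quat \<Rightarrow> rat" where
  "vdet x y z = q1 x * (q2 y * q3 z - q3 y * q2 z) - q2 x * (q1 y * q3 z - q3 y * q1 z)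
     + q3 x * (q1 y * q2 z - q2 y * q1 z)"

text \<open>Cramer's rule sees only the imaginary parts; the coefficient \<open>c0\<close> of 1
  absorbs the remaining real part.\<close>

lemma vdet_cramer:
  assumes "vdet x y z \<noteq> 0"
  obtains c0 where "w = qcomb c0 (vdet w y z / vdet x y z) (vdet x w z / vdet x y z) (vdet x y w / vdet x
      y z) x y z"
proof
  define D where "D = vdet x y z"
  have D: "D \<noteq> 0" using assms by (simp add: D_def)
  have "D * q1 w = vdet w y z * q1 x + vdet x w z * q1 y + vdet x y w * q1 z"
    "D * q2 w = vdet w y z * q2 x + vdet x w z * q2 y + vdet x y w * q2 z"
    "D * q3 w = vdet w y z * q3 x + vdet x w z * q3 y + vdet x y w * q3 z"
    unfolding D_def vdet_def by (simp_all add: algebra_simps)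
  hence "q1 w = (vdet w y z * q1 x + vdet x w z * q1 y + vdet x y w * q1 z) / D"
    "q2 w = (vdet w y z * q2 x + vdet x w z * q2 y + vdet x y w * q2 z) / D"
    "q3 w = (vdet w y z * q3 x + vdet x w z * q3 y + vdet x y w * q3 z) / D"
    using D by (metis nonzero_mult_div_cancel_left)+
  thus "w = qcomb (q0 w - vdet w y z / D * q0 x - vdet x w z / D * q0 y - vdet x y w / D * q0 z) (vdet w
      y z / vdet x y z) (vdet x w z / vdet x y z) (vdet x y w / vdet x y z) x y z"
    unfolding quat_eq_iff D_def[symmetric] by (simp add: add_divide_distrib)
qed

section \<open>Rational linear algebra of quaternions\<close>

interpretation quat: vector_space qscal
  by unfold_locales (simp_all add: qscal_add_right qscal_add_left)

definition qbasis :: "quat set" where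
  "qbasis = {(1, 0, 0, 0), (0, 1, 0, 0), (0, 0, 1, 0), (0, 0, 0, 1)}"

interpretation quat: finite_dimensional_vector_space qscal qbasis
proof
  show "finite qbasis" by (simp add: qbasis_def)
  show "quat.independent qbasis"
    unfolding quat.independent_explicit_finite_subsets
  proof (intro allI impI)
    fix S u assume S: "S \<subseteq> qbasis" "finite S" "(\<Sum>v\<in>S. qscal (u v) v) = 0"
    have "(\<Sum>v\<in>qbasis. qscal (if v \<in> S then u v else 0) v) = (\<Sum>v\<in>S. qscal (u v) v)"
      using S(1) by (intro sum.mono_neutral_cong_right) (auto simp: qbasis_def)
    hence "(\<Sum>v\<in>qbasis. qscal (if v \<in> S then u v else 0) v) = 0" using S(3) by simp
    hence "\<forall>v\<in>qbasis. (if v \<in> S then u v else 0) = 0"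
      by (simp add: qbasis_def quat_eq_iff)
    thus "\<forall>v\<in>S. u v = 0" using S(1) by (metis subsetD)
  qed
  show "quat.span qbasis = UNIV"
  proof (intro equalityI subset_UNIV subsetI)
    fix x :: quat
    have "x = qscal (q0 x) (1, 0, 0, 0) + qscal (q1 x) (0, 1, 0, 0) + qscal (q2 x) (0, 0, 1, 0) + qscal
        (q3 x) (0, 0, 0, 1)"
      by (simp add: quat_eq_iff)
    also have "\<dots> \<in> quat.span qbasis"
      by (intro quat.span_add quat.span_scale quat.span_base) (auto simp: qbasis_def)
    finally show "x \<in> quat.span qbasis" .
  qed
qed

text \<open>Links the indexed families of \<open>is_order\<close> and \<open>rank_at_least\<close>
  with independence of sets. Injectivity has to be extracted as well, because a repeated vector
  disappears in the image.\<close>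

lemma independent_family:
  fixes e :: "nat \<Rightarrow> quat"
  assumes ind: "\<And>c :: nat \<Rightarrow> rat. (\<Sum>i<n. qscal (c i) (e i)) = 0 \<Longrightarrow> \<forall>i<n. c i = 0"
  shows "inj_on e {..<n}" "quat.independent (e ` {..<n})"
proof -
  show inj: "inj_on e {..<n}"
  proof (rule inj_onI, rule ccontr)
    fix i j :: nat assume ij: "i \<in> {..<n}" "j \<in> {..<n}" "e i = e j" "i \<noteq> j"
    define c where "c = (\<lambda>k. if k = i then 1 else if k = j then - 1 else 0 :: rat)"
    have "(\<Sum>k<n. qscal (c k) (e k)) = (\<Sum>k\<in>{i, j}. qscal (c k) (e k))"
      using ij by (intro sum.mono_neutral_right) (auto simp: c_def)
    also have "\<dots> = 0" using ij by (simp add: c_def)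
    finally have "\<forall>k<n. c k = 0" by (rule ind)
    thus False using ij by (auto simp: c_def)
  qed
  show "quat.independent (e ` {..<n})"
  proof
    assume "quat.dependent (e ` {..<n})"
    then obtain u where u: "\<exists>v\<in>e ` {..<n}. u v \<noteq> 0" "(\<Sum>v\<in>e ` {..<n}. qscal (u v) v) = 0"
      by (auto simp: quat.dependent_finite)
    from u(2) have "(\<Sum>i<n. qscal (u (e i)) (e i)) = 0" by (simp add: sum.reindex[OF inj])
    hence "\<forall>i<n. u (e i) = 0" by (rule ind)
    thus False using u(1) by auto
  qed
qed

lemma four_independent_span:
  fixes e :: "nat \<Rightarrow> quat"
  assumes ind: "\<And>c :: nat \<Rightarrow> rat. (\<Sum>i<4. qscal (c i) (e i)) = 0 \<Longrightarrow> \<forall>i<4. c i = 0"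
  obtains c where "x = (\<Sum>i<4. qscal (c i) (e i))"
proof -
  note inj = independent_family(1)[where n = 4 and e = e, OF ind] and indep = independent_family(2)[where
      n = 4 and e = e, OF ind]
  have "quat.dim UNIV = card qbasis" by (rule quat.dim_UNIV)
  also have "\<dots> = card (e ` {..<4})" by (simp add: card_image[OF inj] qbasis_def)
  finally have "UNIV \<subseteq> quat.span (e ` {..<4})"
    by (intro quat.card_ge_dim_independent) (use indep in auto)
  hence "x \<in> quat.span (e ` {..<4})" by blast
  then obtain u where "x = (\<Sum>v\<in>e ` {..<4}. qscal (u v) v)"
    by (auto simp: quat.span_finite)
  hence "x = (\<Sum>i<4. qscal (u (e i)) (e i))" by (simp add: sum.reindex[OF inj])
  thus ?thesis by (rule that)
qed

section \<open>Denominators and subgroups of the rationals\<close>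

lemma common_denominator:
  fixes A :: "rat set"
  assumes "finite A"
  obtains D :: int where "D > 0" "\<And>x. x \<in> A \<Longrightarrow> of_int D * x \<in> \<int>"
proof -
  have "\<exists>D::int. D > 0 \<and> (\<forall>x\<in>A. of_int D * x \<in> \<int>)"
    using assms
  proof induction
    case empty
    show ?case by (intro exI[of _ 1]) auto
  next
    case (insert y A)
    then obtain D :: int where D: "D > 0" "\<forall>x\<in>A. of_int D * x \<in> \<int>" by blast
    obtain u v where uv: "y = Fract u v" "v > 0" by (cases y) auto
    have vy: "of_int v * y \<in> \<int>" using uv(2) by (simp add: uv(1) Fract_of_int_quotient)
    have "of_int (D * v) * x \<in> \<int>" if "x \<in> insert y A" for x
    proof (cases "x = y")
      case True
      have "of_int D * (of_int v * y) \<in> \<int>" by (rule Ints_mult[OF Ints_of_int vy])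
      thus ?thesis using True by (simp add: mult.assoc)
    next
      case False
      hence "of_int D * x \<in> \<int>" using D(2) that by auto
      hence "of_int v * (of_int D * x) \<in> \<int>" by (rule Ints_mult[OF Ints_of_int])
      thus ?thesis by (simp add: mult_ac)
    qed
    thus ?case using D uv by (intro exI[of _ "D * v"]) auto
  qed
  thus ?thesis using that by blast
qed

text \<open>Every power of the reduced denominator divides d, so it is 1. This takes the place of
  integral closedness: powers of a norm, or of a scalar in an order, have a common
  denominator.\<close>

lemma Ints_if_powers_bounded_denominator:
  fixes r :: rat and d :: int
  assumes d: "d > 0" and pw: "\<And>n. of_int d * r ^ n \<in> \<int>"
  shows "r \<in> \<int>"
proof -
  obtain u v where uv: "r = Fract u v" "v > 0" "coprime u v"
    by (cases r) auto
  have dv: "v ^ n dvd d" for n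
  proof -
    obtain k where "of_int d * r ^ n = of_int k" using pw[of n] by (auto elim: Ints_cases)
    hence "of_int d * (of_int u) ^ n = (of_int k * of_int v ^ n :: rat)"
      using uv by (simp add: Fract_of_int_quotient power_divide field_simps)
    hence "d * u ^ n = k * v ^ n" by (metis of_int_eq_iff of_int_mult of_int_power)
    hence "v ^ n dvd d * u ^ n" by simp
    moreover have "coprime (v ^ n) (u ^ n)" using uv(3) by (simp add: coprime_commute)
    ultimately show ?thesis by (simp add: coprime_dvd_mult_left_iff)
  qed
  have "v = 1"
  proof (rule ccontr)
    assume "v \<noteq> 1"
    hence "v \<ge> 2" using uv(2) by simp
    hence "2 ^ nat d \<le> v ^ nat d" by (intro power_mono) auto
    also have "\<dots> \<le> d" using dv d by (simp add: zdvd_imp_le)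
    finally have "2 ^ nat d \<le> d" .
    moreover have "int (nat d) < 2 ^ nat d" using of_nat_less_two_power by blast
    ultimately show False using d by simp
  qed
  thus ?thesis using uv by (simp add: Fract_of_int_quotient)
qed

text \<open>A bounded denominator makes the subgroup discrete, so it has a least positive element,
  and division with remainder shows that this element generates.\<close>

lemma cyclic_subgroup_rat:
  fixes G :: "rat set" and D :: int
  assumes diff: "\<And>x y. x \<in> G \<Longrightarrow> y \<in> G \<Longrightarrow> x - y \<in> G"
    and D: "D > 0" "\<And>x. x \<in> G \<Longrightarrow> of_int D * x \<in> \<int>" and ex: "g' \<in> G" "g' > 0"
  obtains g where "g \<in> G" "g > 0" "\<And>x. x \<in> G \<Longrightarrow> \<exists>k::int. x = of_int k * g"
proof -
  have zero: "0 \<in> G" using diff[OF ex(1) ex(1)] by simp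
  have neg: "- x \<in> G" if "x \<in> G" for x using diff[OF zero that] by simp
  have add: "x + y \<in> G" if "x \<in> G" "y \<in> G" for x y using diff[OF that(1) neg[OF that(2)]] by simp
  have natmul: "of_nat n * x \<in> G" if "x \<in> G" for n x
    by (induction n) (use zero add that in \<open>auto simp: distrib_right\<close>)
  have intmul: "of_int k * x \<in> G" if "x \<in> G" for k x
  proof (cases "k \<ge> 0")
    case True
    thus ?thesis using natmul[OF that, of "nat k"] by simp
  next
    case False
    thus ?thesis using neg[OF natmul[OF that, of "nat (- k)"]] by simp
  qed
  define P where "P = (\<lambda>n::nat. n > 0 \<and> (\<exists>x\<in>G. of_int D * x = of_nat n))"
  obtain k where k: "of_int D * g' = of_int k" using D(2)[OF ex(1)] by (auto elim: Ints_cases)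
  have "of_int k > (0 :: rat)" unfolding k[symmetric] using D(1) ex(2) by simp
  hence "P (nat k)" unfolding P_def using k ex(1) by (auto intro!: bexI[of _ g'])
  hence PL: "P (LEAST n. P n)" by (rule LeastI)
  define n where "n = (LEAST n. P n)"
  obtain g where g: "n > 0" "g \<in> G" "of_int D * g = of_nat n" using PL by (auto simp: P_def n_def)
  have gpos: "g > 0"
  proof -
    have "of_int D * g > 0" using g by simp
    thus ?thesis using D(1) by (simp add: zero_less_mult_iff)
  qed
  show ?thesis
  proof (rule that[OF g(2) gpos])
    fix x assume x: "x \<in> G"
    obtain m where m: "of_int D * x = of_int m" using D(2)[OF x] by (auto elim: Ints_cases)
    define k where "k = m div int n"
    have y: "x - of_int k * g \<in> G" using diff intmul x g(2) by blast
    have "of_int D * (x - of_int k * g) = of_int (m mod int n)"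
      using m g(3) by (simp add: k_def algebra_simps minus_mult_div_eq_mod[symmetric] del: minus_mult_div_eq_mod)
    hence eq: "of_int D * (x - of_int k * g) = of_nat (nat (m mod int n))"
      using g(1) by simp
    have "nat (m mod int n) < n" using g(1) by (simp add: nat_less_iff)
    hence "\<not> P (nat (m mod int n))" unfolding n_def by (rule not_less_Least)
    hence "nat (m mod int n) = 0" using eq y by (auto simp: P_def)
    hence "of_int D * (x - of_int k * g) = 0" using eq by simp
    thus "\<exists>k::int. x = of_int k * g" using D(1) by (intro exI[of _ k]) auto
  qed
qed

section \<open>The definite norm form and its integral rings\<close>

locale quat_alg =
  fixes a b :: rat
  assumes a_neg: "a < 0" and b_neg: "b < 0"
begin

abbreviation mul :: "quat \<Rightarrow> quat \<Rightarrow> quat" (infixl "\<star>" 70) where "x \<star> y \<equiv> qmul a b x y"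

definition qdot :: "quat \<Rightarrow> quat \<Rightarrow> rat" where
  "qdot x y = q0 x * q0 y - a * q1 x * q1 y - b * q2 x * q2 y + a * b * q3 x * q3 y"

definition qnorm :: "quat \<Rightarrow> rat" where "qnorm x = fst (x \<star> qconj x)"

lemma qnorm_eq: "qnorm x = (q0 x)\<^sup>2 - a * (q1 x)\<^sup>2 - b * (q2 x)\<^sup>2 + a * b * (q3 x)\<^sup>2"
  by (simp add: qnorm_def power2_eq_square algebra_simps)

lemma qnorm_qdot: "qnorm x = qdot x x"
  by (simp add: qnorm_eq qdot_def power2_eq_square algebra_simps)

lemma qnorm_mul: "qnorm (x \<star> y) = qnorm x * qnorm y"
  unfolding qnorm_eq qmul_coords by (simp add: power2_eq_square algebra_simps)

lemma qnorm_pos: "x \<noteq> 0 \<Longrightarrow> qnorm x > 0"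
proof -
  assume x: "x \<noteq> 0"
  have ab: "a * b > 0" using a_neg b_neg by (simp add: mult_neg_neg)
  have nn: "- a * (q1 x)\<^sup>2 \<ge> 0" "- b * (q2 x)\<^sup>2 \<ge> 0" "a * b * (q3 x)\<^sup>2 \<ge> 0" "(q0 x)\<^sup>2 \<ge> 0"
    using a_neg b_neg ab by (auto simp: mult_nonpos_nonneg)
  have "q0 x \<noteq> 0 \<or> q1 x \<noteq> 0 \<or> q2 x \<noteq> 0 \<or> q3 x \<noteq> 0" using x by (simp add: quat_eq_iff)
  moreover have "- a * (q1 x)\<^sup>2 > 0" if "q1 x \<noteq> 0" using a_neg that by (simp add: mult_neg_pos)
  moreover have "- b * (q2 x)\<^sup>2 > 0" if "q2 x \<noteq> 0" using b_neg that by (simp add: mult_neg_pos)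
  moreover have "a * b * (q3 x)\<^sup>2 > 0" if "q3 x \<noteq> 0" using ab that by simp
  moreover have "(q0 x)\<^sup>2 > 0" if "q0 x \<noteq> 0" using that by simp
  moreover have "qnorm x = (q0 x)\<^sup>2 + (- a * (q1 x)\<^sup>2) + (- b * (q2 x)\<^sup>2) + a * b * (q3 x)\<^sup>2"
    by (simp add: qnorm_eq)
  ultimately show ?thesis using nn by linarith
qed

lemma qnorm_nonneg: "qnorm x \<ge> 0"
  using qnorm_pos[of x] by (cases "x = 0") (auto simp: qnorm_eq)

lemma mul_assoc: "x \<star> y \<star> z = x \<star> (y \<star> z)"
  by (simp add: quat_eq_iff algebra_simps)

lemma mul_add_left: "(x + y) \<star> z = x \<star> z + y \<star> z"
  and mul_add_right: "x \<star> (y + z) = x \<star> y + x \<star> z"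
  and mul_diff_left: "(x - y) \<star> z = x \<star> z - y \<star> z"
  and mul_diff_right: "x \<star> (y - z) = x \<star> y - x \<star> z"
  and mul_scal_left: "qscal c x \<star> y = qscal c (x \<star> y)"
  and mul_scal_right: "x \<star> qscal c y = qscal c (x \<star> y)"
  and mul_neg_left: "(- x) \<star> y = - (x \<star> y)"
  and mul_neg_right: "x \<star> (- y) = - (x \<star> y)"
  and mul_one [simp]: "qone \<star> x = x" "x \<star> qone = x"
  by (auto simp: quat_eq_iff algebra_simps)

definition subring_quat :: "quat set \<Rightarrow> bool" where
  "subring_quat S \<longleftrightarrow> qone \<in> S \<and> (\<forall>x\<in>S. - x \<in> S) \<and> (\<forall>x\<in>S. \<forall>y\<in>S. x + y \<in> S \<and> x \<star> y \<in> S)"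

text \<open>Orders described without a basis: integral norms bound the denominators, and integral
  multiples of i, j, k provide full rank. Rings obtained by gluing can be checked in this form;
  \<open>is_ord_iff\<close> shows that nothing is lost.\<close>

definition ord_like :: "quat set \<Rightarrow> bool" where
  "ord_like S \<longleftrightarrow> subring_quat S \<and> (\<forall>x\<in>S. qnorm x \<in> \<int>) \<and>
     (\<exists>n::int. n > 0 \<and> (0, of_int n, 0, 0) \<in> S \<and> (0, 0, of_int n, 0) \<in> S \<and> (0, 0, 0, of_int n) \<in> S)"

definition is_ord :: "quat set \<Rightarrow> bool" where
  "is_ord Ord \<longleftrightarrow> qone \<in> Ord \<and> (\<forall>x\<in>Ord. \<forall>y\<in>Ord. x \<star> y \<in> Ord) \<and>
     (\<exists>e :: nat \<Rightarrow> quat.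
        (\<forall>c :: nat \<Rightarrow> rat. (\<Sum>i<4. qscal (c i) (e i)) = 0 \<longrightarrow> (\<forall>i<4. c i = 0)) \<and>
        Ord = {(\<Sum>i<4. qscal (of_int (n i)) (e i)) | n :: nat \<Rightarrow> int. True})"

lemma subring_quatD:
  assumes "subring_quat S"
  shows "qone \<in> S" "x \<in> S \<Longrightarrow> - x \<in> S" "x \<in> S \<Longrightarrow> y \<in> S \<Longrightarrow> x + y \<in> S"
    "x \<in> S \<Longrightarrow> y \<in> S \<Longrightarrow> x - y \<in> S" "x \<in> S \<Longrightarrow> y \<in> S \<Longrightarrow> x \<star> y \<in> S" "0 \<in> S"
    "x \<in> S \<Longrightarrow> qscal (of_int k) x \<in> S" "qscal (of_int k) qone \<in> S"
proof -
  show 1: "qone \<in> S" and neg: "\<And>x. x \<in> S \<Longrightarrow> - x \<in> S"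
    and add: "\<And>x y. x \<in> S \<Longrightarrow> y \<in> S \<Longrightarrow> x + y \<in> S"
    and "x \<in> S \<Longrightarrow> y \<in> S \<Longrightarrow> x \<star> y \<in> S"
    using assms by (auto simp: subring_quat_def)
  show "x \<in> S \<Longrightarrow> y \<in> S \<Longrightarrow> x - y \<in> S" using add[of x "- y"] neg[of y] by simp
  show 0: "0 \<in> S" using add[OF 1 neg[OF 1]] by simp
  have nat: "x \<in> S \<Longrightarrow> qscal (of_nat n) x \<in> S" for n x
    by (induction n) (use 0 add in \<open>auto simp: qscal_add_left\<close>)
  show int: "x \<in> S \<Longrightarrow> qscal (of_int k) x \<in> S" for x
  proof (cases "k \<ge> 0")
    case True
    thus "x \<in> S \<Longrightarrow> qscal (of_int k) x \<in> S" using nat[of x "nat k"] by simp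
  next
    case False
    thus "x \<in> S \<Longrightarrow> qscal (of_int k) x \<in> S" using neg[OF nat[of x "nat (- k)"]] by simp
  qed
  show "qscal (of_int k) qone \<in> S" by (rule int[OF 1])
qed

lemma is_ord_imp_ord_like:
  assumes "is_ord S"
  shows "ord_like S"
proof -
  obtain e :: "nat \<Rightarrow> quat" where
    "\<forall>c :: nat \<Rightarrow> rat. (\<Sum>i<4. qscal (c i) (e i)) = 0 \<longrightarrow> (\<forall>i<4. c i = 0)"
    and S: "S = {(\<Sum>i<4. qscal (of_int (n i)) (e i)) | n :: nat \<Rightarrow> int. True}"
    using assms unfolding is_ord_def by (elim conjE exE) 
  hence ind: "\<forall>i<4. c i = 0" if "(\<Sum>i<4. qscal (c i) (e i)) = 0" for c
    using that by blast
  have one: "qone \<in> S" and mult: "\<And>x y. x \<in> S \<Longrightarrow> y \<in> S \<Longrightarrow> x \<star> y \<in> S"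
    using assms by (auto simp: is_ord_def)
  have neg: "- x \<in> S" if x: "x \<in> S" for x
  proof -
    obtain n :: "nat \<Rightarrow> int" where "x = (\<Sum>i<4. qscal (of_int (n i)) (e i))" using x S by blast
    hence "- x = (\<Sum>i<4. qscal (of_int (- n i)) (e i))" by (simp add: sum_negf)
    thus ?thesis unfolding S by (intro CollectI exI[of _ "\<lambda>i. - n i"]) simp
  qed
  have add: "x + y \<in> S" if xy: "x \<in> S" "y \<in> S" for x y
  proof -
    obtain n m :: "nat \<Rightarrow> int" where "x = (\<Sum>i<4. qscal (of_int (n i)) (e i))" "y = (\<Sum>i<4. qscal (of_int (m
        i)) (e i))"
      using xy S by blast
    hence "x + y = (\<Sum>i<4. qscal (of_int (n i + m i)) (e i))" by (simp add: sum.distrib qscal_add_left)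
    thus ?thesis unfolding S by (intro CollectI exI[of _ "\<lambda>i. n i + m i"]) simp
  qed
  have ring: "subring_quat S" using one mult neg add by (auto simp: subring_quat_def)
  define A where "A = {a, b} \<union> (\<lambda>i. q0 (e i)) ` {..<4} \<union> (\<lambda>i. q1 (e i)) ` {..<4}
      \<union> (\<lambda>i. q2 (e i)) ` {..<4} \<union> (\<lambda>i. q3 (e i)) ` {..<4}"
  obtain D :: int where D: "D > 0" "\<And>x. x \<in> A \<Longrightarrow> of_int D * x \<in> \<int>"
    by (rule common_denominator[of A]) (auto simp: A_def)
  have coords: "of_int D * q0 x \<in> \<int>" "of_int D * q1 x \<in> \<int>" "of_int D * q2 x \<in> \<int>" "of_int D * q3 x \<in> \<int>"
    if xS: "x \<in> S" for x
  proof -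
    obtain n :: "nat \<Rightarrow> int" where x: "x = (\<Sum>i<4. qscal (of_int (n i)) (e i))" using xS S by blast
    have eqs: "of_int D * q0 x = (\<Sum>i<4. of_int (n i) * (of_int D * q0 (e i)))"
      "of_int D * q1 x = (\<Sum>i<4. of_int (n i) * (of_int D * q1 (e i)))"
      "of_int D * q2 x = (\<Sum>i<4. of_int (n i) * (of_int D * q2 (e i)))"
      "of_int D * q3 x = (\<Sum>i<4. of_int (n i) * (of_int D * q3 (e i)))"
      by (simp_all add: x fst_sum snd_sum sum_distrib_left mult_ac)
    show "of_int D * q0 x \<in> \<int>" "of_int D * q1 x \<in> \<int>" "of_int D * q2 x \<in> \<int>" "of_int D * q3 x \<in> \<int>"
      unfolding eqs by (intro Ints_sum Ints_mult Ints_of_int D(2); auto simp: A_def)+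
  qed
  have aD: "of_int D * a \<in> \<int>" "of_int D * b \<in> \<int>" using D(2) by (auto simp: A_def)
  \<comment> \<open>The fourth power is dictated by the term a b x3^2: one factor D each for a and
    b, and two for the squared coordinate.\<close>
  have bd: "of_int (D ^ 4) * qnorm x \<in> \<int>" if "x \<in> S" for x
  proof -
    let ?D = "of_int D :: rat"
    have poly: "d\<^sup>2 * p\<^sup>2 - d * u * q\<^sup>2 - d * v * r\<^sup>2 + u * v * s\<^sup>2 \<in> \<int>"
      if "d \<in> \<int>" "p \<in> \<int>" "q \<in> \<int>" "r \<in> \<int>" "s \<in> \<int>" "u \<in> \<int>" "v \<in> \<int>" for d p q r s u v :: rat
      using that by (intro Ints_add Ints_diff Ints_mult Ints_power)
    have "of_int (D ^ 4) * qnorm x = ?D\<^sup>2 * (?D * q0 x)\<^sup>2 - ?D * (?D * a) * (?D * q1 x)\<^sup>2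
       - ?D * (?D * b) * (?D * q2 x)\<^sup>2 + (?D * a) * (?D * b) * (?D * q3 x)\<^sup>2"
      unfolding qnorm_eq of_int_power by (simp add: eval_nat_numeral algebra_simps)
    also have "\<dots> \<in> \<int>" by (rule poly) (use coords[OF that] aD in auto)
    finally show ?thesis .
  qed
  \<comment> \<open>Norms are multiplicative, so each power of \<open>qnorm x\<close> is again a
    norm from S and has its denominator bounded by D^4.\<close>
  have norm: "qnorm x \<in> \<int>" if "x \<in> S" for x
  proof (rule Ints_if_powers_bounded_denominator[of "D ^ 4"])
    fix n
    have "\<exists>y\<in>S. qnorm y = qnorm x ^ n"
    proof (induction n)
      case 0
      show ?case using one by (intro bexI[of _ qone]) (auto simp: qnorm_eq)
    next
      case (Suc n)
      then obtain y where "y \<in> S" "qnorm y = qnorm x ^ n" by blast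
      thus ?case using mult[OF that] by (intro bexI[of _ "x \<star> y"]) (auto simp: qnorm_mul)
    qed
    thus "of_int (D ^ 4) * qnorm x ^ n \<in> \<int>" using bd by metis
  qed (use D in simp)
  have "\<exists>n::int. n > 0 \<and> qscal (of_int n) x \<in> S" for x
  proof -
    obtain c where x: "x = (\<Sum>i<4. qscal (c i) (e i))" using four_independent_span[OF ind] by blast
    obtain n :: int where n: "n > 0" "\<And>x. x \<in> c ` {..<4} \<Longrightarrow> of_int n * x \<in> \<int>"
      by (rule common_denominator[of "c ` {..<4}"]) auto
    have "\<exists>k::int. of_int n * c i = of_int k" if "i < 4" for i
      using n(2)[of "c i"] that by (auto elim: Ints_cases)
    then obtain k :: "nat \<Rightarrow> int" where k: "\<And>i. i < 4 \<Longrightarrow> of_int n * c i = of_int (k i)" by metis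
    have "qscal (of_int n) x = (\<Sum>i<4. qscal (of_int n * c i) (e i))"
      by (simp add: x quat.scale_sum_right)
    also have "\<dots> = (\<Sum>i<4. qscal (of_int (k i)) (e i))" using k by (intro sum.cong) auto
    also have "\<dots> \<in> S" unfolding S by blast
    finally show ?thesis using n(1) by blast
  qed
  hence "\<forall>x. \<exists>n::int. n > 0 \<and> qscal (of_int n) x \<in> S" by blast
  then obtain n :: "quat \<Rightarrow> int" where "\<forall>x. n x > 0 \<and> qscal (of_int (n x)) x \<in> S"
    by (rule choice[elim_format]) blast
  hence n: "n x > 0" "qscal (of_int (n x)) x \<in> S" for x by blast+
  let ?i = "(0, 1, 0, 0) :: quat" and ?j = "(0, 0, 1, 0) :: quat" and ?k = "(0, 0, 0, 1) :: quat"
  define N where "N = n ?i * n ?j * n ?k"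
  have N: "N > 0" using n(1) by (simp add: N_def)
  have "qscal (of_int N) ?i \<in> S" "qscal (of_int N) ?j \<in> S" "qscal (of_int N) ?k \<in> S"
    using subring_quatD(7)[OF ring n(2)[of ?i], of "n ?j * n ?k"]
      subring_quatD(7)[OF ring n(2)[of ?j], of "n ?i * n ?k"]
      subring_quatD(7)[OF ring n(2)[of ?k], of "n ?i * n ?j"] by (simp_all add: N_def mult_ac)
  hence "(0, of_int N, 0, 0) \<in> S" "(0, 0, of_int N, 0) \<in> S" "(0, 0, 0, of_int N) \<in> S"
    by (simp_all add: qscal_def)
  thus ?thesis using ring norm N unfolding ord_like_def by blast
qed

text \<open>A basis in Hermite normal form starting with 1. Its determinant is the product of the
  diagonal entries, and cosets of a suborder can be counted by division with remainder in each
  diagonal direction.\<close>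

definition tri_basis :: "quat set \<Rightarrow> quat \<Rightarrow> quat \<Rightarrow> quat \<Rightarrow> bool" where
  "tri_basis S e1 e2 e3 \<longleftrightarrow> q1 e1 > 0 \<and> q2 e1 = 0 \<and> q3 e1 = 0 \<and> q2 e2 > 0 \<and> q3 e2 = 0 \<and> q3 e3 > 0 \<and>
     S = {zcomb n0 n1 n2 n3 e1 e2 e3
          | n0 n1 n2 n3 :: int. True}"

text \<open>The trace is the polarization N(x + 1) - N(x) - 1 of the norm.\<close>

lemma trace_int:
  assumes "subring_quat S" "\<And>x. x \<in> S \<Longrightarrow> qnorm x \<in> \<int>" "x \<in> S"
  shows "2 * q0 x \<in> \<int>"
proof -
  have "qnorm (x + qone) - qnorm x - 1 \<in> \<int>"
    using assms subring_quatD[OF assms(1)] by (intro Ints_diff) auto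
  thus ?thesis by (simp add: qnorm_eq power2_eq_square algebra_simps)
qed

lemma ord_like_imp_tri_basis:
  assumes "ord_like S"
  obtains e1 e2 e3 where "tri_basis S e1 e2 e3"
proof -
  have ring: "subring_quat S" and norm: "\<And>x. x \<in> S \<Longrightarrow> qnorm x \<in> \<int>"
    using assms by (auto simp: ord_like_def)
  note R = subring_quatD[OF ring]
  obtain n :: int where n: "n > 0" "(0, of_int n, 0, 0) \<in> S" "(0, 0, of_int n, 0) \<in> S" "(0, 0, 0, of_int n) \<in> S"
    using assms by (auto simp: ord_like_def)
  have tr: "2 * q0 x \<in> \<int>" if "x \<in> S" for x
    by (rule trace_int[OF ring norm that])
  \<comment> \<open>Each imaginary coordinate of x is read off from the trace of x times n i, n j or
    n k; the constants d clears are what must then be divided out.\<close>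
  obtain d :: int where d: "d > 0" "\<And>x. x \<in> {inverse a, inverse b, inverse (a * b)} \<Longrightarrow> of_int d * x \<in> \<int>"
    by (rule common_denominator[of "{inverse a, inverse b, inverse (a * b)}"]) auto
  define D where "D = 2 * d * n"
  have D: "D > 0" using d n by (simp add: D_def)
  have coords: "of_int D * q1 x \<in> \<int>" "of_int D * q2 x \<in> \<int>" "of_int D * q3 x \<in> \<int>" if "x \<in> S" for x
  proof -
    have eqs: "of_int D * q1 x = (of_int d * inverse a) * (2 * q0 (x \<star> (0, of_int n, 0, 0)))"
      "of_int D * q2 x = (of_int d * inverse b) * (2 * q0 (x \<star> (0, 0, of_int n, 0)))"
      "of_int D * q3 x = - (of_int d * inverse (a * b)) * (2 * q0 (x \<star> (0, 0, 0, of_int n)))"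
      using a_neg b_neg by (simp_all add: D_def field_simps)
    show "of_int D * q1 x \<in> \<int>" "of_int D * q2 x \<in> \<int>" "of_int D * q3 x \<in> \<int>"
      unfolding eqs by (intro Ints_mult Ints_minus d(2) tr R(5) that n; simp)+
  qed
  \<comment> \<open>A scalar in S is an integer: twice each of its powers is a trace from S, so its
    powers have bounded denominators.\<close>
  have ints0: "q0 x \<in> \<int>" if "x \<in> S" "q1 x = 0" "q2 x = 0" "q3 x = 0" for x
  proof -
    have "of_int 2 * q0 x ^ n \<in> \<int>" for n
    proof -
      have eq: "qnorm x = (q0 x)\<^sup>2" using that by (simp add: qnorm_eq)
      have "\<exists>y\<in>S. q0 y = q0 x ^ n"
      proof (induction n)
        case 0 show ?case using R(1) by (intro bexI[of _ qone]) auto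
      next
        case (Suc n)
        then obtain y where "y \<in> S" "q0 y = q0 x ^ n" by blast
        thus ?case using R(5)[OF that(1)] that by (intro bexI[of _ "x \<star> y"]) auto
      qed
      thus ?thesis using tr by force
    qed
    thus ?thesis by (rule Ints_if_powers_bounded_denominator[of 2, rotated]) auto
  qed
  \<comment> \<open>Generators are chosen from the last coordinate downwards, each on the subgroup
    where all later coordinates vanish.\<close>
  obtain g3 where g3: "g3 \<in> q3 ` S" "g3 > 0" "\<And>x. x \<in> q3 ` S \<Longrightarrow> \<exists>k::int. x = of_int k * g3"
  proof (rule cyclic_subgroup_rat[of "q3 ` S" D "of_int n"])
    show "x - y \<in> q3 ` S" if xy: "x \<in> q3 ` S" "y \<in> q3 ` S" for x y
    proof -
      obtain u v where "x = q3 u" "y = q3 v" "u \<in> S" "v \<in> S" using xy by auto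
      thus ?thesis using R(4) by (intro image_eqI[of _ _ "u - v"]) auto
    qed
    show "of_int n \<in> q3 ` S" using n(4) by (force simp: image_iff)
  qed (use D coords n in auto)
  obtain g2 where g2: "g2 \<in> q2 ` {x \<in> S. q3 x = 0}" "g2 > 0"
      "\<And>x. x \<in> q2 ` {x \<in> S. q3 x = 0} \<Longrightarrow> \<exists>k::int. x = of_int k * g2"
  proof (rule cyclic_subgroup_rat[of "q2 ` {x \<in> S. q3 x = 0}" D "of_int n"])
    show "x - y \<in> q2 ` {x \<in> S. q3 x = 0}" if xy: "x \<in> q2 ` {x \<in> S. q3 x = 0}" "y \<in> q2 ` {x \<in> S. q3 x = 0}" for x y
    proof -
      obtain u v where "x = q2 u" "y = q2 v" "u \<in> S" "v \<in> S" "q3 u = 0" "q3 v = 0" using xy by auto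
      thus ?thesis using R(4) by (intro image_eqI[of _ _ "u - v"]) auto
    qed
    show "of_int n \<in> q2 ` {x \<in> S. q3 x = 0}" using n(3) by (force simp: image_iff)
  qed (use D coords n in auto)
  obtain g1 where g1: "g1 \<in> q1 ` {x \<in> S. q2 x = 0 \<and> q3 x = 0}" "g1 > 0"
      "\<And>x. x \<in> q1 ` {x \<in> S. q2 x = 0 \<and> q3 x = 0} \<Longrightarrow> \<exists>k::int. x = of_int k * g1"
  proof (rule cyclic_subgroup_rat[of "q1 ` {x \<in> S. q2 x = 0 \<and> q3 x = 0}" D "of_int n"])
    show "x - y \<in> q1 ` {x \<in> S. q2 x = 0 \<and> q3 x = 0}"
      if xy: "x \<in> q1 ` {x \<in> S. q2 x = 0 \<and> q3 x = 0}" "y \<in> q1 ` {x \<in> S. q2 x = 0 \<and> q3 x = 0}" for x y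
    proof -
      obtain u v where "x = q1 u" "y = q1 v" "u \<in> S" "v \<in> S" "q3 u = 0" "q3 v = 0" "q2 u = 0" "q2 v = 0"
          using xy by auto
      thus ?thesis using R(4) by (intro image_eqI[of _ _ "u - v"]) auto
    qed
    show "of_int n \<in> q1 ` {x \<in> S. q2 x = 0 \<and> q3 x = 0}" using n(2) by (force simp: image_iff)
  qed (use D coords n in auto)
  obtain e1 where e1: "e1 \<in> S" "q1 e1 = g1" "q2 e1 = 0" "q3 e1 = 0" using g1(1) by auto
  obtain e2 where e2: "e2 \<in> S" "q2 e2 = g2" "q3 e2 = 0" using g2(1) by auto
  obtain e3 where e3: "e3 \<in> S" "q3 e3 = g3" using g3(1) by auto
  have all: "\<exists>n0 n1 n2 n3 :: int. x = zcomb n0 n1 n2 n3 e1 e2 e3"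
    if x: "x \<in> S" for x
  proof -
    obtain n3 :: int where n3: "q3 x = of_int n3 * g3" using g3(3) x by blast
    define y where "y = x - qscal (of_int n3) e3"
    have y: "y \<in> S" "q3 y = 0" using x R e3 n3 by (auto simp: y_def)
    obtain n2 :: int where n2: "q2 y = of_int n2 * g2" using g2(3) y by blast
    define z where "z = y - qscal (of_int n2) e2"
    have z: "z \<in> S" "q3 z = 0" "q2 z = 0" using y R e2 n2 by (auto simp: z_def)
    obtain n1 :: int where n1: "q1 z = of_int n1 * g1" using g1(3) z by blast
    define w where "w = z - qscal (of_int n1) e1"
    have w: "w \<in> S" "q3 w = 0" "q2 w = 0" "q1 w = 0" using z R e1 n1 by (auto simp: w_def)
    obtain n0 where n0: "q0 w = of_int n0" using ints0[OF w(1)] w by (auto elim: Ints_cases)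
    have "w = qscal (of_int n0) qone" using n0 w by (simp add: quat_eq_iff)
    hence "x = zcomb n0 n1 n2 n3 e1 e2 e3"
      by (simp add: w_def z_def y_def algebra_simps)
    thus ?thesis by blast
  qed
  have mem: "zcomb n0 n1 n2 n3 e1 e2 e3 \<in> S"
    for n0 n1 n2 n3 :: int
    by (intro R(3) R(7) R(8) e1(1) e2(1) e3(1))
  have "S = {zcomb n0 n1 n2 n3 e1 e2 e3
          | n0 n1 n2 n3 :: int. True}" (is "S = ?T")
  proof (intro equalityI subsetI)
    fix x assume "x \<in> S"
    with all show "x \<in> ?T" by simp
  next
    fix x assume "x \<in> ?T"
    then obtain n0 n1 n2 n3 :: int where "x = zcomb n0 n1 n2 n3 e1 e2 e3"
      by (elim CollectE exE conjE)
    with mem show "x \<in> S" by simp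
  qed
  hence "tri_basis S e1 e2 e3" unfolding tri_basis_def using e1 e2 e3 g1(2) g2(2) g3(2) by simp
  thus ?thesis by (rule that)
qed

lemma ord_like_imp_is_ord:
  assumes "ord_like S"
  shows "is_ord S"
proof -
  obtain e1 e2 e3 where t: "tri_basis S e1 e2 e3" using ord_like_imp_tri_basis[OF assms] .
  have ring: "subring_quat S" using assms by (simp add: ord_like_def)
  define e where "e = (\<lambda>i::nat. if i = 0 then qone else if i = 1 then e1 else if i = 2 then e2 else e3)"
  have sum4: "(\<Sum>i<4. f i) = f 0 + f 1 + f 2 + f 3" for f :: "nat \<Rightarrow> quat"
    by (simp add: eval_nat_numeral)
  have ind: "\<forall>i<4. c i = 0" if "(\<Sum>i<4. qscal (c i) (e i)) = 0" for c :: "nat \<Rightarrow> rat"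
  proof -
    have "qcomb (c 0) (c 1) (c 2) (c 3) e1 e2 e3 = 0"
      using that by (simp add: sum4 e_def)
    hence eqs: "c 0 + c 1 * q0 e1 + c 2 * q0 e2 + c 3 * q0 e3 = 0" "c 1 * q1 e1 + c 2 * q1 e2 + c 3 * q1 e3 = 0"
      "c 2 * q2 e2 + c 3 * q2 e3 = 0" "c 3 * q3 e3 = 0"
      using t by (auto simp: tri_basis_def quat_eq_iff)
    have "c 3 = 0" "c 2 = 0" "c 1 = 0" "c 0 = 0" using eqs t by (auto simp: tri_basis_def)
    thus ?thesis by (auto simp: less_Suc_eq eval_nat_numeral)
  qed
  have "S = {(\<Sum>i<4. qscal (of_int (n i)) (e i)) | n :: nat \<Rightarrow> int. True}" (is "_ = ?R")
  proof (intro equalityI subsetI)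
    fix x assume "x \<in> S"
    then obtain n0 n1 n2 n3 :: int where
      x: "x = zcomb n0 n1 n2 n3 e1 e2 e3"
      using t by (auto simp: tri_basis_def)
    define n where "n = (\<lambda>i::nat. if i = 0 then n0 else if i = 1 then n1 else if i = 2 then n2 else n3)"
    have "x = (\<Sum>i<4. qscal (of_int (n i)) (e i))" by (simp add: sum4 e_def n_def x)
    thus "x \<in> ?R" by blast
  next
    fix x assume "x \<in> ?R"
    then obtain n :: "nat \<Rightarrow> int" where "x = (\<Sum>i<4. qscal (of_int (n i)) (e i))" by blast
    hence "x = zcomb (n 0) (n 1) (n 2) (n 3) e1 e2 e3"
      by (simp add: sum4 e_def)
    thus "x \<in> S" using t unfolding tri_basis_def by blast
  qed
  thus ?thesis using ring ind unfolding is_ord_def subring_quat_def by blast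
qed

lemma is_ord_iff: "is_ord S \<longleftrightarrow> ord_like S"
  using is_ord_imp_ord_like ord_like_imp_is_ord by blast

end

section \<open>Localization of maximal orders\<close>

text \<open>For prime l, the localization of the integers at l as a subring of the rationals, so
  that local and global orders live in one and the same algebra.\<close>

definition loc :: "nat \<Rightarrow> rat set" where
  "loc l = {of_int n / of_int d | n d :: int. \<not> int l dvd d}"

lemma locI: "\<not> int l dvd d \<Longrightarrow> of_int d * x \<in> \<int> \<Longrightarrow> x \<in> loc l"
proof -
  assume d: "\<not> int l dvd d" and "of_int d * x \<in> \<int>"
  then obtain n where n: "of_int d * x = of_int n" by (auto elim: Ints_cases)
  have "d \<noteq> 0" using d by auto
  hence "x = of_int n / of_int d" using n by (simp add: field_simps)
  thus ?thesis using d unfolding loc_def by blast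
qed

lemma locE:
  assumes "x \<in> loc l"
  obtains d n :: int where "\<not> int l dvd d" "of_int d * x = of_int n"
proof -
  obtain n d :: int where nd: "x = of_int n / of_int d" "\<not> int l dvd d" using assms by (auto simp: loc_def)
  have "d \<noteq> 0" using nd by auto
  hence "of_int d * x = of_int n" using nd by simp
  thus ?thesis using that nd by blast
qed

lemma loc_of_int [simp]: "prime l \<Longrightarrow> of_int n \<in> loc l"
  by (rule locI[of _ 1]) (auto dest: prime_gt_1_nat)

lemma loc_Ints: "prime l \<Longrightarrow> x \<in> \<int> \<Longrightarrow> x \<in> loc l"
  by (auto elim!: Ints_cases)

lemma loc_simps [simp]: "prime l \<Longrightarrow> 0 \<in> loc l" "prime l \<Longrightarrow> 1 \<in> loc l" "prime l \<Longrightarrow> numeral k \<in> loc l"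
  using loc_of_int[of l 0] loc_of_int[of l 1] loc_of_int[of l "numeral k"] by simp_all

lemma loc_add: assumes "prime l" "x \<in> loc l" "y \<in> loc l" shows "x + y \<in> loc l"
proof -
  obtain d n e m where *: "\<not> int l dvd d" "of_int d * x = of_int n" "\<not> int l dvd e" "of_int e * y = of_int m"
    using assms by (metis locE)
  show ?thesis
  proof (rule locI[of _ "d * e"])
    show "\<not> int l dvd d * e" using assms(1) * by (simp add: prime_dvd_mult_iff)
    have "of_int (d * e) * (x + y) = of_int e * (of_int d * x) + of_int d * (of_int e * y)"
      by (simp add: algebra_simps)
    also have "\<dots> \<in> \<int>" unfolding * by (intro Ints_add Ints_mult Ints_of_int)
    finally show "of_int (d * e) * (x + y) \<in> \<int>" .
  qed
qed

lemma loc_mult: assumes "prime l" "x \<in> loc l" "y \<in> loc l" shows "x * y \<in> loc l"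
proof -
  obtain d n e m where *: "\<not> int l dvd d" "of_int d * x = of_int n" "\<not> int l dvd e" "of_int e * y = of_int m"
    using assms by (metis locE)
  show ?thesis
  proof (rule locI[of _ "d * e"])
    show "\<not> int l dvd d * e" using assms(1) * by (simp add: prime_dvd_mult_iff)
    have "of_int (d * e) * (x * y) = (of_int d * x) * (of_int e * y)"
      by (simp add: algebra_simps)
    also have "\<dots> \<in> \<int>" unfolding * by (intro Ints_mult Ints_of_int)
    finally show "of_int (d * e) * (x * y) \<in> \<int>" .
  qed
qed

lemma loc_uminus: assumes "prime l" "x \<in> loc l" shows "- x \<in> loc l"
  using loc_mult[OF assms(1) loc_of_int[OF assms(1), of "-1"] assms(2)] by simp

lemma loc_diff: assumes "prime l" "x \<in> loc l" "y \<in> loc l" shows "x - y \<in> loc l"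
  using loc_add[OF assms(1,2) loc_uminus[OF assms(1,3)]] by simp

lemma loc_power: assumes "prime l" "x \<in> loc l" shows "x ^ n \<in> loc l"
  by (induction n) (use assms in \<open>auto intro: loc_mult\<close>)

lemmas loc_intros = loc_add loc_diff loc_mult loc_uminus loc_power

lemma loc_inverse_of_int: "\<not> int l dvd d \<Longrightarrow> 1 / of_int d \<in> loc l"
  by (rule locI[of _ d]) (cases "d = 0", auto)

text \<open>The denominator is both prime to l and a power of l.\<close>

lemma Ints_if_loc_power:
  assumes l: "prime l" and x: "x \<in> loc l" and k: "of_int (int l ^ k) * x \<in> \<int>"
  shows "x \<in> \<int>"
proof -
  obtain d n where dn: "\<not> int l dvd d" "of_int d * x = of_int n" using locE[OF x] .
  obtain m where m: "of_int (int l ^ k) * x = of_int m" using k by (auto elim: Ints_cases)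
  have l': "prime (int l)" using l by simp
  have l0: "int l \<noteq> 0" using l by (auto dest: prime_gt_0_nat)
  have "of_int (d * m) = (of_int (int l ^ k * n) :: rat)"
    unfolding of_int_mult m[symmetric] dn(2)[symmetric] by simp
  hence "d * m = int l ^ k * n" by (simp only: of_int_eq_iff)
  hence "int l ^ k dvd d * m" by simp
  moreover have "coprime (int l ^ k) d" using l' dn(1) by (simp add: prime_imp_coprime)
  ultimately have "int l ^ k dvd m" by (simp add: coprime_dvd_mult_right_iff)
  then obtain q where "m = int l ^ k * q" by blast
  hence "of_int (int l ^ k) * x = of_int (int l ^ k) * of_int q" using m by simp
  hence "x = of_int q" using l0 by simp
  thus ?thesis by simp
qed

lemma loc_dvd:
  assumes l: "prime l" and x: "x \<in> loc l" and n: "of_int n = of_int (int l) * x"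
  shows "int l dvd n"
proof -
  obtain d m where dm: "\<not> int l dvd d" "of_int d * x = of_int m" using locE[OF x] .
  have "of_int (d * n) = (of_int (int l * m) :: rat)"
    unfolding of_int_mult n dm(2)[symmetric] by simp
  hence "d * n = int l * m" by (simp only: of_int_eq_iff)
  hence "int l dvd d * n" by simp
  thus ?thesis using dm(1) l by (simp add: prime_dvd_mult_iff)
qed

lemma loc_valuation:
  assumes l: "prime l" and x: "x \<in> loc l" "x \<noteq> 0"
  obtains k n d where "x = of_int (int l) ^ k * (of_int n / of_int d)" "\<not> int l dvd n" "\<not> int l dvd d"
proof -
  obtain m d :: int where md: "x = of_int m / of_int d" "\<not> int l dvd d" using x by (auto simp: loc_def)
  have m0: "m \<noteq> 0" using md x(2) by auto
  have "\<not> is_unit (int l)" using l by (auto dest: prime_gt_1_nat)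
  then obtain n where "m = int l ^ multiplicity (int l) m * n" "\<not> int l dvd n"
    using multiplicity_decompose'[OF m0] by metis
  hence "x = of_int (int l) ^ multiplicity (int l) m * (of_int n / of_int d)"
    using md by (metis of_int_mult of_int_power times_divide_eq_right)
  thus ?thesis using that \<open>\<not> int l dvd n\<close> md(2) by blast
qed

lemma loc_divide_prime_power:
  assumes l: "prime l" and "j \<ge> k" "\<not> int l dvd n" "\<not> int l dvd e"
  shows "(of_int (int l) ^ j * (of_int m / of_int e)) / (of_int (int l) ^ k * (of_int n / of_int d)) \<in> loc l"
proof -
  have "(of_int (int l) :: rat) \<noteq> 0" using l by (auto dest: prime_gt_0_nat)
  hence "(of_int (int l) ^ j * (of_int m / of_int e)) / (of_int (int l) ^ k * (of_int n / of_int d))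
      = of_int (int l) ^ (j - k) * of_int m * of_int d * (1 / of_int e) * (1 / of_int n :: rat)"
    using assms(2) by (simp add: power_diff)
  also have "\<dots> \<in> loc l" using assms by (intro loc_intros loc_of_int loc_inverse_of_int)
  finally show ?thesis .
qed

section \<open>Local orders and conjugation of maximal orders\<close>

context quat_alg
begin

text \<open>The reduced discriminant of an order with basis \<open>1, x, y, z\<close> is \<open>trip x y z\<close> up to sign.\<close>

definition trip :: "quat \<Rightarrow> quat \<Rightarrow> quat \<Rightarrow> rat" where "trip x y z = 4 * a * b * vdet x y z"

text \<open>Trace formulas show that \<open>trip\<close> is integral on orders and invariant under
  conjugation. The four variants expose each argument in turn for pairing with a dual
  element.\<close>

lemma trip_eq_trace:
  "trip x y z = - 2 * q0 ((x \<star> y - y \<star> x) \<star> z)" "trip x y z = - 2 * q0 (x \<star> (y \<star> z - z \<star> y))"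
  "trip x y z = - 2 * q0 (y \<star> (z \<star> x - x \<star> z))" "trip x y z = - 2 * q0 (z \<star> (x \<star> y - y \<star> x))"
  by (simp_all add: trip_def vdet_def algebra_simps)

lemma ab_nonzero: "a * b \<noteq> 0"
  using a_neg b_neg by simp

lemma trip_zero_iff: "trip x y z = 0 \<longleftrightarrow> vdet x y z = 0"
  using a_neg b_neg by (simp add: trip_def)

lemma trip_cramer:
  assumes "trip x y z \<noteq> 0"
  obtains c0 where "w = qcomb c0 (trip w y z / trip x y z) (trip x w z / trip x y z) (trip x y w / trip x
      y z) x y z"
proof -
  have nz: "vdet x y z \<noteq> 0" using assms trip_zero_iff by blast
  have eq: "trip u v w / trip x y z = vdet u v w / vdet x y z" for u v w
    using a_neg b_neg by (simp add: trip_def)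
  show ?thesis using vdet_cramer[OF nz, of w] that unfolding eq by blast
qed

text \<open>A ring over the localized integers with integral norms; full rank is supplied
  separately, by a triple with nonzero \<open>trip\<close>.\<close>

definition local_order :: "nat \<Rightarrow> quat set \<Rightarrow> bool" where
  "local_order l R \<longleftrightarrow> subring_quat R \<and> (\<forall>c\<in>loc l. \<forall>x\<in>R. qscal c x \<in> R) \<and> (\<forall>x\<in>R. qnorm x \<in> loc l)"

lemma trace_loc:
  assumes "prime l" "qnorm x \<in> loc l" "qnorm (x + qone) \<in> loc l"
  shows "2 * q0 x \<in> loc l"
proof -
  have "qnorm (x + qone) - qnorm x - 1 \<in> loc l"
    using assms by (intro loc_diff) auto
  thus ?thesis by (simp add: qnorm_eq power2_eq_square algebra_simps)
qed

lemma local_order_trace: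
  assumes "prime l" "local_order l R" "x \<in> R"
  shows "2 * q0 x \<in> loc l"
  using assms subring_quatD[of R] unfolding local_order_def by (intro trace_loc) auto

text \<open>A lattice of unit discriminant equals its trace dual. The Cramer coordinates of w are
  traces of w against commutators in R, divided by a unit.\<close>

lemma local_order_self_dual:
  assumes l: "prime l" and R: "local_order l R" and xyz: "x \<in> R" "y \<in> R" "z \<in> R"
    and unit: "trip x y z \<noteq> 0" "1 / trip x y z \<in> loc l"
    and dual: "\<And>c. c \<in> R \<Longrightarrow> 2 * q0 (w \<star> c) \<in> loc l"
  shows "w \<in> R"
proof -
  have ring: "subring_quat R" and scal: "\<And>c x. c \<in> loc l \<Longrightarrow> x \<in> R \<Longrightarrow> qscal c x \<in> R"
    using R by (auto simp: local_order_def)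
  note r = subring_quatD[OF ring]
  have div: "c / trip x y z \<in> loc l" if "c \<in> loc l" for c
    using loc_mult[OF l that unit(2)] by simp
  obtain c0 where w: "w = qcomb c0 (trip w y z / trip x y z) (trip x w z / trip x y z) (trip x y w / trip
      x y z) x y z"
    using trip_cramer[OF unit(1), of w] .
  have t: "trip w y z \<in> loc l" "trip x w z \<in> loc l" "trip x y w \<in> loc l"
    unfolding trip_eq_trace(2)[of w] trip_eq_trace(3)[of x w] trip_eq_trace(4)[of x y w] mult_minus_left
    by (intro loc_uminus l dual r xyz)+
  define v where "v = qscal (trip w y z / trip x y z) x
    + qscal (trip x w z / trip x y z) y + qscal (trip x y w / trip x y z) z"
  have v: "v \<in> R" unfolding v_def by (intro r scal div t xyz)
  \<comment> \<open>The trace of s is \<open>- trip x y z\<close>, a unit; pairing with s therefore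
    isolates the coefficient of 1, which Cramer's rule leaves open.\<close>
  define s where "s = (x \<star> y - y \<star> x) \<star> z"
  have s: "s \<in> R" unfolding s_def by (intro r xyz)
  have wv: "w = qscal c0 qone + v" using w by (simp add: v_def add.assoc)
  have "2 * q0 (w \<star> s) - 2 * q0 (v \<star> s) \<in> loc l"
    by (intro loc_diff l dual s local_order_trace[OF l R] r v)
  moreover have "2 * q0 (w \<star> s) - 2 * q0 (v \<star> s) = - c0 * trip x y z"
    unfolding wv trip_eq_trace(1)[of x y z] s_def[symmetric]
    by (simp add: mul_add_left mul_scal_left del: qmul_coords)
  ultimately have "(- c0 * trip x y z) / trip x y z \<in> loc l" using div by metis
  hence "- c0 \<in> loc l" using unit(1) by simp
  hence "c0 \<in> loc l" using loc_uminus[OF l] by fastforce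
  thus ?thesis unfolding wv by (intro r scal v)
qed

lemma ord_like_multiple:
  assumes "ord_like M"
  obtains n :: int where "n > 0" "qscal (of_int n) w \<in> M"
proof -
  have ring: "subring_quat M" using assms by (simp add: ord_like_def)
  note r = subring_quatD[OF ring]
  obtain m :: int where m: "m > 0" "(0, of_int m, 0, 0) \<in> M" "(0, 0, of_int m, 0) \<in> M" "(0, 0, 0, of_int m) \<in> M"
    using assms by (auto simp: ord_like_def)
  obtain d :: int where d: "d > 0" "\<And>x. x \<in> {q0 w, q1 w, q2 w, q3 w} \<Longrightarrow> of_int d * x \<in> \<int>"
    by (rule common_denominator[of "{q0 w, q1 w, q2 w, q3 w}"]) auto
  obtain k0 k1 k2 k3 where k: "of_int d * q0 w = of_int k0" "of_int d * q1 w = of_int k1"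
    "of_int d * q2 w = of_int k2" "of_int d * q3 w = of_int k3"
    using d(2)[of "q0 w"] d(2)[of "q1 w"] d(2)[of "q2 w"] d(2)[of "q3 w"] by (auto elim!: Ints_cases)
  have "qscal (of_int (m * d)) w = qscal (of_int (m * k0)) qone + qscal (of_int k1) (0, of_int m, 0, 0)
      + qscal (of_int k2) (0, 0, of_int m, 0) + qscal (of_int k3) (0, 0, 0, of_int m)"
    using k by (simp add: quat_eq_iff mult.assoc)
  also have "\<dots> \<in> M" by (intro r m)
  finally show ?thesis using that[of "m * d"] m d by simp
qed

lemma local_order_multiple:
  assumes l: "prime l" and R: "local_order l R" and xyz: "x \<in> R" "y \<in> R" "z \<in> R" "trip x y z \<noteq> 0"
  obtains n :: int where "n > 0" "qscal (of_int n) w \<in> R"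
proof -
  have ring: "subring_quat R" using R by (auto simp: local_order_def)
  note r = subring_quatD[OF ring]
  obtain c0 where w: "w = qcomb c0 (trip w y z / trip x y z) (trip x w z / trip x y z) (trip x y w / trip
      x y z) x y z"
    using trip_cramer[OF xyz(4), of w] .
  define c1 c2 c3 where "c1 = trip w y z / trip x y z" "c2 = trip x w z / trip x y z" "c3 = trip x y w /
      trip x y z"
  obtain d :: int where d: "d > 0" "\<And>x. x \<in> {c0, c1, c2, c3} \<Longrightarrow> of_int d * x \<in> \<int>"
    by (rule common_denominator[of "{c0, c1, c2, c3}"]) auto
  obtain k0 k1 k2 k3 where k: "of_int d * c0 = of_int k0" "of_int d * c1 = of_int k1"
    "of_int d * c2 = of_int k2" "of_int d * c3 = of_int k3"
    using d(2)[of c0] d(2)[of c1] d(2)[of c2] d(2)[of c3] by (auto elim!: Ints_cases)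
  have "qscal (of_int d) w = zcomb k0 k1 k2 k3 x y z"
    unfolding k[symmetric] by (subst w) (simp add: c1_c2_c3_def qscal_add_right)
  also have "\<dots> \<in> R" by (intro r xyz)
  finally show ?thesis using that d(1) by blast
qed

definition qinv :: "quat \<Rightarrow> quat" where "qinv u = qscal (1 / qnorm u) (qconj u)"

lemma qinv: assumes "u \<noteq> 0" shows "u \<star> qinv u = qone" "qinv u \<star> u = qone"
proof -
  have "u \<star> qconj u = qscal (qnorm u) qone" "qconj u \<star> u = qscal (qnorm u) qone"
    by (auto simp: quat_eq_iff qnorm_eq power2_eq_square)
  thus "u \<star> qinv u = qone" "qinv u \<star> u = qone"
    using qnorm_pos[OF assms] by (simp_all add: qinv_def mul_scal_left mul_scal_right)
qed

lemma qnorm_qinv: assumes "u \<noteq> 0" shows "qnorm u * qnorm (qinv u) = 1"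
  using qinv(1)[OF assms] qnorm_mul[of u "qinv u"] by (simp add: qnorm_eq)

text \<open>Take \<open>u\<close> of minimal norm valuation in the conductor of all \<open>v\<close> with \<open>v M\<close> contained in \<open>R\<close>. For \<open>w\<close> in
  \<open>u M u\<^sup>-\<^sup>1\<close> and \<open>c\<close> in \<open>R\<close>, minimality makes the norms of \<open>c w\<close> and \<open>c w + 1\<close> integral at \<open>l\<close>,
  hence also the trace of \<open>c w\<close>; as \<open>R\<close> is self-dual, \<open>w\<close> lies in \<open>R\<close>.\<close>

lemma conjugate_into_local_order:
  assumes l: "prime l" and R: "local_order l R" and xyz: "x \<in> R" "y \<in> R" "z \<in> R"
    and unit: "trip x y z \<noteq> 0" "1 / trip x y z \<in> loc l" and M: "ord_like M"
  obtains u where "u \<noteq> 0" "\<And>y. y \<in> M \<Longrightarrow> u \<star> y \<star> qinv u \<in> R"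
proof -
  have ring: "subring_quat R" and scal: "\<And>c x. c \<in> loc l \<Longrightarrow> x \<in> R \<Longrightarrow> qscal c x \<in> R"
    and norm: "\<And>x. x \<in> R \<Longrightarrow> qnorm x \<in> loc l"
    using R by (auto simp: local_order_def)
  have Mring: "subring_quat M" using M by (simp add: ord_like_def)
  note r = subring_quatD[OF ring] and m = subring_quatD[OF Mring]
  define I where "I = {v. \<forall>y\<in>M. v \<star> y \<in> R}"
  have IR: "v \<in> R" if "v \<in> I" for v using that m(1) by (force simp: I_def)
  have I_add: "v + w \<in> I" if "v \<in> I" "w \<in> I" for v w
    using that r(3) by (auto simp: I_def mul_add_left)
  have I_left: "c \<star> v \<in> I" if "c \<in> R" "v \<in> I" for c v
    using that r(5) by (auto simp: I_def mul_assoc)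
  have I_right: "v \<star> y \<in> I" if "v \<in> I" "y \<in> M" for v y
    using that m(5) by (auto simp: I_def mul_assoc)
  obtain e1 e2 e3 where t: "tri_basis M e1 e2 e3" using ord_like_imp_tri_basis[OF M] .
  obtain d1 d2 d3 :: int where d: "d1 > 0" "qscal (of_int d1) e1 \<in> R" "d2 > 0" "qscal (of_int d2) e2 \<in> R"
    "d3 > 0" "qscal (of_int d3) e3 \<in> R"
    using local_order_multiple[OF l R xyz unit(1)] by metis
  define D where "D = d1 * d2 * d3"
  have D: "D > 0" using d by (simp add: D_def)
  \<comment> \<open>Clearing denominators of a basis of M relative to R puts the scalar D into I, so
    I is nonzero.\<close>
  have DI: "qscal (of_int D) qone \<in> I"
    unfolding I_def
  proof (intro CollectI ballI)
    fix y assume "y \<in> M"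
    then obtain n0 n1 n2 n3 :: int where
      y: "y = zcomb n0 n1 n2 n3 e1 e2 e3"
      using t unfolding tri_basis_def by (elim conjE) (simp only: mem_Collect_eq, elim exE conjE)
    have "qscal (of_int D) qone \<star> y = qscal (of_int (D * n0)) qone + qscal (of_int (d2 * d3 * n1)) (qscal
        (of_int d1) e1)
       + qscal (of_int (d1 * d3 * n2)) (qscal (of_int d2) e2) + qscal (of_int (d1 * d2 * n3)) (qscal
           (of_int d3) e3)"
      by (simp add: y mul_scal_left qscal_add_right D_def mult_ac)
    also have "\<dots> \<in> R" by (intro r d)
    finally show "qscal (of_int D) qone \<star> y \<in> R" .
  qed
  \<comment> \<open>\<open>P k\<close> states that some nonzero element of I has norm of exact
    valuation k at l. Valuations are natural numbers here because I lies in R.\<close>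
  define P where "P = (\<lambda>k. \<exists>v\<in>I. v \<noteq> 0 \<and> (\<exists>n d. qnorm v = of_int (int l) ^ k * (of_int n / of_int d)
    \<and> \<not> int l dvd n \<and> \<not> int l dvd d))"
  have val: "\<exists>k n d. qnorm v = of_int (int l) ^ k * (of_int n / of_int d) \<and> \<not> int l dvd n \<and> \<not> int l dvd d"
    if "v \<in> I" "v \<noteq> 0" for v
    using loc_valuation[OF l norm[OF IR[OF that(1)]]] qnorm_pos[OF that(2)] by (metis less_irrefl)
  have "\<exists>k. P k"
  proof -
    have "qscal (of_int D) qone \<noteq> 0" using D by (auto simp: quat_eq_iff)
    thus ?thesis using val[OF DI] DI unfolding P_def by blast
  qed
  hence "P (LEAST k. P k)" by (rule LeastI_ex)
  then obtain u n d where u: "u \<in> I" "u \<noteq> 0" "qnorm u = of_int (int l) ^ (LEAST k. P k) * (of_int n / of_int d)"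
    "\<not> int l dvd n" "\<not> int l dvd d"
    unfolding P_def by blast
  have min: "qnorm v / qnorm u \<in> loc l" if vI: "v \<in> I" for v
  proof (cases "v = 0")
    case True
    thus ?thesis using l by (simp add: qnorm_eq)
  next
    case False
    obtain k m e where v: "qnorm v = of_int (int l) ^ k * (of_int m / of_int e)" "\<not> int l dvd m" "\<not> int l dvd e"
      using val[OF vI False] by blast
    hence "P k" using vI False unfolding P_def by blast
    hence "(LEAST k. P k) \<le> k" by (rule Least_le)
    thus ?thesis unfolding u(3) v(1) using u v l by (intro loc_divide_prime_power)
  qed
  show ?thesis
  proof (rule that[OF u(2)])
    fix y assume y: "y \<in> M"
    define w where "w = u \<star> y \<star> qinv u"
    have wu: "w \<star> u = u \<star> y" by (simp add: w_def mul_assoc qinv[OF u(2)])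
    have N: "qnorm (c \<star> w) \<in> loc l" "qnorm (c \<star> w + qone) \<in> loc l" if c: "c \<in> R" for c
    proof -
      have cu: "c \<star> (u \<star> y) \<in> I" by (intro I_left c I_right u y)
      have "qnorm (c \<star> (u \<star> y)) = qnorm (c \<star> w) * qnorm u"
        unfolding qnorm_mul[symmetric] mul_assoc wu ..
      thus "qnorm (c \<star> w) \<in> loc l" using min[OF cu] qnorm_pos[OF u(2)] by simp
      have "qnorm (c \<star> (u \<star> y) + u) = qnorm (c \<star> w + qone) * qnorm u"
        unfolding qnorm_mul[symmetric] mul_add_left mul_assoc wu by simp
      thus "qnorm (c \<star> w + qone) \<in> loc l" using min[OF I_add[OF cu u(1)]] qnorm_pos[OF u(2)] by simp
    qed
    have "w \<in> R"
    proof (rule local_order_self_dual[OF l R xyz unit])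
      fix c assume "c \<in> R"
      hence "2 * q0 (c \<star> w) \<in> loc l" by (intro trace_loc[OF l] N)
      thus "2 * q0 (w \<star> c) \<in> loc l" by (simp add: algebra_simps)
    qed
    thus "u \<star> y \<star> qinv u \<in> R" by (simp add: w_def)
  qed
qed

text \<open>Gluing \<open>M\<close> away from \<open>l\<close> with \<open>R\<close> at \<open>l\<close> gives an order containing \<open>M\<close>, hence equal to \<open>M\<close>.\<close>

lemma maximal_order_absorbs:
  assumes l: "prime l" and M: "ord_like M" and max: "\<And>S. ord_like S \<Longrightarrow> M \<subseteq> S \<Longrightarrow> S = M"
    and R: "subring_quat R" "\<And>x. x \<in> R \<Longrightarrow> qnorm x \<in> loc l" and sub: "M \<subseteq> R" and y: "y \<in> R"
  obtains d :: int where "\<not> int l dvd d" "qscal (of_int d) y \<in> M"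
proof -
  have Mring: "subring_quat M" and Mnorm: "\<And>x. x \<in> M \<Longrightarrow> qnorm x \<in> \<int>" using M by (auto simp: ord_like_def)
  note r = subring_quatD[OF R(1)] and m = subring_quatD[OF Mring]
  define S where "S = {y \<in> R. \<exists>k. qscal (of_int (int l ^ k)) y \<in> M}"
  have MS: "M \<subseteq> S"
  proof
    fix y assume "y \<in> M"
    thus "y \<in> S" using sub unfolding S_def by (auto intro!: exI[of _ 0])
  qed
  have up: "qscal (of_int (int l ^ (k + j))) y \<in> M" if "qscal (of_int (int l ^ k)) y \<in> M" for k j y
    using m(7)[OF that, of "int l ^ j"] by (simp add: power_add mult_ac)
  have "subring_quat S"
    unfolding subring_quat_def
  proof (intro conjI ballI)
    show "qone \<in> S" using MS m(1) by blast
    fix x assume "x \<in> S"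
    then obtain k where x: "x \<in> R" "qscal (of_int (int l ^ k)) x \<in> M" by (auto simp: S_def)
    show "- x \<in> S" unfolding S_def using x r(2) m(2)[OF x(2)] by (auto intro!: exI[of _ k])
    fix y assume "y \<in> S"
    then obtain j where y: "y \<in> R" "qscal (of_int (int l ^ j)) y \<in> M" by (auto simp: S_def)
    have "qscal (of_int (int l ^ (k + j))) (x + y) \<in> M"
      unfolding qscal_add_right using m(3)[OF up[OF x(2), of j] up[OF y(2), of k]] by (simp add: add.commute)
    thus "x + y \<in> S" unfolding S_def using x y r(3) by blast
    have "qscal (of_int (int l ^ (k + j))) (x \<star> y) \<in> M"
      using m(5)[OF x(2) y(2)] by (simp add: mul_scal_left mul_scal_right power_add mult.commute)
    thus "x \<star> y \<in> S" unfolding S_def using x y r(5) by blast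
  qed
  \<comment> \<open>The norm is integral at l because x lies in R, and integral up to a power of l
    because a multiple of x lies in M.\<close>
  moreover have "qnorm x \<in> \<int>" if xS: "x \<in> S" for x
  proof -
    obtain k where x: "x \<in> R" "qscal (of_int (int l ^ k)) x \<in> M" using xS by (auto simp: S_def)
    have "qnorm (qscal (of_int (int l ^ k)) x) = of_int (int l ^ (k * 2)) * qnorm x"
      by (simp add: qnorm_eq power_mult power_mult_distrib algebra_simps)
    hence "of_int (int l ^ (k * 2)) * qnorm x \<in> \<int>" using Mnorm[OF x(2)] by metis
    thus ?thesis by (rule Ints_if_loc_power[OF l R(2)[OF x(1)]])
  qed
  moreover have "\<exists>n::int. n > 0 \<and> (0, of_int n, 0, 0) \<in> S \<and> (0, 0, of_int n, 0) \<in> S \<and> (0, 0, 0, of_int n) \<in> S"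
    using M MS unfolding ord_like_def by blast
  ultimately have "ord_like S" unfolding ord_like_def by blast
  hence SM: "S = M" using max MS by blast
  obtain n :: int where n: "n > 0" "qscal (of_int n) y \<in> M" using ord_like_multiple[OF M] .
  have "\<not> is_unit (int l)" using l by (auto dest: prime_gt_1_nat)
  \<comment> \<open>Only the part s of the multiplier prime to l remains; the power of l is already
    permitted by the definition of S.\<close>
  then obtain s where s: "n = int l ^ multiplicity (int l) n * s" "\<not> int l dvd s"
    using multiplicity_decompose'[of n "int l"] n(1) by (metis less_irrefl)
  have "qscal (of_int s) y \<in> S"
    unfolding S_def
  proof (intro CollectI conjI exI)
    show "qscal (of_int s) y \<in> R" by (rule r(7)[OF y])
    show "qscal (of_int (int l ^ multiplicity (int l) n)) (qscal (of_int s) y) \<in> M"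
      using n(2) s(1) by (metis of_int_mult qscal_simps(4))
  qed
  thus ?thesis using that s(2) SM by blast
qed

lemma tri_basis_vdet: "tri_basis M e1 e2 e3 \<Longrightarrow> vdet e1 e2 e3 = q1 e1 * q2 e2 * q3 e3"
  by (simp add: tri_basis_def vdet_def)

lemma tri_basis_vdet_multiple:
  assumes t: "tri_basis M e1 e2 e3" and "x \<in> M" "y \<in> M" "z \<in> M"
  obtains n :: int where "vdet x y z = of_int n * vdet e1 e2 e3"
proof -
  have ex: "\<exists>n0 n1 n2 n3 :: int. w = zcomb n0 n1 n2 n3 e1 e2 e3"
    if "w \<in> M" for w
    using t that unfolding tri_basis_def by simp
  obtain x0 x1 x2 x3 :: int where x: "x = zcomb x0 x1 x2 x3 e1 e2 e3"
    using ex[OF assms(2)] by blast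
  obtain y0 y1 y2 y3 :: int where y: "y = zcomb y0 y1 y2 y3 e1 e2 e3"
    using ex[OF assms(3)] by blast
  obtain z0 z1 z2 z3 :: int where z: "z = zcomb z0 z1 z2 z3 e1 e2 e3"
    using ex[OF assms(4)] by blast
  show ?thesis
    by (rule that[of "x1 * (y2 * z3 - y3 * z2) - x2 * (y1 * z3 - y3 * z1) + x3 * (y1 * z2 - y2 * z1)"])
      (simp add: x y z vdet_def algebra_simps)
qed

lemma tri_basis_mem:
  assumes "tri_basis M e1 e2 e3"
  shows "e1 \<in> M" "e2 \<in> M" "e3 \<in> M"
proof -
  have mem: "zcomb n0 n1 n2 n3 e1 e2 e3 \<in> M"
    for n0 n1 n2 n3 :: int using assms unfolding tri_basis_def by blast
  show "e1 \<in> M" "e2 \<in> M" "e3 \<in> M" using mem[of 0 1 0 0] mem[of 0 0 1 0] mem[of 0 0 0 1] by simp_all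
qed

lemma trip_int:
  assumes "ord_like M" "x \<in> M" "y \<in> M" "z \<in> M"
  shows "trip x y z \<in> \<int>"
proof -
  have ring: "subring_quat M" and norm: "\<And>x. x \<in> M \<Longrightarrow> qnorm x \<in> \<int>" using assms by (auto simp: ord_like_def)
  have "2 * q0 ((x \<star> y - y \<star> x) \<star> z) \<in> \<int>"
    by (rule trace_int[OF ring norm]) (auto intro!: subring_quatD[OF ring] assms)
  thus ?thesis unfolding trip_eq_trace(1) mult_minus_left by (rule Ints_minus)
qed

text \<open>The conjugate of R by the inverse of u contains M, and by maximality M absorbs it up to
  factors prime to l. So M contains prime-to-l multiples of a triple with unit \<open>trip\<close>,
  while every \<open>trip\<close> from M is a multiple of \<mu>.\<close>

lemma maximal_order_unit_at:
  assumes l: "prime l" and R: "local_order l R" and xyz: "x \<in> R" "y \<in> R" "z \<in> R"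
    and unit: "trip x y z \<noteq> 0" "1 / trip x y z \<in> loc l"
    and M: "ord_like M" and max: "\<And>S. ord_like S \<Longrightarrow> M \<subseteq> S \<Longrightarrow> S = M"
    and t: "tri_basis M e1 e2 e3" and \<mu>: "trip e1 e2 e3 = of_int \<mu>"
  shows "\<not> int l dvd \<mu>"
proof
  assume dvd: "int l dvd \<mu>"
  have ring: "subring_quat R" and norm: "\<And>x. x \<in> R \<Longrightarrow> qnorm x \<in> loc l"
    using R by (auto simp: local_order_def)
  note r = subring_quatD[OF ring]
  obtain u where u: "u \<noteq> 0" "\<And>y. y \<in> M \<Longrightarrow> u \<star> y \<star> qinv u \<in> R"
    using conjugate_into_local_order[OF l R xyz unit M] by blast
  note i = qinv[OF u(1)]
  define R' where "R' = {y. u \<star> y \<star> qinv u \<in> R}"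
  have mulR: "u \<star> (x \<star> y) \<star> qinv u = (u \<star> x \<star> qinv u) \<star> (u \<star> y \<star> qinv u)" for x y
  proof -
    have "(u \<star> x \<star> qinv u) \<star> (u \<star> y \<star> qinv u) = u \<star> x \<star> ((qinv u \<star> u) \<star> y \<star> qinv u)"
      by (simp only: mul_assoc)
    thus ?thesis by (simp add: i mul_assoc)
  qed
  have R'ring: "subring_quat R'"
    unfolding subring_quat_def R'_def
    using r by (auto simp: mulR mul_add_left mul_add_right mul_neg_left mul_neg_right i)
  have R'norm: "qnorm y \<in> loc l" if "y \<in> R'" for y
  proof -
    have "qnorm (u \<star> y \<star> qinv u) = qnorm y * (qnorm u * qnorm (qinv u))" by (simp add: qnorm_mul)
    moreover have "qnorm (u \<star> y \<star> qinv u) \<in> loc l" using norm that by (simp add: R'_def)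
    ultimately show ?thesis using qnorm_qinv[OF u(1)] by simp
  qed
  have MR': "M \<subseteq> R'" using u(2) by (auto simp: R'_def)
  define \<phi> where "\<phi> = (\<lambda>y. qinv u \<star> y \<star> u)"
  have \<phi>: "\<phi> y \<in> R'" if "y \<in> R" for y
  proof -
    have "u \<star> \<phi> y \<star> qinv u = (u \<star> qinv u) \<star> y \<star> (u \<star> qinv u)" by (simp only: \<phi>_def mul_assoc)
    thus ?thesis using that by (simp add: R'_def i)
  qed
  have \<phi>mul: "\<phi> (x \<star> y) = \<phi> x \<star> \<phi> y" for x y
  proof -
    have "\<phi> x \<star> \<phi> y = qinv u \<star> x \<star> ((u \<star> qinv u) \<star> y \<star> u)" by (simp only: \<phi>_def mul_assoc)
    thus ?thesis by (simp add: i mul_assoc \<phi>_def)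
  qed
  have \<phi>diff: "\<phi> (x - y) = \<phi> x - \<phi> y" for x y
    by (simp add: \<phi>_def mul_diff_left mul_diff_right)
  \<comment> \<open>The real part of v w equals that of w v, so conjugation preserves traces and
    with them \<open>trip\<close>.\<close>
  have \<phi>tr: "q0 (\<phi> y) = q0 y" for y
  proof -
    have "q0 (v \<star> w) = q0 (w \<star> v)" for v w by (simp add: algebra_simps)
    hence "q0 (\<phi> y) = q0 (u \<star> (qinv u \<star> y))" unfolding \<phi>_def by metis
    thus ?thesis by (simp add: mul_assoc[symmetric] i del: qmul_coords)
  qed
  have \<phi>trip: "trip (\<phi> x) (\<phi> y) (\<phi> z) = trip x y z"
    unfolding trip_eq_trace(1) \<phi>mul[symmetric] \<phi>diff[symmetric] \<phi>tr ..
  note absorb = maximal_order_absorbs[OF l M max R'ring R'norm MR']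
  obtain d1 where d1: "\<not> int l dvd d1" "qscal (of_int d1) (\<phi> x) \<in> M" using absorb \<phi>[OF xyz(1)] by blast
  obtain d2 where d2: "\<not> int l dvd d2" "qscal (of_int d2) (\<phi> y) \<in> M" using absorb \<phi>[OF xyz(2)] by blast
  obtain d3 where d3: "\<not> int l dvd d3" "qscal (of_int d3) (\<phi> z) \<in> M" using absorb \<phi>[OF xyz(3)] by blast
  obtain n where n: "vdet (qscal (of_int d1) (\<phi> x)) (qscal (of_int d2) (\<phi> y)) (qscal (of_int d3) (\<phi> z)) =
      of_int n * vdet e1 e2 e3"
    using tri_basis_vdet_multiple[OF t d1(2) d2(2) d3(2)] .
  have "vdet (qscal (of_int d1) (\<phi> x)) (qscal (of_int d2) (\<phi> y)) (qscal (of_int d3) (\<phi> z)) = of_int (d1 *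
      d2 * d3) * vdet (\<phi> x) (\<phi> y) (\<phi> z)"
    by (simp add: vdet_def algebra_simps)
  hence "of_int (d1 * d2 * d3) * trip (\<phi> x) (\<phi> y) (\<phi> z) = of_int n * trip e1 e2 e3"
    using n unfolding trip_def by simp
  hence eq: "of_int (d1 * d2 * d3) * trip x y z = of_int (n * \<mu>)" by (simp add: \<phi>trip \<mu>)
  obtain k where k: "\<mu> = int l * k" using dvd by blast
  have "of_int (d1 * d2 * d3) = of_int (int l) * (of_int (n * k) * (1 / trip x y z))"
    using eq unit(1) k by (simp add: field_simps)
  moreover have "of_int (n * k) * (1 / trip x y z) \<in> loc l" by (rule loc_mult[OF l loc_of_int[OF l] unit(2)])
  ultimately have "int l dvd d1 * d2 * d3" using loc_dvd[OF l] by blast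
  thus False using d1(1) d2(1) d3(1) l by (simp add: prime_dvd_mult_iff)
qed

end

section \<open>Ramification and the reduced discriminant\<close>

lemma odd_prime_not_dvd_four: "prime l \<Longrightarrow> l \<noteq> 2 \<Longrightarrow> \<not> int l dvd 4"
proof
  assume l: "prime l" "l \<noteq> 2" "int l dvd 4"
  have "int l dvd int (2 ^ 2)" using l(3) by simp
  hence "l dvd 2 ^ 2" by (simp only: int_dvd_int_iff)
  hence "l dvd 2" by (rule prime_dvd_power[OF l(1)])
  thus False using l(2) primes_dvd_imp_eq[OF l(1) two_is_prime_nat] by blast
qed

text \<open>The binary form S^2 - u T^2 is anisotropic modulo p: a zero with T invertible would
  exhibit u as a square.\<close>

lemma nonresidue_dvd:
  fixes u S T :: int
  assumes p: "prime (p::nat)" and u: "Legendre u (int p) = - 1" and dvd: "int p dvd S\<^sup>2 - u * T\<^sup>2"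
  shows "int p dvd S \<and> int p dvd T"
proof -
  have "int p dvd T"
  proof (rule ccontr)
    assume "\<not> int p dvd T"
    hence "coprime T (int p)" using p prime_imp_coprime[of "int p" T] by (simp add: coprime_commute)
    then obtain V where V: "[T * V = 1] (mod int p)" using cong_solve_coprime_int by blast
    have "[S\<^sup>2 = u * T\<^sup>2] (mod int p)" using dvd by (simp add: cong_iff_dvd_diff)
    hence "[S\<^sup>2 * V\<^sup>2 = u * T\<^sup>2 * V\<^sup>2] (mod int p)" by (rule cong_scalar_right)
    hence "[(S * V)\<^sup>2 = u * (T * V)\<^sup>2] (mod int p)" by (simp add: power_mult_distrib mult.assoc)
    also have "[u * (T * V)\<^sup>2 = u * 1\<^sup>2] (mod int p)" using V by (intro cong_mult cong_pow) auto
    finally have "[(S * V)\<^sup>2 = u] (mod int p)" by simp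
    hence "QuadRes (int p) u" unfolding QuadRes_def by blast
    thus False using u by (auto simp: Legendre_def split: if_splits)
  qed
  moreover have "int p dvd S"
  proof -
    have "int p dvd (S\<^sup>2 - u * T\<^sup>2) + u * T\<^sup>2" using dvd \<open>int p dvd T\<close>
      by (intro dvd_add dvd_mult) (auto simp: power2_eq_square)
    thus ?thesis using p by (simp add: prime_dvd_power_iff)
  qed
  ultimately show ?thesis by blast
qed

text \<open>Anisotropy applies twice: modulo p to S and T, whose squares then drop out modulo p^2,
  and after division by p to Y and Z.\<close>

lemma anisotropic_descent:
  fixes u S T Y Z :: int
  assumes p: "prime (p::nat)" and u: "Legendre u (int p) = - 1"
    and dvd: "(int p)\<^sup>2 dvd S\<^sup>2 - u * T\<^sup>2 + int p * (Y\<^sup>2 - u * Z\<^sup>2)"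
  shows "int p dvd S \<and> int p dvd T \<and> int p dvd Y \<and> int p dvd Z"
proof -
  have p0: "int p \<noteq> 0" using p by (auto dest: prime_gt_0_nat)
  have "int p dvd S\<^sup>2 - u * T\<^sup>2 + int p * (Y\<^sup>2 - u * Z\<^sup>2)"
    by (rule dvd_trans[OF _ dvd]) simp
  hence "int p dvd S\<^sup>2 - u * T\<^sup>2" by (simp add: dvd_add_left_iff)
  hence ST: "int p dvd S" "int p dvd T" using nonresidue_dvd[OF p u, of S T] by blast+
  hence "(int p)\<^sup>2 dvd S\<^sup>2 - u * T\<^sup>2" by (intro dvd_diff dvd_mult) (auto intro: dvd_power_same)
  hence "(int p)\<^sup>2 dvd int p * (Y\<^sup>2 - u * Z\<^sup>2)" using dvd by (simp add: dvd_add_right_iff)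
  hence "int p dvd Y\<^sup>2 - u * Z\<^sup>2" using p0 by (simp add: power2_eq_square)
  thus ?thesis using ST nonresidue_dvd[OF p u, of Y Z] by blast
qed

text \<open>While the common denominator contains p, the numerators satisfy the descent condition
  modulo p^2 and are all divisible by p. The p-part of the denominator is thus stripped off one
  factor at a time.\<close>

lemma anisotropic_integral:
  fixes s t y z :: rat and u :: int
  assumes p: "prime p" and u: "Legendre u (int p) = - 1"
    and N: "s\<^sup>2 - of_int u * t\<^sup>2 + of_nat p * (y\<^sup>2 - of_int u * z\<^sup>2) \<in> loc p"
  shows "s \<in> loc p \<and> t \<in> loc p \<and> y \<in> loc p \<and> z \<in> loc p"
proof -
  obtain D :: int where D: "D > 0" "\<And>x. x \<in> {s, t, y, z} \<Longrightarrow> of_int D * x \<in> \<int>"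
    by (rule common_denominator[of "{s, t, y, z}"]) auto
  have "\<not> is_unit (int p)" using p by (auto dest: prime_gt_1_nat)
  then obtain d where d: "D = int p ^ multiplicity (int p) D * d" "\<not> int p dvd d"
    using multiplicity_decompose'[of D "int p"] D(1) by (metis less_irrefl)
  have "\<forall>x\<in>{s, t, y, z}. of_int (int p ^ k * d) * x \<in> \<int> \<Longrightarrow> \<forall>x\<in>{s, t, y, z}. of_int d * x \<in> \<int>" for k
  proof (induction k)
    case (Suc k)
    let ?e = "of_int (int p ^ Suc k * d) :: rat"
    obtain S T Y Z where *: "?e * s = of_int S" "?e * t = of_int T" "?e * y = of_int Y" "?e * z = of_int Z"
      using Suc.prems by (auto elim!: Ints_cases)
    obtain m n where mn: "\<not> int p dvd m" "of_int m * (s\<^sup>2 - of_int u * t\<^sup>2 + of_nat p * (y\<^sup>2 - of_int u *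
        z\<^sup>2)) = of_int n"
      using locE[OF N] .
    have "of_int (m * (S\<^sup>2 - u * T\<^sup>2 + int p * (Y\<^sup>2 - u * Z\<^sup>2))) =
        of_int m * ((?e * s)\<^sup>2 - of_int u * (?e * t)\<^sup>2 + of_nat p * ((?e * y)\<^sup>2 - of_int u * (?e * z)\<^sup>2))"
      unfolding * by simp
    also have "\<dots> = ?e\<^sup>2 * (of_int m * (s\<^sup>2 - of_int u * t\<^sup>2 + of_nat p * (y\<^sup>2 - of_int u * z\<^sup>2)))"
      unfolding power_mult_distrib by (simp only: distrib_left right_diff_distrib mult.left_commute)
    also have "\<dots> = of_int ((int p ^ Suc k * d)\<^sup>2 * n)" unfolding mn by simp
    finally have "m * (S\<^sup>2 - u * T\<^sup>2 + int p * (Y\<^sup>2 - u * Z\<^sup>2)) = (int p ^ Suc k * d)\<^sup>2 * n"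
      by (simp only: of_int_eq_iff)
    also have "\<dots> = (int p)\<^sup>2 * ((int p ^ k * d)\<^sup>2 * n)" by (simp add: power_mult_distrib mult_ac)
    finally have "(int p)\<^sup>2 dvd m * (S\<^sup>2 - u * T\<^sup>2 + int p * (Y\<^sup>2 - u * Z\<^sup>2))" by simp
    moreover have "coprime ((int p)\<^sup>2) m" using mn(1) p by (simp add: prime_imp_coprime)
    ultimately have "(int p)\<^sup>2 dvd S\<^sup>2 - u * T\<^sup>2 + int p * (Y\<^sup>2 - u * Z\<^sup>2)"
      by (simp add: coprime_dvd_mult_right_iff)
    hence dv: "int p dvd S" "int p dvd T" "int p dvd Y" "int p dvd Z"
      using anisotropic_descent[OF p u, of S T Y Z] by blast+
    have p0: "(of_nat p :: rat) \<noteq> 0" using p by (auto dest: prime_gt_0_nat)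
    have red: "of_int (int p ^ k * d) * x \<in> \<int>" if eq: "?e * x = of_int X" "int p dvd X" for x X
    proof -
      obtain X' where "X = int p * X'" using eq(2) by blast
      hence "of_nat p * (of_int (int p ^ k * d) * x) = of_nat p * of_int X'" using eq(1) by (simp add: mult_ac)
      hence "of_int (int p ^ k * d) * x = of_int X'" using p0 by simp
      thus ?thesis by simp
    qed
    show ?case using red * dv by (intro Suc.IH) blast
  qed simp
  hence "\<forall>x\<in>{s, t, y, z}. of_int d * x \<in> \<int>" using D(2) d(1) by metis
  thus ?thesis using d(2) locI by blast
qed

section \<open>Explicit local orders of unit discriminant\<close>

context quat_alg
begin

lemma zcombI: "x = zcomb n0 n1 n2 n3 u v w \<Longrightarrow> \<exists>n0 n1 n2 n3 :: int. x = zcomb n0 n1 n2 n3 u v w"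
  by blast

text \<open>Reduces a local order to a finite check: products of basis vectors, and the coefficients
  of the norm form in this basis.\<close>

lemma local_order_spanI:
  assumes l: "prime l"
    and prods: "\<And>x y. x \<in> {e1, e2, e3} \<Longrightarrow> y \<in> {e1, e2, e3} \<Longrightarrow> \<exists>n0 n1 n2 n3 :: int. x \<star> y = zcomb n0 n1 n2
        n3 e1 e2 e3"
    and ints: "{qnorm e1, qnorm e2, qnorm e3, 2 * q0 e1, 2 * q0 e2, 2 * q0 e3,
      2 * qdot e1 e2, 2 * qdot e1 e3, 2 * qdot e2 e3} \<subseteq> \<int>"
  obtains R where "local_order l R" "e1 \<in> R" "e2 \<in> R" "e3 \<in> R"
proof -
  have norms: "qnorm e1 \<in> loc l" "qnorm e2 \<in> loc l" "qnorm e3 \<in> loc l"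
      "2 * q0 e1 \<in> loc l" "2 * q0 e2 \<in> loc l" "2 * q0 e3 \<in> loc l"
      "2 * qdot e1 e2 \<in> loc l" "2 * qdot e1 e3 \<in> loc l" "2 * qdot e2 e3 \<in> loc l"
    by (rule loc_Ints[OF l], use ints in simp)+
  define f where "f = (\<lambda>c0 c1 c2 c3. qcomb c0 c1 c2 c3 e1 e2 e3)"
  define R where "R = {x. \<exists>c0\<in>loc l. \<exists>c1\<in>loc l. \<exists>c2\<in>loc l. \<exists>c3\<in>loc l. x = f c0 c1 c2 c3}"
  have fR: "f c0 c1 c2 c3 \<in> R" if "c0 \<in> loc l" "c1 \<in> loc l" "c2 \<in> loc l" "c3 \<in> loc l" for c0 c1 c2 c3
    using that by (auto simp: R_def)
  have RE: "\<exists>c0\<in>loc l. \<exists>c1\<in>loc l. \<exists>c2\<in>loc l. \<exists>c3\<in>loc l. x = f c0 c1 c2 c3" if "x \<in> R" for x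
    using that by (simp add: R_def)
  have mem: "qone \<in> R" "e1 \<in> R" "e2 \<in> R" "e3 \<in> R"
    using fR[of 1 0 0 0] fR[of 0 1 0 0] fR[of 0 0 1 0] fR[of 0 0 0 1] l by (simp_all add: f_def)
  have add: "x + y \<in> R" if xy: "x \<in> R" "y \<in> R" for x y
  proof -
    obtain c0 c1 c2 c3 where c: "c0 \<in> loc l" "c1 \<in> loc l" "c2 \<in> loc l" "c3 \<in> loc l" "x = f c0 c1 c2 c3"
      using RE[OF xy(1)] by blast
    obtain d0 d1 d2 d3 where d: "d0 \<in> loc l" "d1 \<in> loc l" "d2 \<in> loc l" "d3 \<in> loc l" "y = f d0 d1 d2 d3"
      using RE[OF xy(2)] by blast
    note cd = c d
    have "x + y = f (c0 + d0) (c1 + d1) (c2 + d2) (c3 + d3)"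
      unfolding cd f_def qscal_add_left by simp
    also have "\<dots> \<in> R" by (intro fR loc_add l cd)
    finally show ?thesis .
  qed
  have scal: "qscal c x \<in> R" if cx: "c \<in> loc l" "x \<in> R" for c x
  proof -
    obtain c0 c1 c2 c3 where cd: "c0 \<in> loc l" "c1 \<in> loc l" "c2 \<in> loc l" "c3 \<in> loc l" "x = f c0 c1 c2 c3"
      using RE[OF cx(2)] by blast
    have "qscal c x = f (c * c0) (c * c1) (c * c2) (c * c3)"
      unfolding cd f_def qscal_add_right by simp
    also have "\<dots> \<in> R" by (intro fR loc_mult l cd cx)
    finally show ?thesis .
  qed
  have prodR: "x \<star> y \<in> R" if xy: "x \<in> {e1, e2, e3}" "y \<in> {e1, e2, e3}" for x y
  proof -
    obtain n0 n1 n2 n3 :: int where "x \<star> y = zcomb n0 n1 n2 n3 e1 e2 e3" using prods[OF xy] by blast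
    moreover have "f (of_int n0) (of_int n1) (of_int n2) (of_int n3) \<in> R" by (intro fR loc_of_int l)
    ultimately show ?thesis by (simp add: f_def)
  qed
  have mulR: "x \<star> y \<in> R" if xy: "x \<in> R" "y \<in> R" for x y
  proof -
    obtain c0 c1 c2 c3 where c: "c0 \<in> loc l" "c1 \<in> loc l" "c2 \<in> loc l" "c3 \<in> loc l" "x = f c0 c1 c2 c3"
      using RE[OF xy(1)] by blast
    obtain d0 d1 d2 d3 where d: "d0 \<in> loc l" "d1 \<in> loc l" "d2 \<in> loc l" "d3 \<in> loc l" "y = f d0 d1 d2 d3"
      using RE[OF xy(2)] by blast
    note cd = c d
    show ?thesis unfolding cd f_def mul_add_left mul_add_right mul_scal_left mul_scal_right mul_one
      by (intro add scal cd prodR mem) auto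
  qed
  have "- x \<in> R" if "x \<in> R" for x using scal[of "-1" x] that loc_of_int[OF l, of "-1"] by simp
  hence "subring_quat R" unfolding subring_quat_def using mem add mulR by auto
  moreover have "qnorm x \<in> loc l" if xR: "x \<in> R" for x
  proof -
    obtain c0 c1 c2 c3 where cd: "c0 \<in> loc l" "c1 \<in> loc l" "c2 \<in> loc l" "c3 \<in> loc l" "x = f c0 c1 c2 c3"
      using RE[OF xR] by blast
    have "qnorm x = c0\<^sup>2 + c1\<^sup>2 * qnorm e1 + c2\<^sup>2 * qnorm e2 + c3\<^sup>2 * qnorm e3
       + c0 * c1 * (2 * q0 e1) + c0 * c2 * (2 * q0 e2) + c0 * c3 * (2 * q0 e3)
       + c1 * c2 * (2 * qdot e1 e2) + c1 * c3 * (2 * qdot e1 e3) + c2 * c3 * (2 * qdot e2 e3)"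
      unfolding cd f_def qnorm_eq qdot_def by (simp add: power2_eq_square algebra_simps)
    also have "\<dots> \<in> loc l" by (intro loc_add loc_mult loc_power l cd norms)
    finally show ?thesis .
  qed
  ultimately have "local_order l R" using scal unfolding local_order_def by blast
  thus ?thesis using that mem by blast
qed

text \<open>Stands in for splitting of the algebra at l, phrased as a local order of unit reduced
  discriminant; this is all that the conjugation argument uses.\<close>

definition unramified_at :: "nat \<Rightarrow> bool" where
  "unramified_at l \<longleftrightarrow> (\<exists>R x y z. local_order l R \<and> x \<in> R \<and> y \<in> R \<and> z \<in> R \<and> trip x y z \<noteq> 0 \<and> 1 / trip x y z \<in> loc l)"

lemma unramified_atI:
  assumes "prime l"
    and "\<And>x y. x \<in> {e1, e2, e3} \<Longrightarrow> y \<in> {e1, e2, e3} \<Longrightarrow> \<exists>n0 n1 n2 n3 :: int. x \<star> y = zcomb n0 n1 n2 n3 e1 e2 e3"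
    and "{qnorm e1, qnorm e2, qnorm e3, 2 * q0 e1, 2 * q0 e2, 2 * q0 e3,
      2 * qdot e1 e2, 2 * qdot e1 e3, 2 * qdot e2 e3} \<subseteq> \<int>"
    and unit: "trip e1 e2 e3 = of_int n" "\<not> int l dvd n"
  shows "unramified_at l"
proof -
  obtain R where R: "local_order l R" "e1 \<in> R" "e2 \<in> R" "e3 \<in> R"
    using local_order_spanI[OF assms(1-3)] by blast
  have "n \<noteq> 0" using unit(2) by auto
  hence "trip e1 e2 e3 \<noteq> 0" "1 / trip e1 e2 e3 \<in> loc l"
    using unit loc_inverse_of_int[OF unit(2)] by simp_all
  thus ?thesis unfolding unramified_at_def using R by blast
qed

text \<open>The order spanned by 1, i, j, k has reduced discriminant 4 a b, which settles every
  prime not dividing it.\<close>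

lemma unramified_at_standard:
  assumes l: "prime l" and ab: "a = of_int A" "b = of_int B" and nd: "\<not> int l dvd 4 * A * B"
  shows "unramified_at l"
proof (rule unramified_atI[OF l])
  let ?i = "(0, 1, 0, 0) :: quat" and ?j = "(0, 0, 1, 0) :: quat" and ?k = "(0, 0, 0, 1) :: quat"
  let ?c = "\<lambda>n0 n1 n2 n3. zcomb n0 n1 n2 n3 ?i ?j ?k"
  have "?i \<star> ?i = ?c A 0 0 0" "?i \<star> ?j = ?c 0 0 0 1" "?i \<star> ?k = ?c 0 0 A 0"
    "?j \<star> ?i = ?c 0 0 0 (-1)" "?j \<star> ?j = ?c B 0 0 0" "?j \<star> ?k = ?c 0 (-B) 0 0"
    "?k \<star> ?i = ?c 0 0 (-A) 0" "?k \<star> ?j = ?c 0 B 0 0" "?k \<star> ?k = ?c (-A*B) 0 0 0"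
    by (simp_all add: quat_eq_iff ab)
  note prods = this[THEN zcombI]
  show "\<exists>n0 n1 n2 n3 :: int. x \<star> y = zcomb n0 n1 n2 n3 ?i ?j ?k"
    if "x \<in> {?i, ?j, ?k}" "y \<in> {?i, ?j, ?k}" for x y
    using that by (elim insertE emptyE) (simp_all only: prods)
  show "trip ?i ?j ?k = of_int (4 * A * B)" unfolding trip_def vdet_def by (simp add: ab)
  have "qnorm ?i = of_int (- A)" "qnorm ?j = of_int (- B)" "qnorm ?k = of_int (A * B)"
    "2 * q0 ?i = of_int 0" "2 * q0 ?j = of_int 0" "2 * q0 ?k = of_int 0"
    "2 * qdot ?i ?j = of_int 0" "2 * qdot ?i ?k = of_int 0" "2 * qdot ?j ?k = of_int 0"
    unfolding qnorm_eq qdot_def by (simp_all add: ab)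
  thus "{qnorm ?i, qnorm ?j, qnorm ?k, 2 * q0 ?i, 2 * q0 ?j, 2 * q0 ?k,
      2 * qdot ?i ?j, 2 * qdot ?i ?k, 2 * qdot ?j ?k} \<subseteq> \<int>"
    by (simp only: insert_subset Ints_of_int empty_subsetI simp_thms)
qed (rule nd)

text \<open>When b = 1 modulo 4 the element (1 + j)/2 is integral; adjoining it removes the factor 4
  and leaves the odd discriminant a b.\<close>

lemma unramified_at_two:
  assumes ab: "a = of_int A" "b = of_int (4 * \<beta> + 1)" and A: "odd A"
  shows "unramified_at 2"
proof (rule unramified_atI)
  let ?i = "(0, 1, 0, 0) :: quat" and ?j = "(1/2, 0, 1/2, 0) :: quat" and ?k = "(0, 1/2, 0, 1/2) :: quat"
  let ?c = "\<lambda>n0 n1 n2 n3. zcomb n0 n1 n2 n3 ?i ?j ?k"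
  have "?i \<star> ?i = ?c A 0 0 0" "?i \<star> ?j = ?c 0 0 0 1" "?i \<star> ?k = ?c 0 0 A 0"
    "?j \<star> ?i = ?c 0 1 0 (-1)" "?j \<star> ?j = ?c \<beta> 0 1 0" "?j \<star> ?k = ?c 0 (-\<beta>) 0 0"
    "?k \<star> ?i = ?c A 0 (-A) 0" "?k \<star> ?j = ?c 0 \<beta> 0 1" "?k \<star> ?k = ?c (-A*\<beta>) 0 0 0"
    by (simp_all add: quat_eq_iff ab field_simps)
  note prods = this[THEN zcombI]
  show "\<exists>n0 n1 n2 n3 :: int. x \<star> y = zcomb n0 n1 n2 n3 ?i ?j ?k"
    if "x \<in> {?i, ?j, ?k}" "y \<in> {?i, ?j, ?k}" for x y
    using that by (elim insertE emptyE) (simp_all only: prods)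
  have "qnorm ?i = of_int (- A)" "qnorm ?j = of_int (- \<beta>)" "qnorm ?k = of_int (A * \<beta>)"
    "2 * q0 ?i = of_int 0" "2 * q0 ?j = of_int 1" "2 * q0 ?k = of_int 0"
    "2 * qdot ?i ?j = of_int 0" "2 * qdot ?i ?k = of_int (-A)" "2 * qdot ?j ?k = of_int 0"
    unfolding qnorm_eq qdot_def by (simp_all add: ab field_simps power2_eq_square)
  thus "{qnorm ?i, qnorm ?j, qnorm ?k, 2 * q0 ?i, 2 * q0 ?j, 2 * q0 ?k,
      2 * qdot ?i ?j, 2 * qdot ?i ?k, 2 * qdot ?j ?k} \<subseteq> \<int>"
    by (simp only: insert_subset Ints_of_int empty_subsetI simp_thms)
  show "trip ?i ?j ?k = of_int (A * (4 * \<beta> + 1))" unfolding trip_def vdet_def by (simp add: ab)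
  show "\<not> int 2 dvd A * (4 * \<beta> + 1)" using A by simp
qed simp

text \<open>With p = 8 t + 5, the vectors (1 + j + k)/2 and (i + 2 j + k)/4 have norms (1 + 3 p)/4
  and (1 + 3 p)/8, which are integers for exactly this residue of p. Together with 1 and k they span
  an order of discriminant p up to sign.\<close>

lemma unramified_at_two_minus_two:
  assumes ab: "a = - 2" "b = - of_int (8 * t + 5)"
  shows "unramified_at 2"
proof (rule unramified_atI)
  let ?i = "(1/2, 0, 1/2, 1/2) :: quat" and ?j = "(0, 1/4, 1/2, 1/4) :: quat" and ?k = "(0, 0, 0, 1) :: quat"
  let ?c = "\<lambda>n0 n1 n2 n3. zcomb n0 n1 n2 n3 ?i ?j ?k"
  have "?i \<star> ?i = ?c (-4-6*t) 1 0 0" "?i \<star> ?j = ?c (-4-6*t) (3+4*t) (-2-4*t) (-1-t)"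
    "?i \<star> ?k = ?c 0 (-10-16*t) (10+16*t) (3+4*t)"
    "?j \<star> ?i = ?c (-1-2*t) (-3-4*t) (3+4*t) (1+t)" "?j \<star> ?j = ?c (-2-3*t) 0 0 0"
    "?j \<star> ?k = ?c (3+4*t) (-11-16*t) (10+16*t) (3+4*t)"
    "?k \<star> ?i = ?c (-10-16*t) (10+16*t) (-10-16*t) (-2-4*t)"
    "?k \<star> ?j = ?c (-8-12*t) (11+16*t) (-10-16*t) (-3-4*t)" "?k \<star> ?k = ?c (-10-16*t) 0 0 0"
    by (simp_all add: quat_eq_iff ab field_simps)
  note prods = this[THEN zcombI]
  show "\<exists>n0 n1 n2 n3 :: int. x \<star> y = zcomb n0 n1 n2 n3 ?i ?j ?k"
    if "x \<in> {?i, ?j, ?k}" "y \<in> {?i, ?j, ?k}" for x y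
    using that by (elim insertE emptyE) (simp_all only: prods)
  have "qnorm ?i = of_int (4 + 6 * t)" "qnorm ?j = of_int (2 + 3 * t)" "qnorm ?k = of_int (10 + 16 * t)"
    "2 * q0 ?i = of_int 1" "2 * q0 ?j = of_int 0" "2 * q0 ?k = of_int 0"
    "2 * qdot ?i ?j = of_int (5 + 8 * t)" "2 * qdot ?i ?k = of_int (10 + 16 * t)" "2 * qdot ?j ?k =
        of_int (5 + 8 * t)"
    unfolding qnorm_eq qdot_def by (simp_all add: ab field_simps power2_eq_square)
  thus "{qnorm ?i, qnorm ?j, qnorm ?k, 2 * q0 ?i, 2 * q0 ?j, 2 * q0 ?k,
      2 * qdot ?i ?j, 2 * qdot ?i ?k, 2 * qdot ?j ?k} \<subseteq> \<int>"
    by (simp only: insert_subset Ints_of_int empty_subsetI simp_thms)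
  show "trip ?i ?j ?k = of_int (- 5 - 8 * t)" unfolding trip_def vdet_def by (simp add: ab field_simps)
  show "\<not> int 2 dvd - 5 - 8 * t" by presburger
qed simp

text \<open>The third vector is (c + i) j / q, of norm (c^2 - A)/q = s: integral because A is a
  square modulo q. Using it instead of k divides the discriminant by q and leaves 4 A up to
  sign.\<close>

lemma unramified_at_divisor:
  assumes q: "prime q" and ab: "a = of_int A" "b = - of_nat q" and c: "c\<^sup>2 - A = int q * s" and nd: "\<not>
      int q dvd 4 * A"
  shows "unramified_at q"
proof (rule unramified_atI[OF q])
  have q0: "(of_nat q :: rat) \<noteq> 0" using q by (auto dest: prime_gt_0_nat)
  let ?i = "(0, 1, 0, 0) :: quat" and ?j = "(0, 0, 1, 0) :: quat" and ?k = "(0, 0, of_int c / of_nat q, 1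
      / of_nat q) :: quat"
  let ?c = "\<lambda>n0 n1 n2 n3. zcomb n0 n1 n2 n3 ?i ?j ?k"
  have "A = c\<^sup>2 - int q * s" using c by simp
  hence a: "a = (of_int c)\<^sup>2 - of_nat q * of_int s" using ab by simp
  have "?i \<star> ?i = ?c A 0 0 0" "?i \<star> ?j = ?c 0 0 (-c) (int q)" "?i \<star> ?k = ?c 0 0 (-s) c"
    "?j \<star> ?i = ?c 0 0 c (- int q)" "?j \<star> ?j = ?c (- int q) 0 0 0" "?j \<star> ?k = ?c (-c) 1 0 0"
    "?k \<star> ?i = ?c 0 0 s (-c)" "?k \<star> ?j = ?c (-c) (-1) 0 0" "?k \<star> ?k = ?c (-s) 0 0 0"
    using q0 ab by (simp_all add: quat_eq_iff) (simp_all add: a field_simps power2_eq_square)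
  note prods = this[THEN zcombI]
  show "\<exists>n0 n1 n2 n3 :: int. x \<star> y = zcomb n0 n1 n2 n3 ?i ?j ?k"
    if "x \<in> {?i, ?j, ?k}" "y \<in> {?i, ?j, ?k}" for x y
    using that by (elim insertE emptyE) (simp_all only: prods)
  have "qnorm ?i = of_int (-A)" "qnorm ?j = of_int (int q)" 
    "2 * q0 ?i = of_int 0" "2 * q0 ?j = of_int 0" "2 * q0 ?k = of_int 0"
    "2 * qdot ?i ?j = of_int 0" "2 * qdot ?i ?k = of_int 0" "2 * qdot ?j ?k = of_int (2 * c)"
    using q0 unfolding qnorm_eq qdot_def by (simp_all add: ab)
  moreover have "qnorm ?k = of_int s"
    using q0 unfolding qnorm_eq by (simp add: ab(2)) (simp add: a field_simps power2_eq_square)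
  ultimately show "{qnorm ?i, qnorm ?j, qnorm ?k, 2 * q0 ?i, 2 * q0 ?j, 2 * q0 ?k,
      2 * qdot ?i ?j, 2 * qdot ?i ?k, 2 * qdot ?j ?k} \<subseteq> \<int>"
    by (simp only: insert_subset Ints_of_int empty_subsetI simp_thms)
  show "trip ?i ?j ?k = of_int (- 4 * A)" using q0 unfolding trip_def vdet_def by (simp add: ab)
  show "\<not> int q dvd - 4 * A" using nd by simp
qed

end

text \<open>The interface between the presentations and the argument: split away from p, and at p a
  norm form so anisotropic that an integral norm forces integral coordinates, with p dividing a b
  exactly once.\<close>

locale quat_ram = quat_alg +
  fixes p :: nat
  assumes p_prime: "prime p" and p_odd: "odd p"
    and unramified: "\<And>l. prime l \<Longrightarrow> l \<noteq> p \<Longrightarrow> unramified_at l"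
    and ab_loc: "a \<in> loc p" "b \<in> loc p"
    and ab_p: "\<exists>\<eta>::int. a * b = of_int (int p * \<eta>) \<and> \<not> int p dvd \<eta>"
    and coords_loc: "\<And>x. qnorm x \<in> loc p \<Longrightarrow> q0 x \<in> loc p \<and> q1 x \<in> loc p \<and> q2 x \<in> loc p \<and> q3 x \<in> loc p"
begin

lemma vdet_loc:
  assumes "qnorm x \<in> loc p" "qnorm y \<in> loc p" "qnorm z \<in> loc p"
  shows "vdet x y z \<in> loc p"
  unfolding vdet_def using coords_loc[OF assms(1)] coords_loc[OF assms(2)] coords_loc[OF assms(3)] p_prime
  by (intro loc_intros) auto

lemma p_dvd_trip:
  assumes "qnorm x \<in> loc p" "qnorm y \<in> loc p" "qnorm z \<in> loc p" "trip x y z = of_int \<mu>"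
  shows "int p dvd \<mu>"
proof -
  obtain \<eta> :: int where \<eta>: "a * b = of_int (int p * \<eta>)" using ab_p by blast
  show ?thesis
  proof (rule loc_dvd[OF p_prime])
    show "of_int (4 * \<eta>) * vdet x y z \<in> loc p"
      using vdet_loc[OF assms(1-3)] p_prime by (intro loc_mult loc_of_int)
    have "of_int \<mu> = 4 * (a * b) * vdet x y z" using assms(4) by (simp add: trip_def mult.assoc)
    thus "of_int \<mu> = of_int (int p) * (of_int (4 * \<eta>) * vdet x y z)" unfolding \<eta> by (simp add: mult_ac)
  qed
qed

text \<open>A commutator is twice a cross product, so its norm is 4 a b times a form in 2 by 2
  minors of coordinates that are integral at p; the factor a b contributes p.\<close>

lemma p_dvd_norm_commutator:
  assumes "qnorm x \<in> loc p" "qnorm y \<in> loc p" "qnorm (x \<star> y - y \<star> x) = of_int k"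
  shows "int p dvd k"
proof -
  obtain \<eta> :: int where \<eta>: "a * b = of_int (int p * \<eta>)" using ab_p by blast
  note c = coords_loc[OF assms(1)] coords_loc[OF assms(2)]
  define w where "w = - b * (q2 x * q3 y - q3 x * q2 y)\<^sup>2 - a * (q1 x * q3 y - q3 x * q1 y)\<^sup>2 + (q1 x *
      q2 y - q2 x * q1 y)\<^sup>2"
  show ?thesis
  proof (rule loc_dvd[OF p_prime])
    show "of_int (4 * \<eta>) * w \<in> loc p"
      unfolding w_def using c ab_loc p_prime by (intro loc_intros loc_of_int) auto
    have "qnorm (x \<star> y - y \<star> x) = 4 * (a * b) * w"
      unfolding qnorm_eq w_def by (simp add: power2_eq_square algebra_simps)
    thus "of_int k = of_int (int p) * (of_int (4 * \<eta>) * w)" unfolding \<eta> assms(3) by (simp add: mult_ac)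
  qed
qed

lemma coords_subring:
  defines "R \<equiv> {x. q0 x \<in> loc p \<and> q1 x \<in> loc p \<and> q2 x \<in> loc p \<and> q3 x \<in> loc p}"
  shows "subring_quat R" "x \<in> R \<Longrightarrow> qnorm x \<in> loc p"
proof -
  show "subring_quat R"
    unfolding subring_quat_def R_def using p_prime ab_loc
    by (auto intro!: loc_intros)
  show "qnorm x \<in> loc p" if "x \<in> R"
    unfolding qnorm_eq using that p_prime ab_loc by (auto simp: R_def intro!: loc_intros)
qed

text \<open>Anisotropy at p gives a factor p; it remains to see that no prime l divides the cofactor
  \<kappa>. For l different from p this follows from a local order of unit discriminant, for l = p
  from comparison with 1, i, j, k.\<close>

theorem maximal_order_discriminant:
  assumes M: "ord_like M" and max: "\<And>S. ord_like S \<Longrightarrow> M \<subseteq> S \<Longrightarrow> S = M" and t: "tri_basis M e1 e2 e3"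
  shows "trip e1 e2 e3 = of_nat p"
proof -
  have norm: "\<And>x. x \<in> M \<Longrightarrow> qnorm x \<in> \<int>" using M by (auto simp: ord_like_def)
  hence normp: "\<And>x. x \<in> M \<Longrightarrow> qnorm x \<in> loc p" using loc_Ints[OF p_prime] by blast
  note mem = tri_basis_mem[OF t]
  obtain \<mu> where \<mu>: "trip e1 e2 e3 = of_int \<mu>" using trip_int[OF M mem] by (auto elim: Ints_cases)
  have "vdet e1 e2 e3 > 0" using tri_basis_vdet[OF t] t by (simp add: tri_basis_def)
  hence "trip e1 e2 e3 > 0" using a_neg b_neg by (simp add: trip_def mult_neg_neg)
  hence \<mu>0: "\<mu> > 0" using \<mu> by simp
  have "int p dvd \<mu>" using p_dvd_trip[OF normp normp normp \<mu>] mem by blast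
  then obtain \<kappa> where \<kappa>: "\<mu> = int p * \<kappa>" by blast
  have "\<not> int l dvd \<kappa>" if l: "prime l" for l
  proof (cases "l = p")
    case False
    obtain R x y z where R: "local_order l R" "x \<in> R" "y \<in> R" "z \<in> R" "trip x y z \<noteq> 0" "1 / trip x y z \<in> loc l"
      using unramified[OF l False] unfolding unramified_at_def by blast
    have "\<not> int l dvd \<mu>" by (rule maximal_order_unit_at[OF l R M max t \<mu>])
    thus ?thesis using \<kappa> by auto
  next
    case True
    \<comment> \<open>At p the ring of elements with integral coordinates contains M, so M absorbs
      it and contains prime-to-p multiples of i, j, k. Their \<open>trip\<close> is 4 a b up to a
      factor prime to p, and has only one factor p.\<close>
    define R where "R = {x :: quat. q0 x \<in> loc p \<and> q1 x \<in> loc p \<and> q2 x \<in> loc p \<and> q3 x \<in> loc p}"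
    have MR: "M \<subseteq> R" using coords_loc[OF normp] by (auto simp: R_def)
    have nR: "qnorm x \<in> loc p" if "x \<in> R" for x using coords_subring(2) that by (simp add: R_def)
    note absorb = maximal_order_absorbs[OF p_prime M max coords_subring(1)[folded R_def] nR MR]
    let ?i = "(0, 1, 0, 0) :: quat" and ?j = "(0, 0, 1, 0) :: quat" and ?k = "(0, 0, 0, 1) :: quat"
    have ijk: "?i \<in> R" "?j \<in> R" "?k \<in> R" using p_prime by (simp_all add: R_def)
    obtain d1 where d1: "\<not> int p dvd d1" "qscal (of_int d1) ?i \<in> M" using absorb ijk(1) by blast
    obtain d2 where d2: "\<not> int p dvd d2" "qscal (of_int d2) ?j \<in> M" using absorb ijk(2) by blast
    obtain d3 where d3: "\<not> int p dvd d3" "qscal (of_int d3) ?k \<in> M" using absorb ijk(3) by blast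
    obtain n where n: "vdet (qscal (of_int d1) ?i) (qscal (of_int d2) ?j) (qscal (of_int d3) ?k) = of_int
        n * vdet e1 e2 e3"
      using tri_basis_vdet_multiple[OF t d1(2) d2(2) d3(2)] .
    obtain \<eta> :: int where \<eta>: "a * b = of_int (int p * \<eta>)" "\<not> int p dvd \<eta>" using ab_p by blast
    have "4 * (a * b) * of_int (d1 * d2 * d3) = 4 * a * b * (of_int n * vdet e1 e2 e3)"
      unfolding n[symmetric] by (simp add: vdet_def)
    also have "\<dots> = of_int (n * \<mu>)" using \<mu> by (simp add: trip_def mult_ac)
    finally have "4 * (a * b) * of_int (d1 * d2 * d3) = of_int (n * \<mu>)" .
    hence "of_int (int p * (4 * \<eta> * (d1 * d2 * d3))) = (of_int (int p * (n * \<kappa>)) :: rat)"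
      unfolding \<eta>(1) \<kappa> by (simp add: mult_ac)
    hence "int p * (4 * \<eta> * (d1 * d2 * d3)) = int p * (n * \<kappa>)" by (simp only: of_int_eq_iff)
    hence eq: "4 * \<eta> * (d1 * d2 * d3) = n * \<kappa>" using p_prime by (auto dest: prime_gt_0_nat)
    have pp: "prime (int p)" using p_prime by simp
    have "p \<noteq> 2" using p_odd by auto
    hence "\<not> int p dvd 4" by (rule odd_prime_not_dvd_four[OF p_prime])
    hence "\<not> int p dvd 4 * \<eta> * (d1 * d2 * d3)" using pp \<eta>(2) d1 d2 d3 by (simp add: prime_dvd_mult_iff)
    thus ?thesis using eq True by (metis dvd_mult)
  qed
  moreover have "\<kappa> > 0" using \<mu>0 \<kappa> p_prime by (simp add: zero_less_mult_iff)
  ultimately have "nat \<kappa> = 1"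
    using prime_factor_nat[of "nat \<kappa>"] by (metis int_dvd_int_iff int_nat_eq less_imp_le)
  hence "\<kappa> = 1" using \<open>\<kappa> > 0\<close> by linarith
  thus ?thesis using \<mu> \<kappa> by simp
qed

end

section \<open>The three presentations of the algebra\<close>

lemma prime_not_dvd_prime: "prime l \<Longrightarrow> prime m \<Longrightarrow> l \<noteq> m \<Longrightarrow> \<not> int l dvd int m"
  using primes_dvd_imp_eq by (auto simp: int_dvd_int_iff)

text \<open>At p the norm form is built from sums of two squares, and -1 is a nonresidue. At 2, the
  constant b = -p is 1 modulo 4.\<close>

lemma quat_ram_3_mod_4:
  assumes p: "prime p" "p mod 4 = 3"
  shows "quat_ram (- 1) (- of_nat p) p"
proof -
  have p2: "2 < p" using p prime_ge_2_nat[of p] by (cases "p = 2") auto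
  interpret quat_alg "- 1" "- of_nat p"
    by unfold_locales (use p2 in auto)
  show ?thesis
  proof
    show "odd p" using p(2) by presburger
    show "unramified_at l" if l: "prime l" "l \<noteq> p" for l
    proof (cases "l = 2")
      case True
      have "- int p = 4 * (- int (p div 4) - 1) + 1" using p(2) by presburger
      hence "- of_nat p = (of_int (4 * (- int (p div 4) - 1) + 1) :: rat)" by (metis of_int_minus of_int_of_nat_eq)
      thus ?thesis using True unramified_at_two[of "- 1" "- int (p div 4) - 1"] by simp
    next
      case False
      have "\<not> int l dvd 4 * (- 1) * (- int p)"
        using l odd_prime_not_dvd_four[OF l(1) False] prime_not_dvd_prime[OF l(1) p(1) l(2)]
        by (simp add: prime_dvd_mult_iff)
      thus ?thesis using unramified_at_standard[OF l(1), of "- 1" "- int p"] by simp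
    qed
    show "(- 1 :: rat) \<in> loc p" "- of_nat p \<in> loc p"
      using loc_of_int[OF p(1), of "- 1"] loc_of_int[OF p(1), of "- int p"] by simp_all
    show "\<exists>\<eta>. - 1 * - of_nat p = rat_of_int (int p * \<eta>) \<and> \<not> int p dvd \<eta>"
      using p2 by (intro exI[of _ 1]) simp
    fix x assume "qnorm x \<in> loc p"
    hence "(q0 x)\<^sup>2 - of_int (- 1) * (q1 x)\<^sup>2 + of_nat p * ((q2 x)\<^sup>2 - of_int (- 1) * (q3 x)\<^sup>2) \<in> loc p"
      by (simp add: qnorm_eq algebra_simps)
    thus "q0 x \<in> loc p \<and> q1 x \<in> loc p \<and> q2 x \<in> loc p \<and> q3 x \<in> loc p"
      by (rule anisotropic_integral[OF p(1), rotated]) (use Legendre_minus_one[OF p(1) p2] p(2) in simp)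
  qed (rule p(1))
qed

text \<open>Here -1 is a residue and 2 is not, so -2 is a nonresidue. As a = -2 is even, the prime 2
  requires the special order with quarter coordinates.\<close>

lemma quat_ram_5_mod_8:
  assumes p: "prime p" "p mod 8 = 5"
  shows "quat_ram (- 2) (- of_nat p) p"
proof -
  have p2: "2 < p" using p prime_ge_2_nat[of p] by (cases "p = 2") auto
  have p4: "p mod 4 = 1" using p(2) by presburger
  interpret quat_alg "- 2" "- of_nat p"
    by unfold_locales (use p2 in auto)
  show ?thesis
  proof
    show "odd p" using p(2) by presburger
    show "unramified_at l" if l: "prime l" "l \<noteq> p" for l
    proof (cases "l = 2")
      case True
      have "int p = 8 * int (p div 8) + 5" using p(2) by presburger
      hence "- of_nat p = (- of_int (8 * int (p div 8) + 5) :: rat)" by (metis of_int_of_nat_eq)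
      from unramified_at_two_minus_two[OF refl this] show ?thesis using True by simp
    next
      case False
      have "prime (int l)" using l(1) by simp
      hence "\<not> int l dvd 4 * (4 * int p)"
        using odd_prime_not_dvd_four[OF l(1) False] prime_not_dvd_prime[OF l(1) p(1) l(2)]
        by (simp only: prime_dvd_mult_iff simp_thms)
      hence "\<not> int l dvd 4 * (- 2) * (- int p)" using dvd_mult2[of "int l" "4 * (-2) * (- int p)" 2] by auto
      thus ?thesis using unramified_at_standard[OF l(1), of "- 2" "- int p"] by simp
    qed
    show "(- 2 :: rat) \<in> loc p" "- of_nat p \<in> loc p"
      using loc_of_int[OF p(1), of "- 2"] loc_of_int[OF p(1), of "- int p"] by simp_all
    have "\<not> int p dvd 2" using prime_not_dvd_prime[OF p(1) two_is_prime_nat] p2 by simp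
    thus "\<exists>\<eta>. - 2 * - of_nat p = rat_of_int (int p * \<eta>) \<and> \<not> int p dvd \<eta>"
      by (intro exI[of _ 2]) simp
    fix x assume "qnorm x \<in> loc p"
    hence "(q0 x)\<^sup>2 - of_int (- 2) * (q1 x)\<^sup>2 + of_nat p * ((q2 x)\<^sup>2 - of_int (- 2) * (q3 x)\<^sup>2) \<in> loc p"
      by (simp add: qnorm_eq algebra_simps)
    moreover have "Legendre (- 2) (int p) = - 1"
      using Legendre_mult[OF p(1) p2, of "- 1" 2] Legendre_minus_one[OF p(1) p2] Legendre_two[OF p(1) p4]
          p4 p(2) by simp
    ultimately show "q0 x \<in> loc p \<and> q1 x \<in> loc p \<and> q2 x \<in> loc p \<and> q3 x \<in> loc p"
      using anisotropic_integral[OF p(1)] by blast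
  qed (rule p(1))
qed

lemma quat_ram_1_mod_8:
  assumes p: "prime p" "p mod 8 = 1" and q: "prime q" "q mod 4 = 3" "Legendre (int p) (int q) = - 1"
  shows "quat_ram (- of_nat p) (- of_nat q) p"
proof -
  have p2: "2 < p" using p prime_ge_2_nat[of p] by (cases "p = 2") auto
  have q2: "2 < q" using q prime_ge_2_nat[of q] by (cases "q = 2") auto
  have p4: "p mod 4 = 1" and p_odd: "odd p" using p(2) by presburger+
  have pq: "p \<noteq> q" using p4 q(2) by auto
  interpret quat_alg "- of_nat p" "- of_nat q"
    by unfold_locales (use p2 q2 in auto)
  show ?thesis
  proof
    show "odd p" by (rule p_odd)
    show "unramified_at l" if l: "prime l" "l \<noteq> p" for l
    proof -
      consider "l = 2" | "l = q" | "l \<noteq> 2" "l \<noteq> q" by blast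
      thus ?thesis
      proof cases
        case 1
        have "- int q = 4 * (- int (q div 4) - 1) + 1" using q(2) by presburger
        hence "- of_nat q = (of_int (4 * (- int (q div 4) - 1) + 1) :: rat)" by (metis of_int_minus
            of_int_of_nat_eq)
        thus ?thesis using 1 unramified_at_two[of "- int p" "- int (q div 4) - 1"] p_odd by simp
      next
        case 2
        \<comment> \<open>Modulo q both -1 and p are nonresidues, so -p is a square, and the order
          adapted to a divisor of b applies.\<close>
        have "Legendre (- int p) (int q) = 1"
          using Legendre_mult[OF q(1) q2, of "- 1" "int p"] Legendre_minus_one[OF q(1) q2] q by simp
        then obtain c where "[c\<^sup>2 = - int p] (mod int q)"
          by (auto simp: Legendre_def QuadRes_def split: if_splits)
        then obtain s where s: "c\<^sup>2 - (- int p) = int q * s" by (auto simp: cong_iff_dvd_diff)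
        have "\<not> int q dvd 4 * (- int p)"
          using q odd_prime_not_dvd_four[OF q(1)] prime_not_dvd_prime[OF q(1) p(1)] pq q2
          by (simp add: prime_dvd_mult_iff)
        thus ?thesis unfolding 2 using unramified_at_divisor[OF q(1) _ _ s] by simp
      next
        case 3
        have "\<not> int l dvd 4 * (- int p) * (- int q)"
          using l odd_prime_not_dvd_four[OF l(1) 3(1)] prime_not_dvd_prime[OF l(1) p(1) l(2)]
            prime_not_dvd_prime[OF l(1) q(1) 3(2)]
          by (simp add: prime_dvd_mult_iff)
        thus ?thesis using unramified_at_standard[OF l(1), of "- int p" "- int q"] by simp
      qed
    qed
    show "- of_nat p \<in> loc p" "- of_nat q \<in> loc p"
      using loc_of_int[OF p(1), of "- int q"] loc_of_int[OF p(1), of "- int p"] by simp_all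
    show "\<exists>\<eta>. - of_nat p * - of_nat q = rat_of_int (int p * \<eta>) \<and> \<not> int p dvd \<eta>"
      using prime_not_dvd_prime[OF p(1) q(1) pq] by (intro exI[of _ "int q"]) simp
    fix x assume "qnorm x \<in> loc p"
    \<comment> \<open>Here p divides a instead of b, so the coordinates are paired as 1 with j and i
      with k, and the nonresidue at p is -q.\<close>
    hence "(q0 x)\<^sup>2 - of_int (- int q) * (q2 x)\<^sup>2 + of_nat p * ((q1 x)\<^sup>2 - of_int (- int q) * (q3 x)\<^sup>2) \<in> loc p"
      by (simp add: qnorm_eq algebra_simps)
    moreover have "Legendre (- int q) (int p) = - 1"
    proof -
      have "even ((p - 1) div 2 * ((q - 1) div 2))" using p4 by (simp add: even_mult_iff) presburger
      hence "Legendre (int p) (int q) * Legendre (int q) (int p) = 1"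
        using Quadratic_Reciprocity[OF p(1) p2 q(1) q2 pq] by simp
      hence "Legendre (int q) (int p) = - 1" using q(3) by simp
      thus ?thesis
        using Legendre_mult[OF p(1) p2, of "- 1" "int q"] Legendre_minus_one[OF p(1) p2] p4 by simp
    qed
    ultimately show "q0 x \<in> loc p \<and> q1 x \<in> loc p \<and> q2 x \<in> loc p \<and> q3 x \<in> loc p"
      using anisotropic_integral[OF p(1)] by blast
  qed (rule p(1))
qed

theorem quat_ram_Bp:
  assumes p: "prime p" "odd p"
  shows "quat_ram (Bp_a p) (Bp_b p) p"
proof -
  have "p mod 4 = 3 \<or> p mod 8 = 5 \<or> p mod 8 = 1" using p(2) by presburger
  then consider "p mod 4 = 3" | "p mod 8 = 5" | "p mod 8 = 1" by blast
  thus ?thesis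
  proof cases
    case 1
    thus ?thesis using quat_ram_3_mod_4[OF p(1)] by (simp add: Bp_a_def Bp_b_def)
  next
    case 2
    hence "p mod 4 \<noteq> 3" by presburger
    thus ?thesis using quat_ram_5_mod_8[OF p(1) 2] 2 by (simp add: Bp_a_def Bp_b_def)
  next
    case 3
    have "prime (pizer_q p) \<and> pizer_q p mod 4 = 3 \<and> Legendre (int p) (int (pizer_q p)) = - 1"
      unfolding pizer_q_def by (rule LeastI_ex[OF exists_prime_3_mod_4_nonresidue[OF p(1) 3]])
    moreover have "p mod 4 \<noteq> 3" using 3 by presburger
    ultimately show ?thesis using quat_ram_1_mod_8[OF p(1) 3] 3 by (simp add: Bp_a_def Bp_b_def)
  qed
qed

section \<open>Successive minima\<close>

lemma vdet_combination:
  "vdet (qcomb x0 x1 x2 x3 u v w)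
        (qcomb y0 y1 y2 y3 u v w)
        (qcomb z0 z1 z2 z3 u v w) =
   (x1 * (y2 * z3 - y3 * z2) - x2 * (y1 * z3 - y3 * z1) + x3 * (y1 * z2 - y2 * z1)) * vdet u v w"
  by (simp add: vdet_def algebra_simps)

text \<open>Integral independence becomes rational independence by clearing denominators, and then
  the exchange bound applies.\<close>

lemma rank_at_least_le_card:
  assumes rank: "rank_at_least M n" and sub: "M \<subseteq> quat.span T" and fin: "finite T"
  shows "n \<le> card T"
proof -
  obtain v :: "nat \<Rightarrow> quat" where v: "\<And>k. k < n \<Longrightarrow> v k \<in> M"
    and ind: "\<And>c :: nat \<Rightarrow> int. (\<Sum>k<n. qscal (of_int (c k)) (v k)) = 0 \<Longrightarrow> \<forall>k<n. c k = 0"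
    using rank unfolding rank_at_least_def by blast
  have rat: "\<forall>k<n. c k = 0" if c0: "(\<Sum>k<n. qscal (c k) (v k)) = 0" for c :: "nat \<Rightarrow> rat"
  proof -
    obtain d :: int where d: "d > 0" "\<And>x. x \<in> c ` {..<n} \<Longrightarrow> of_int d * x \<in> \<int>"
      by (rule common_denominator[of "c ` {..<n}"]) auto
    have "\<forall>k\<in>{..<n}. \<exists>m::int. of_int d * c k = of_int m" using d(2) by (auto elim!: Ints_cases)
    then obtain m :: "nat \<Rightarrow> int" where m: "\<forall>k\<in>{..<n}. of_int d * c k = of_int (m k)"
      by (rule bchoice[elim_format]) blast
    have "(\<Sum>k<n. qscal (of_int (m k)) (v k)) = (\<Sum>k<n. qscal (of_int d) (qscal (c k) (v k)))"
      using m by (intro sum.cong) auto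
    also have "\<dots> = 0" unfolding quat.scale_sum_right[symmetric] c0 by simp
    finally have "\<forall>k<n. m k = 0" by (rule ind)
    thus ?thesis using m d(1) by auto
  qed
  note fam = independent_family[where n = n and e = v, OF rat]
  have "card (v ` {..<n}) \<le> card T"
    using quat.independent_span_bound[OF fin fam(2)] v sub by auto
  thus ?thesis by (simp add: card_image[OF fam(1)])
qed

lemma zmod_gen_subset:
  assumes "S \<subseteq> L" "0 \<in> L" "\<And>x y. x \<in> L \<Longrightarrow> y \<in> L \<Longrightarrow> x + y \<in> L" "\<And>x. x \<in> L \<Longrightarrow> - x \<in> L"
  shows "zmod_gen S \<subseteq> L"
proof
  fix x assume "x \<in> zmod_gen S"
  thus "x \<in> L" by induction (use assms in auto)
qed

lemma zmod_gen_subset_span: "S \<subseteq> quat.span T \<Longrightarrow> zmod_gen S \<subseteq> quat.span T"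
  by (rule zmod_gen_subset) (auto intro: quat.span_add quat.span_zero quat.span_neg)

lemma rank_at_leastI:
  assumes "inj_on v {..<n}" "quat.independent (v ` {..<n})" "\<And>k. k < n \<Longrightarrow> v k \<in> M"
  shows "rank_at_least M n"
  unfolding rank_at_least_def
proof (intro exI[of _ v] conjI allI impI)
  fix c :: "nat \<Rightarrow> int" and k assume c: "(\<Sum>k<n. qscal (of_int (c k)) (v k)) = 0" and k: "k < n"
  define u where "u = (\<lambda>x. of_int (c (inv_into {..<n} v x)) :: rat)"
  have uv: "u (v k) = of_int (c k)" if "k < n" for k using that assms(1) by (simp add: u_def)
  have "(\<Sum>x\<in>v ` {..<n}. qscal (u x) x) = (\<Sum>k<n. qscal (u (v k)) (v k))"
    by (simp add: sum.reindex[OF assms(1)])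
  also have "\<dots> = (\<Sum>k<n. qscal (of_int (c k)) (v k))" by (intro sum.cong) (auto simp: uv)
  also have "\<dots> = 0" by (rule c)
  finally have "u (v k) = 0"
    using assms(2) k unfolding quat.dependent_finite[OF finite_imageI[OF finite_lessThan]] by blast
  thus "c k = 0" using uv[OF k] by simp
qed (use assms in auto)

context quat_alg
begin

lemma qnorm_scal: "qnorm (qscal c x) = c\<^sup>2 * qnorm x"
  by (simp add: qnorm_eq power_mult_distrib algebra_simps)

lemma exists_min_norm:
  assumes "x \<in> A" "\<And>x. x \<in> A \<Longrightarrow> qnorm x \<in> \<int>"
  obtains v where "v \<in> A" "\<And>w. w \<in> A \<Longrightarrow> qnorm v \<le> qnorm w"
proof -
  obtain v where v: "v \<in> A" "\<forall>w. w \<in> A \<longrightarrow> nat \<lfloor>qnorm v\<rfloor> \<le> nat \<lfloor>qnorm w\<rfloor>"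
    using ex_has_least_nat[of "\<lambda>v. v \<in> A" x "\<lambda>v. nat \<lfloor>qnorm v\<rfloor>"] assms(1) by auto
  have "qnorm v \<le> qnorm w" if w: "w \<in> A" for w
  proof -
    obtain m n where mn: "qnorm v = of_int m" "qnorm w = of_int n"
      using assms(2)[OF v(1)] assms(2)[OF w] by (auto elim!: Ints_cases)
    have "nat m \<le> nat n" using v(2)[rule_format, OF w] by (simp add: mn)
    moreover have "m \<ge> 0" using qnorm_nonneg[of v] mn by simp
    ultimately show ?thesis using mn qnorm_nonneg[of w] by simp
  qed
  thus ?thesis using that v(1) by blast
qed

text \<open>Each vector is chosen shortest outside the rational span of its predecessors. Its norm
  is no smaller than the minimum because the vectors chosen so far witness the rank, and no larger
  because otherwise all vectors up to the minimum would lie in too small a span.\<close>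

lemma successive_minima_vectors:
  fixes D :: "nat \<Rightarrow> rat"
  assumes zero: "0 \<in> L" and add: "\<And>x y. x \<in> L \<Longrightarrow> y \<in> L \<Longrightarrow> x + y \<in> L" and neg: "\<And>x. x \<in> L \<Longrightarrow> - x \<in> L"
    and int: "\<And>x. x \<in> L \<Longrightarrow> qnorm x \<in> \<int>"
    and rank: "\<And>i. i \<in> {1, 2, 3} \<Longrightarrow> rank_at_least (zmod_gen {v \<in> L. qnorm v \<le> D i}) i"
    and least: "\<And>i D'. i \<in> {1, 2, 3} \<Longrightarrow> rank_at_least (zmod_gen {v \<in> L. qnorm v \<le> D'}) i \<Longrightarrow> D i \<le> D'"
  obtains v1 v2 v3 where "v1 \<in> L" "v2 \<in> L" "v3 \<in> L" "qnorm v1 = D 1" "qnorm v2 = D 2" "qnorm v3 = D 3"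
    "D 1 \<le> D 2" "D 2 \<le> D 3" "quat.independent {v1, v2, v3}" "v1 \<noteq> v2" "v1 \<noteq> v3" "v2 \<noteq> v3"
    "\<forall>w\<in>L. w \<noteq> 0 \<longrightarrow> D 1 \<le> qnorm w" "\<forall>w\<in>L. w \<notin> quat.span {v1} \<longrightarrow> D 2 \<le> qnorm w"
    "\<forall>w\<in>L. w \<notin> quat.span {v1, v2} \<longrightarrow> D 3 \<le> qnorm w"
proof -
  have ex: "\<exists>x. x \<in> L - quat.span T" if "finite T" "card T < i" "i \<in> {1, 2, 3}" for T i
  proof (rule ccontr)
    assume "\<not> ?thesis"
    hence "{v \<in> L. qnorm v \<le> D i} \<subseteq> quat.span T" by blast
    hence "i \<le> card T" using rank_at_least_le_card[OF rank[OF that(3)] zmod_gen_subset_span that(1)] by blast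
    thus False using that by simp
  qed
  have upper: "\<not> D i < qnorm v"
    if "finite T" "card T < i" "i \<in> {1, 2, 3}" and min: "\<And>w. w \<in> L - quat.span T \<Longrightarrow> qnorm v \<le> qnorm w" for T i v
  proof
    assume "D i < qnorm v"
    hence "{v \<in> L. qnorm v \<le> D i} \<subseteq> quat.span T" using min by force
    hence "i \<le> card T" using rank_at_least_le_card[OF rank[OF that(3)] zmod_gen_subset_span that(1)] by blast
    thus False using that by simp
  qed
  have shortest: "\<exists>v. v \<in> L - quat.span T \<and> (\<forall>w. w \<in> L - quat.span T \<longrightarrow> qnorm v \<le> qnorm w)"
    if T: "finite T" "card T < i" "i \<in> {1, 2, 3}" for T i
  proof -
    obtain x where "x \<in> L - quat.span T" using ex[OF T] by blast
    moreover have "qnorm x \<in> \<int>" if "x \<in> L - quat.span T" for x using int that by blast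
    ultimately show ?thesis using exists_min_norm by metis
  qed
  obtain v1 where v1: "v1 \<in> L - quat.span {}" "\<And>w. w \<in> L - quat.span {} \<Longrightarrow> qnorm v1 \<le> qnorm w"
    using shortest[of "{}" 1] by auto
  obtain v2 where v2: "v2 \<in> L - quat.span {v1}" "\<And>w. w \<in> L - quat.span {v1} \<Longrightarrow> qnorm v2 \<le> qnorm w"
    using shortest[of "{v1}" 2] by auto
  have "card {v1, v2} < 3" by (simp add: card_insert_if)
  then obtain v3 where v3: "v3 \<in> L - quat.span {v1, v2}" "\<And>w. w \<in> L - quat.span {v1, v2} \<Longrightarrow> qnorm v3 \<le> qnorm w"
    using shortest[of "{v1, v2}" 3] by auto
  have sub: "quat.span {} \<subseteq> quat.span {v1}" "quat.span {v1} \<subseteq> quat.span {v1, v2}" by (auto intro!: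
      quat.span_mono quat.span_zero)
  have le: "qnorm v1 \<le> qnorm v2" "qnorm v2 \<le> qnorm v3" using v1(2)[of v2] v2(2)[of v3] v2(1) v3(1) sub by auto
  have ne: "v1 \<noteq> v2" "v1 \<noteq> v3" "v2 \<noteq> v3" "v1 \<noteq> 0"
    using v1(1) v2(1) v3(1) by (auto intro: quat.span_base)
  have ind1: "quat.independent {v1}" using ne(4) by simp
  have ind2: "quat.independent {v2, v1}" using quat.independent_insert[of v2 "{v1}"] ind1 v2(1) ne by auto
  have "quat.independent {v3, v2, v1}"
    using quat.independent_insert[of v3 "{v2, v1}"] ind2 v3(1) ne by (auto simp: insert_commute)
  hence ind3: "quat.independent {v1, v2, v3}" by (simp add: insert_commute)
  \<comment> \<open>Counted from zero: \<open>v 0\<close>, \<open>v 1\<close>, \<open>v 2\<close>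
    realize \<open>D 1\<close>, \<open>D 2\<close>, \<open>D 3\<close>, hence the index
    \<open>i - 1\<close> below.\<close>
  define v where "v = (\<lambda>k::nat. if k = 0 then v1 else if k = 1 then v2 else v3)"
  have inj: "inj_on v {..<3}" using ne by (auto simp: inj_on_def v_def less_Suc_eq eval_nat_numeral)
  have img: "v ` {..<3} = {v1, v2, v3}" by (auto simp: v_def eval_nat_numeral lessThan_Suc)
  have r: "rank_at_least (zmod_gen {w \<in> L. qnorm w \<le> qnorm (v (i - 1))}) i" if i: "i \<in> {1, 2, 3}" for i
  proof (rule rank_at_leastI)
    have "{..<i} \<subseteq> {..<3}" using i by auto
    thus "inj_on v {..<i}" "quat.independent (v ` {..<i})"
      using inj_on_subset[OF inj] quat.independent_mono[OF ind3] img by (metis, metis image_mono)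
    show "v k \<in> zmod_gen {w \<in> L. qnorm w \<le> qnorm (v (i - 1))}" if "k < i" for k
      using that i v1(1) v2(1) v3(1) le by (intro zmod_gen.gen) (auto simp: v_def)
  qed
  have D: "qnorm v1 = D 1" "qnorm v2 = D 2" "qnorm v3 = D 3"
    using least[OF _ r[of 1]] upper[of "{}" 1 v1] v1(2) least[OF _ r[of 2]] upper[of "{v1}" 2 v2] v2(2)
      least[OF _ r[of 3]] upper[of "{v1, v2}" 3 v3] v3(2) \<open>card {v1, v2} < 3\<close>
    by (force simp: v_def)+
  show ?thesis
    by (rule that[of v1 v2 v3]) (use v1 v2 v3 D le ne ind3 in auto)
qed

section \<open>Rounding, and bases formed by minimal vectors\<close>

lemma qnorm_combination_convex:
  "(1 - s) * qnorm (qscal s u + w) + s * qnorm (qscal (s - 1) u + w) = s * (1 - s) * qnorm u + qnorm w"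
  unfolding qnorm_eq by (simp add: power2_eq_square algebra_simps)

text \<open>Rounding a coefficient up with probability equal to its fractional part kills the cross
  terms in expectation, so some rounding is at least as good as in the orthogonal case.\<close>

lemma round_coefficient:
  obtains m :: int where "qnorm (qscal (s - of_int m) u + w) \<le> qnorm u / 4 + qnorm w"
proof -
  define t where "t = s - of_int \<lfloor>s\<rfloor>"
  have t: "0 \<le> t" "t < 1" unfolding t_def by linarith+
  have "t * (1 - t) \<le> 1 / 4" using zero_le_power2[of "t - 1 / 2"] by (simp add: power2_eq_square algebra_simps)
  hence "t * (1 - t) * qnorm u \<le> 1 / 4 * qnorm u" by (intro mult_right_mono qnorm_nonneg)
  hence avg: "(1 - t) * qnorm (qscal t u + w) + t * qnorm (qscal (t - 1) u + w) \<le> qnorm u / 4 + qnorm w"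
    unfolding qnorm_combination_convex by simp
  have "qnorm (qscal t u + w) \<le> qnorm u / 4 + qnorm w \<or> qnorm (qscal (t - 1) u + w) \<le> qnorm u / 4 + qnorm w"
  proof (rule ccontr)
    let ?B = "qnorm u / 4 + qnorm w"
    assume "\<not> ?thesis"
    hence gt: "?B < qnorm (qscal t u + w)" "?B < qnorm (qscal (t - 1) u + w)" by auto
    have "(1 - t) * ?B < (1 - t) * qnorm (qscal t u + w)" using gt(1) t by simp
    moreover have "t * ?B \<le> t * qnorm (qscal (t - 1) u + w)" using gt(2) t by (intro mult_left_mono) auto
    moreover have "(1 - t) * ?B + t * ?B = ?B" unfolding distrib_right[symmetric] by simp
    ultimately show False using avg by linarith
  qed
  moreover have "t = s - of_int \<lfloor>s\<rfloor>" "t - 1 = s - of_int (\<lfloor>s\<rfloor> + 1)" by (simp_all add: t_def)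
  ultimately show ?thesis using that by metis
qed

lemma notin_span_combination:
  assumes "quat.independent (insert v T)" "v \<notin> T" "x \<in> quat.span T" "c \<noteq> 0"
  shows "qscal c v + x \<notin> quat.span T"
proof
  assume "qscal c v + x \<in> quat.span T"
  hence "qscal c v + x - x \<in> quat.span T" using assms(3) by (rule quat.span_diff)
  hence "qscal c v \<in> quat.span T" by simp
  hence "qscal (1 / c) (qscal c v) \<in> quat.span T" by (rule quat.span_scale)
  hence "v \<in> quat.span T" using assms(4) by simp
  thus False using assms(1,2) by (simp add: quat.independent_insert)
qed

lemma pure_independent_combination:
  assumes ind: "quat.independent {v1, v2, v3}" "v1 \<noteq> v2" "v1 \<noteq> v3" "v2 \<noteq> v3"
    and pure: "q0 v1 = 0" "q0 v2 = 0" "q0 v3 = 0"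
  obtains c0 c1 c2 c3 where "x = qcomb c0 c1 c2 c3 v1 v2 v3"
proof -
  define e where "e = (\<lambda>k::nat. if k = 0 then qone else if k = 1 then v1 else if k = 2 then v2 else v3)"
  have sum4: "(\<Sum>i<4. f i) = f 0 + f 1 + f 2 + f 3" for f :: "nat \<Rightarrow> quat"
    by (simp add: eval_nat_numeral)
  have ind4: "\<forall>i<4. c i = 0" if c: "(\<Sum>i<4. qscal (c i) (e i)) = 0" for c :: "nat \<Rightarrow> rat"
  proof -
    have eq: "qcomb (c 0) (c 1) (c 2) (c 3) v1 v2 v3 = 0"
      using c by (simp add: sum4 e_def)
    hence "q0 (qcomb (c 0) (c 1) (c 2) (c 3) v1 v2 v3) = 0" by simp
    hence c0: "c 0 = 0" using pure by simp
    define u where "u = (\<lambda>x. if x = v1 then c 1 else if x = v2 then c 2 else c 3)"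
    have "(\<Sum>x\<in>{v1, v2, v3}. qscal (u x) x) = 0" using eq c0 ind(2-4) by (simp add: u_def add.assoc)
    hence "\<forall>x\<in>{v1, v2, v3}. u x = 0" 
      using ind(1) unfolding quat.dependent_finite[of "{v1, v2, v3}", simplified] by blast
    hence "c 1 = 0" "c 2 = 0" "c 3 = 0" using ind(2-4) by (auto simp: u_def)
    thus ?thesis using c0 by (auto simp: less_Suc_eq eval_nat_numeral)
  qed
  obtain c where "x = (\<Sum>i<4. qscal (c i) (e i))" by (rule four_independent_span[of e, OF ind4])
  hence "x = qcomb (c 0) (c 1) (c 2) (c 3) v1 v2 v3" by (simp add: sum4 e_def)
  thus ?thesis by (rule that)
qed

text \<open>Writing i, j, k in terms of the triple makes their determinant 1 a multiple of
  \<open>vdet v1 v2 v3\<close>.\<close>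

lemma pure_independent_vdet:
  assumes ind: "quat.independent {v1, v2, v3}" "v1 \<noteq> v2" "v1 \<noteq> v3" "v2 \<noteq> v3"
    and pure: "q0 v1 = 0" "q0 v2 = 0" "q0 v3 = 0"
  shows "vdet v1 v2 v3 \<noteq> 0"
proof
  assume zero: "vdet v1 v2 v3 = 0"
  note comb = pure_independent_combination[OF ind pure]
  obtain x0 x1 x2 x3 where x: "(0, 1, 0, 0) = qcomb x0 x1 x2 x3 v1 v2 v3" using comb .
  obtain y0 y1 y2 y3 where y: "(0, 0, 1, 0) = qcomb y0 y1 y2 y3 v1 v2 v3" using comb .
  obtain z0 z1 z2 z3 where z: "(0, 0, 0, 1) = qcomb z0 z1 z2 z3 v1 v2 v3" using comb .
  have "vdet (0, 1, 0, 0) (0, 0, 1, 0) (0, 0, 0, 1) = 0" unfolding x y z vdet_combination zero by simp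
  thus False by (simp add: vdet_def)
qed

text \<open>Rounding a nonintegral coefficient would give a shorter vector: up to three coefficients, each
  contributing at most a quarter of the largest norm.\<close>

lemma successive_minima_basis:
  assumes add: "\<And>x y. x \<in> L \<Longrightarrow> y \<in> L \<Longrightarrow> x + y \<in> L" and neg: "\<And>x. x \<in> L \<Longrightarrow> - x \<in> L"
    and pure: "\<And>x. x \<in> L \<Longrightarrow> q0 x = 0"
    and v: "v1 \<in> L" "v2 \<in> L" "v3 \<in> L" and le: "qnorm v1 \<le> qnorm v2" "qnorm v2 \<le> qnorm v3"
    and ind: "quat.independent {v1, v2, v3}" "v1 \<noteq> v2" "v1 \<noteq> v3" "v2 \<noteq> v3"
    and min: "\<And>w. w \<in> L \<Longrightarrow> w \<noteq> 0 \<Longrightarrow> qnorm v1 \<le> qnorm w"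
      "\<And>w. w \<in> L \<Longrightarrow> w \<notin> quat.span {v1} \<Longrightarrow> qnorm v2 \<le> qnorm w"
      "\<And>w. w \<in> L \<Longrightarrow> w \<notin> quat.span {v1, v2} \<Longrightarrow> qnorm v3 \<le> qnorm w"
    and w: "w \<in> L"
  obtains n1 n2 n3 :: int where "w = qscal (of_int n1) v1 + qscal (of_int n2) v2 + qscal (of_int n3) v3"
proof -
  have nz: "v1 \<noteq> 0" using ind(1) quat.dependent_zero by auto
  have pos: "qnorm v1 > 0" using qnorm_pos[OF nz] .
  have zero: "0 \<in> L" using add[OF v(1) neg[OF v(1)]] by simp
  have natm: "qscal (of_nat n) x \<in> L" if "x \<in> L" for n x
    by (induction n) (use zero add that in \<open>auto simp: qscal_add_left\<close>)
  have intm: "qscal (of_int n) x \<in> L" if "x \<in> L" for n x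
    using natm[OF that, of "nat n"] neg[OF natm[OF that, of "nat (- n)"]] by (cases "n \<ge> 0") auto
  have diff: "x - qscal (of_int n) y \<in> L" if "x \<in> L" "y \<in> L" for x y n
    using add[OF that(1) neg[OF intm[OF that(2)]]] by simp
  have ind3: "quat.independent (insert v3 {v1, v2})" "v3 \<notin> {v1, v2}"
    using ind by (auto simp: insert_commute)
  have ind2: "quat.independent (insert v2 {v1})" "v2 \<notin> {v1}"
    using quat.independent_mono[OF ind(1), of "{v2, v1}"] ind by auto
  obtain c0 c1 c2 c3 where w': "w = qcomb c0 c1 c2 c3 v1 v2 v3"
    using pure_independent_combination[OF ind pure[OF v(1)] pure[OF v(2)] pure[OF v(3)]] .
  have "q0 w = 0" by (rule pure[OF w])
  hence "c0 = 0" unfolding w' using pure v by simp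
  hence w1: "w = qscal c1 v1 + qscal c2 v2 + qscal c3 v3" using w' by simp
  have "c3 \<in> \<int>"
  proof (rule ccontr)
    assume c3: "c3 \<notin> \<int>"
    obtain n3 :: int where n3: "qnorm (qscal (c3 - of_int n3) v3 + 0) \<le> qnorm v3 / 4 + qnorm 0"
      using round_coefficient .
    obtain n2 :: int where n2: "qnorm (qscal (c2 - of_int n2) v2 + (qscal (c3 - of_int n3) v3))
       \<le> qnorm v2 / 4 + qnorm (qscal (c3 - of_int n3) v3)" using round_coefficient .
    define x where "x = qscal (c2 - of_int n2) v2 + (qscal (c3 - of_int n3) v3)"
    obtain n1 :: int where n1: "qnorm (qscal (c1 - of_int n1) v1 + x) \<le> qnorm v1 / 4 + qnorm x"
      using round_coefficient .
    define y where "y = qscal (c1 - of_int n1) v1 + x"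
    have "qnorm y \<le> qnorm v1 / 4 + qnorm v2 / 4 + qnorm v3 / 4"
      using n1 n2 n3 unfolding y_def[symmetric] x_def[symmetric] by (simp add: qnorm_eq[of 0])
    hence "qnorm y < qnorm v3" using le pos by simp
    moreover have "y = w - qscal (of_int n1) v1 - qscal (of_int n2) v2 - qscal (of_int n3) v3"
      by (simp add: y_def x_def w1 qscal_diff_left)
    hence "y \<in> L" using diff w v by simp
    moreover have "y = qscal (c3 - of_int n3) v3 + (qscal (c1 - of_int n1) v1 + qscal (c2 - of_int n2) v2)"
      by (simp add: y_def x_def)
    moreover have "c3 - of_int n3 \<noteq> 0" using c3 by auto
    ultimately have "y \<notin> quat.span {v1, v2}"
      using notin_span_combination[OF ind3, of _ "c3 - of_int n3"]
      by (simp add: quat.span_add quat.span_scale quat.span_base)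
    from min(3)[OF \<open>y \<in> L\<close> this] \<open>qnorm y < qnorm v3\<close> show False by simp
  qed
  then obtain n3 where n3: "c3 = of_int n3" by (auto elim: Ints_cases)
  \<comment> \<open>With the integral multiple of the longest vector removed, the remainder lies in
    a smaller span, and the same argument runs against the next smaller minimum.\<close>
  define w2 where "w2 = w - qscal (of_int n3) v3"
  have w2: "w2 \<in> L" "w2 = qscal c1 v1 + qscal c2 v2" using diff[OF w v(3), of n3] by (simp_all add: w2_def w1 n3)
  have "c2 \<in> \<int>"
  proof (rule ccontr)
    assume c2: "c2 \<notin> \<int>"
    obtain n2 :: int where n2: "qnorm (qscal (c2 - of_int n2) v2 + 0) \<le> qnorm v2 / 4 + qnorm 0"
      using round_coefficient .
    define x where "x = qscal (c2 - of_int n2) v2"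
    obtain n1 :: int where n1: "qnorm (qscal (c1 - of_int n1) v1 + x) \<le> qnorm v1 / 4 + qnorm x"
      using round_coefficient .
    define y where "y = qscal (c1 - of_int n1) v1 + x"
    have "qnorm y \<le> qnorm v1 / 4 + qnorm v2 / 4"
      using n1 n2 unfolding y_def[symmetric] x_def[symmetric] by (simp add: qnorm_eq[of 0])
    hence "qnorm y < qnorm v2" using le pos by simp
    moreover have "y = w2 - qscal (of_int n1) v1 - qscal (of_int n2) v2"
      by (simp add: y_def x_def w2(2) qscal_diff_left)
    hence "y \<in> L" using diff w2(1) v by simp
    moreover have "y = qscal (c2 - of_int n2) v2 + (qscal (c1 - of_int n1) v1)"
      by (simp add: y_def x_def)
    moreover have "c2 - of_int n2 \<noteq> 0" using c2 by auto
    ultimately have "y \<notin> quat.span {v1}"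
      using notin_span_combination[OF ind2, of _ "c2 - of_int n2"]
      by (simp add: quat.span_add quat.span_scale quat.span_base)
    from min(2)[OF \<open>y \<in> L\<close> this] \<open>qnorm y < qnorm v2\<close> show False by simp
  qed
  then obtain n2 where n2: "c2 = of_int n2" by (auto elim: Ints_cases)
  define w3 where "w3 = w2 - qscal (of_int n2) v2"
  have w3: "w3 \<in> L" "w3 = qscal c1 v1" using diff[OF w2(1) v(2), of n2] by (simp_all add: w3_def w2(2) n2)
  have "c1 \<in> \<int>"
  proof (rule ccontr)
    assume c1: "c1 \<notin> \<int>"
    obtain n1 :: int where n1: "qnorm (qscal (c1 - of_int n1) v1 + 0) \<le> qnorm v1 / 4 + qnorm 0"
      using round_coefficient .
    define y where "y = qscal (c1 - of_int n1) v1"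
    have "qnorm y \<le> qnorm v1 / 4"
      using n1 unfolding y_def[symmetric] by (simp add: qnorm_eq[of 0])
    hence "qnorm y < qnorm v1" using pos by simp
    moreover have "y = w3 - qscal (of_int n1) v1" by (simp add: y_def w3(2) qscal_diff_left)
    hence "y \<in> L" using diff w3(1) v by simp
    moreover have "y \<noteq> 0" unfolding y_def quat.scale_eq_0_iff using c1 nz by auto
    ultimately show False using min(1)[of y] by simp
  qed
  then obtain n1 where n1: "c1 = of_int n1" by (auto elim: Ints_cases)
  show ?thesis by (rule that[of n1 n2 n3]) (simp add: w1 n1 n2 n3)
qed

end

section \<open>Gross lattices and isometries\<close>

context quat_alg
begin

lemma tri_basis_coords:
  assumes t: "tri_basis M e1 e2 e3" and x: "x \<in> M"
  shows "\<exists>n::int. q3 x = of_int n * q3 e3"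
    and "q3 x = 0 \<Longrightarrow> \<exists>n::int. q2 x = of_int n * q2 e2"
    and "q3 x = 0 \<Longrightarrow> q2 x = 0 \<Longrightarrow> \<exists>n::int. q1 x = of_int n * q1 e1"
    and "q3 x = 0 \<Longrightarrow> q2 x = 0 \<Longrightarrow> q1 x = 0 \<Longrightarrow> \<exists>n::int. x = qscal (of_int n) qone"
proof -
  obtain n0 n1 n2 n3 :: int where
    n: "x = zcomb n0 n1 n2 n3 e1 e2 e3"
    using t x unfolding tri_basis_def by (elim conjE) (simp only: mem_Collect_eq, elim exE conjE)
  have z: "q2 e1 = 0" "q3 e1 = 0" "q3 e2 = 0" and p: "q1 e1 > 0" "q2 e2 > 0" "q3 e3 > 0"
    using t by (simp_all add: tri_basis_def)
  have x3: "q3 x = of_int n3 * q3 e3" and x2: "q2 x = of_int n2 * q2 e2 + of_int n3 * q2 e3"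
    and x1: "q1 x = of_int n1 * q1 e1 + of_int n2 * q1 e2 + of_int n3 * q1 e3"
    by (simp_all add: n z)
  show "\<exists>n::int. q3 x = of_int n * q3 e3" using x3 by blast
  { assume "q3 x = 0" hence "n3 = 0" using x3 p by simp } note 3 = this
  show "q3 x = 0 \<Longrightarrow> \<exists>n::int. q2 x = of_int n * q2 e2" using 3 x2 by auto
  { assume "q3 x = 0" "q2 x = 0" hence "n2 = 0" using 3 x2 p by simp } note 2 = this
  show "q3 x = 0 \<Longrightarrow> q2 x = 0 \<Longrightarrow> \<exists>n::int. q1 x = of_int n * q1 e1" using 3 2 x1 by auto
  show "\<exists>n::int. x = qscal (of_int n) qone" if "q3 x = 0" "q2 x = 0" "q1 x = 0"
  proof -
    have "n1 = 0" using that 3 2 x1 p by simp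
    thus ?thesis using 3[OF that(1)] 2[OF that(1,2)] n by (intro exI[of _ n0]) simp
  qed
qed

lemma cosets_eq_iff:
  assumes "subring_quat R"
  shows "(\<lambda>z. x + z) ` R = (\<lambda>z. y + z) ` R \<longleftrightarrow> x - y \<in> R"
proof
  note r = subring_quatD[OF assms]
  assume "(\<lambda>z. x + z) ` R = (\<lambda>z. y + z) ` R"
  moreover have "x \<in> (\<lambda>z. x + z) ` R" using r(6) by (intro image_eqI[of _ _ 0]) auto
  ultimately have "x \<in> (\<lambda>z. y + z) ` R" by blast
  then obtain z where "z \<in> R" "x = y + z" by blast
  thus "x - y \<in> R" by simp
next
  note r = subring_quatD[OF assms]
  assume d: "x - y \<in> R"
  show "(\<lambda>z. x + z) ` R = (\<lambda>z. y + z) ` R"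
  proof (intro equalityI subsetI)
    fix w assume "w \<in> (\<lambda>z. x + z) ` R"
    then obtain z where "z \<in> R" "w = x + z" by blast
    thus "w \<in> (\<lambda>z. y + z) ` R" using r(3)[OF d, of z] by (intro image_eqI[of _ _ "x - y + z"]) auto
  next
    fix w assume "w \<in> (\<lambda>z. y + z) ` R"
    then obtain z where "z \<in> R" "w = y + z" by blast
    thus "w \<in> (\<lambda>z. x + z) ` R" using r(4)[OF _ d, of z] by (intro image_eqI[of _ _ "z - (x - y)"]) auto
  qed
qed

lemma mult_int_lt_eq_zero:
  fixes d n t :: int
  assumes "d = n * t" "\<bar>d\<bar> < t"
  shows "d = 0"
  using assms dvd_imp_le_int[of d t] by force

text \<open>Relative to the triangular basis of M, that of R has diagonal entries t1, t2, t3, and a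
  box of t1 t2 t3 points represents the cosets. The direction of 1 contributes none, as 1 lies in
  both orders.\<close>

theorem order_index_vdet:
  assumes M: "ord_like M" and R: "ord_like R" and sub: "R \<subseteq> M"
    and te: "tri_basis M e1 e2 e3" and tf: "tri_basis R f1 f2 f3"
  shows "vdet f1 f2 f3 = of_nat (order_index R M) * vdet e1 e2 e3"
proof -
  have Mring: "subring_quat M" and Rring: "subring_quat R" using M R by (auto simp: ord_like_def)
  note m = subring_quatD[OF Mring] and r = subring_quatD[OF Rring]
  note e = tri_basis_mem[OF te] and f = tri_basis_mem[OF tf]
  have ez: "q2 e1 = 0" "q3 e1 = 0" "q3 e2 = 0" and ep: "q1 e1 > 0" "q2 e2 > 0" "q3 e3 > 0"
    using te by (simp_all add: tri_basis_def)
  have fz: "q2 f1 = 0" "q3 f1 = 0" "q3 f2 = 0" and fp: "q1 f1 > 0" "q2 f2 > 0" "q3 f3 > 0"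
    using tf by (simp_all add: tri_basis_def)
  obtain t1 :: int where t1: "q1 f1 = of_int t1 * q1 e1" using tri_basis_coords(3)[OF te] f(1) sub fz by blast
  obtain t2 :: int where t2: "q2 f2 = of_int t2 * q2 e2" using tri_basis_coords(2)[OF te] f(2) sub fz by blast
  obtain t3 :: int where t3: "q3 f3 = of_int t3 * q3 e3" using tri_basis_coords(1)[OF te] f(3) sub by blast
  have tp: "t1 > 0" "t2 > 0" "t3 > 0" using fp ep unfolding t1 t2 t3 by (simp_all add: zero_less_mult_iff)
  define g where "g = (\<lambda>(c1, c2, c3). qscal (of_int c1) e1 + qscal (of_int c2) e2 + qscal (of_int c3) e3)"
  define C where "C = {0..<t1} \<times> {0..<t2} \<times> {0..<t3}"
  have gM: "g c \<in> M" for c unfolding g_def by (cases c) (auto intro!: m e)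
  have "bij_betw (\<lambda>c. (\<lambda>y. g c + y) ` R) C ((\<lambda>x. (\<lambda>y. x + y) ` R) ` M)"
  proof (rule bij_betwI')
    fix c d assume cd: "c \<in> C" "d \<in> C"
    obtain c1 c2 c3 d1 d2 d3 where [simp]: "c = (c1, c2, c3)" "d = (d1, d2, d3)" by (cases c, cases d) blast
    have lt: "\<bar>c1 - d1\<bar> < t1" "\<bar>c2 - d2\<bar> < t2" "\<bar>c3 - d3\<bar> < t3" using cd by (auto simp: C_def)
    have "c = d" if d: "g c - g d \<in> R"
    proof -
      have eq: "q3 (g c - g d) = of_int (c3 - d3) * q3 e3"
        "q2 (g c - g d) = of_int (c2 - d2) * q2 e2 + of_int (c3 - d3) * q2 e3"
        "q1 (g c - g d) = of_int (c1 - d1) * q1 e1 + of_int (c2 - d2) * q1 e2 + of_int (c3 - d3) * q1 e3"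
        by (simp_all add: g_def ez algebra_simps)
      obtain n3 :: int where n3: "q3 (g c - g d) = of_int n3 * q3 f3" using tri_basis_coords(1)[OF tf d] by blast
      hence "of_int (c3 - d3) * q3 e3 = of_int (n3 * t3) * q3 e3" unfolding eq t3 by simp
      hence "c3 - d3 = n3 * t3" using ep(3) by (simp only: mult_right_cancel[OF less_imp_neq[THEN
          not_sym]] of_int_eq_iff)
      hence z3: "c3 - d3 = 0" using lt(3) mult_int_lt_eq_zero by blast
      hence "q3 (g c - g d) = 0" unfolding eq by simp
      then obtain n2 :: int where n2: "q2 (g c - g d) = of_int n2 * q2 f2" using tri_basis_coords(2)[OF
          tf d] by blast
      hence "of_int (c2 - d2) * q2 e2 = of_int (n2 * t2) * q2 e2" unfolding eq t2 z3 by simp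
      hence "c2 - d2 = n2 * t2" using ep(2) by (simp only: mult_right_cancel[OF less_imp_neq[THEN
          not_sym]] of_int_eq_iff)
      hence z2: "c2 - d2 = 0" using lt(2) mult_int_lt_eq_zero by blast
      hence "q2 (g c - g d) = 0" unfolding eq z3 by simp
      then obtain n1 :: int where n1: "q1 (g c - g d) = of_int n1 * q1 f1"
        using tri_basis_coords(3)[OF tf d \<open>q3 (g c - g d) = 0\<close>] by blast
      hence "of_int (c1 - d1) * q1 e1 = of_int (n1 * t1) * q1 e1" unfolding eq t1 z3 z2 by simp
      hence "c1 - d1 = n1 * t1" using ep(1) by (simp only: mult_right_cancel[OF less_imp_neq[THEN
          not_sym]] of_int_eq_iff)
      hence "c1 - d1 = 0" using lt(1) mult_int_lt_eq_zero by blast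
      thus ?thesis using z2 z3 by simp
    qed
    thus "((\<lambda>y. g c + y) ` R = (\<lambda>y. g d + y) ` R) = (c = d)"
      unfolding cosets_eq_iff[OF Rring] using r(6) by auto
  next
    fix c assume "c \<in> C"
    show "(\<lambda>y. g c + y) ` R \<in> (\<lambda>x. (\<lambda>y. x + y) ` R) ` M" using gM by blast
  next
    fix X assume "X \<in> (\<lambda>x. (\<lambda>y. x + y) ` R) ` M"
    then obtain x where x: "x \<in> M" "X = (\<lambda>y. x + y) ` R" by blast
    \<comment> \<open>Division with remainder, to be applied from the last coordinate down:
      quotients multiply the basis of R, remainders that of M, and the coordinate becomes
      zero.\<close>
    have step: "of_int n * s - of_int (n div t) * (of_int t * s) - of_int (n mod t) * s = 0" for n t ::
        int and s :: rat
    proof -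
      have "of_int n = (of_int (n div t) * of_int t + of_int (n mod t) :: rat)"
        by (metis div_mult_mod_eq of_int_add of_int_mult)
      thus ?thesis by (simp add: algebra_simps)
    qed
    obtain n3 :: int where n3: "q3 x = of_int n3 * q3 e3" using tri_basis_coords(1)[OF te x(1)] by blast
    define y where "y = x - qscal (of_int (n3 div t3)) f3 - qscal (of_int (n3 mod t3)) e3"
    have y: "y \<in> M" unfolding y_def by (intro m(4) m(7) x(1) e(3) subsetD[OF sub f(3)])
    have y3: "q3 y = 0" using step[of n3 "q3 e3" t3] by (simp add: y_def n3 t3)
    obtain n2 :: int where n2: "q2 y = of_int n2 * q2 e2" using tri_basis_coords(2)[OF te y y3] by blast
    define z where "z = y - qscal (of_int (n2 div t2)) f2 - qscal (of_int (n2 mod t2)) e2"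
    have z: "z \<in> M" unfolding z_def by (intro m(4) m(7) y e(2) subsetD[OF sub f(2)])
    have z3: "q3 z = 0" by (simp add: z_def y3 fz ez)
    have z2: "q2 z = 0" using step[of n2 "q2 e2" t2] by (simp add: z_def n2 t2)
    obtain n1 :: int where n1: "q1 z = of_int n1 * q1 e1" using tri_basis_coords(3)[OF te z z3 z2] by blast
    define w where "w = z - qscal (of_int (n1 div t1)) f1 - qscal (of_int (n1 mod t1)) e1"
    have w: "w \<in> M" unfolding w_def by (intro m(4) m(7) z e(1) subsetD[OF sub f(1)])
    have w3: "q3 w = 0" "q2 w = 0" by (simp_all add: w_def z3 z2 fz ez)
    have w1: "q1 w = 0" using step[of n1 "q1 e1" t1] by (simp add: w_def n1 t1)
    obtain n0 :: int where n0: "w = qscal (of_int n0) qone" using tri_basis_coords(4)[OF te w w3 w1] by blast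
    define c where "c = (n1 mod t1, n2 mod t2, n3 mod t3)"
    have "x - g c = w + qscal (of_int (n1 div t1)) f1 + qscal (of_int (n2 div t2)) f2 + qscal (of_int (n3
        div t3)) f3"
      by (simp add: w_def z_def y_def g_def c_def)
    also have "\<dots> \<in> R" unfolding n0 by (intro r f)
    finally have "X = (\<lambda>y. g c + y) ` R" unfolding x(2) cosets_eq_iff[OF Rring] .
    moreover have "c \<in> C" using tp by (auto simp: c_def C_def)
    ultimately show "\<exists>c\<in>C. X = (\<lambda>y. g c + y) ` R" by blast
  qed
  hence "order_index R M = card C" unfolding order_index_def by (simp add: bij_betw_same_card)
  also have "\<dots> = nat (t1 * t2 * t3)" using tp by (simp add: C_def card_cartesian_product nat_mult_distrib)
  finally have "of_nat (order_index R M) = (of_int (t1 * t2 * t3) :: rat)" using tp by simp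
  thus ?thesis unfolding tri_basis_vdet[OF te] tri_basis_vdet[OF tf] t1 t2 t3 by simp
qed

section \<open>Gross lattices and their Gram matrices\<close>

definition gross :: "quat \<Rightarrow> quat" where "gross x = (x + x) - rtrace x"

lemma gross_coords [simp]: "q0 (gross x) = 0" "q1 (gross x) = 2 * q1 x" "q2 (gross x) = 2 * q2 x" "q3
    (gross x) = 2 * q3 x"
  by (simp_all add: gross_def rtrace_def)

lemma gross_lattice_eq: "gross_lattice R = gross ` R"
  by (simp add: gross_lattice_def gross_def)

lemma gross_add: "gross (x + y) = gross x + gross y"
  and gross_neg: "gross (- x) = - gross x"
  and gross_scal: "gross (qscal c x) = qscal c (gross x)"
  and gross_one [simp]: "gross qone = 0"
  by (simp_all add: quat_eq_iff algebra_simps)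

lemma qnorm_gross: "qnorm (gross x) = 4 * qnorm x - (2 * q0 x)\<^sup>2"
  by (simp add: qnorm_eq power2_eq_square algebra_simps)

lemma qdot_gross: "qdot (gross x) (gross y) = 2 * (qnorm (x + y) - qnorm x - qnorm y) - 2 * q0 x * (2 * q0 y)"
  by (simp add: qnorm_eq qdot_def power2_eq_square algebra_simps)

text \<open>Both sides are the norm of the cross product of the two pure quaternions.\<close>

lemma gram_minor_gross:
  "qnorm (gross x) * qnorm (gross y) - (qdot (gross x) (gross y))\<^sup>2 = 4 * qnorm (x \<star> y - y \<star> x)"
  unfolding qnorm_eq qdot_def by (simp add: power2_eq_square algebra_simps)

text \<open>On imaginary parts the form is diagonal with entries -a, -b, a b, whose product is the
  square of a b; the rest is the squared coordinate determinant.\<close>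

lemma gram_det:
  assumes "q0 u = 0" "q0 v = 0" "q0 w = 0"
  shows "qnorm u * qnorm v * qnorm w + 2 * qdot u v * qdot u w * qdot v w
    - qnorm u * (qdot v w)\<^sup>2 - qnorm v * (qdot u w)\<^sup>2 - qnorm w * (qdot u v)\<^sup>2 = (a * b * vdet u v w)\<^sup>2"
  unfolding qnorm_eq qdot_def vdet_def assms by (simp add: power2_eq_square algebra_simps)

lemma qdot_sym: "qdot x y = qdot y x"
  and qdot_add_left: "qdot (x + y) z = qdot x z + qdot y z"
  and qdot_add_right: "qdot x (y + z) = qdot x y + qdot x z"
  and qdot_diff_left: "qdot (x - y) z = qdot x z - qdot y z"
  and qdot_diff_right: "qdot x (y - z) = qdot x y - qdot x z"
  and qdot_scal_left: "qdot (qscal c x) z = c * qdot x z"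
  and qdot_scal_right: "qdot x (qscal c z) = c * qdot x z"
  by (simp_all add: qdot_def algebra_simps)

lemma qnorm_add: "qnorm (x + y) = qnorm x + 2 * qdot x y + qnorm y"
  by (simp add: qnorm_eq qdot_def power2_eq_square algebra_simps)

lemma qnorm_diff: "qnorm (x - y) = qnorm x - 2 * qdot x y + qnorm y"
  by (simp add: qnorm_eq qdot_def power2_eq_square algebra_simps)

text \<open>The orthogonal projection of the third vector away from the first two has norm at least
  \<open>D3 - D1/4 - D2/4\<close>, since its coordinates along the first two can be rounded.\<close>

lemma reduced_gram_det_lower_bound:
  assumes le: "0 < qnorm v1" "qnorm v1 \<le> qnorm v2" "qnorm v2 \<le> qnorm v3"
    and x: "2 * \<bar>qdot v1 v2\<bar> \<le> qnorm v1"
    and min: "\<And>m n :: int. qnorm v3 \<le> qnorm (v3 - qscal (of_int m) v1 - qscal (of_int n) v2)"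
  shows "3 * (qnorm v1 * qnorm v2 * qnorm v3) \<le> 8 * (qnorm v1 * qnorm v2 * qnorm v3 + 2 * qdot v1 v2 *
      qdot v1 v3 * qdot v2 v3
    - qnorm v1 * (qdot v2 v3)\<^sup>2 - qnorm v2 * (qdot v1 v3)\<^sup>2 - qnorm v3 * (qdot v1 v2)\<^sup>2)"
proof -
  define D1 D2 D3 where D: "D1 = qnorm v1" "D2 = qnorm v2" "D3 = qnorm v3"
  define x y z where xyz: "x = qdot v1 v2" "y = qdot v1 v3" "z = qdot v2 v3"
  define \<Delta> where "\<Delta> = D1 * D2 - x\<^sup>2"
  have "\<bar>2 * x\<bar>\<^sup>2 \<le> D1\<^sup>2" using x unfolding D xyz by (intro power_mono) (auto simp: abs_mult)
  hence "4 * x\<^sup>2 \<le> D1 * D1" by (simp add: power2_eq_square)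
  also have "\<dots> \<le> D1 * D2" using le unfolding D by (intro mult_left_mono) auto
  finally have \<Delta>: "3 * (D1 * D2) \<le> 4 * \<Delta>" by (simp add: \<Delta>_def)
  have "D1 * D2 > 0" using le unfolding D by simp
  hence \<Delta>0: "\<Delta> > 0" using \<Delta> by linarith
  \<comment> \<open>The coefficients of the orthogonal projection of v3 to the span of v1 and v2,
    solved by Cramer's rule from their Gram matrix; w is the orthogonal part.\<close>
  define s t where st: "s = (D2 * y - x * z) / \<Delta>" "t = (D1 * z - x * y) / \<Delta>"
  define w where "w = v3 - qscal s v1 - qscal t v2"
  have sd: "s * \<Delta> = D2 * y - x * z" "t * \<Delta> = D1 * z - x * y" using \<Delta>0 by (simp_all add: st)
  have "(s * D1 + t * x) * \<Delta> = (s * \<Delta>) * D1 + (t * \<Delta>) * x" by (simp add: algebra_simps)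
  also have "\<dots> = y * \<Delta>" unfolding sd by (simp add: \<Delta>_def power2_eq_square algebra_simps)
  finally have o1: "s * D1 + t * x = y" using \<Delta>0 by simp
  have "(s * x + t * D2) * \<Delta> = (s * \<Delta>) * x + (t * \<Delta>) * D2" by (simp add: algebra_simps)
  also have "\<dots> = z * \<Delta>" unfolding sd by (simp add: \<Delta>_def power2_eq_square algebra_simps)
  finally have o2: "s * x + t * D2 = z" using \<Delta>0 by simp
  have dots: "qdot v1 v1 = D1" "qdot v2 v2 = D2" "qdot v3 v3 = D3" "qdot v1 v2 = x" "qdot v2 v1 = x"
    "qdot v1 v3 = y" "qdot v3 v1 = y" "qdot v2 v3 = z" "qdot v3 v2 = z"
    by (simp_all add: D xyz qnorm_qdot qdot_sym)
  have w1: "qdot w v1 = 0" using o1 by (simp add: w_def qdot_diff_left qdot_scal_left dots)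
  have w2: "qdot w v2 = 0" using o2 by (simp add: w_def qdot_diff_left qdot_scal_left dots)
  have w3: "qdot w v3 = D3 - s * y - t * z" by (simp add: w_def qdot_diff_left qdot_scal_left dots)
  have "qnorm w = qdot w v3 - s * qdot w v1 - t * qdot w v2"
    unfolding qnorm_qdot by (subst (2) w_def) (simp add: qdot_diff_right qdot_scal_right)
  hence Nw: "qnorm w = D3 - s * y - t * z" using w1 w2 w3 by simp
  have "qnorm w * \<Delta> = D3 * \<Delta> - (s * \<Delta>) * y - (t * \<Delta>) * z" unfolding Nw by (simp add: algebra_simps)
  hence G: "qnorm w * \<Delta> = D1 * D2 * D3 + 2 * x * y * z - D1 * z\<^sup>2 - D2 * y\<^sup>2 - D3 * x\<^sup>2"
    unfolding sd by (simp add: \<Delta>_def power2_eq_square algebra_simps)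
  obtain n :: int where n: "qnorm (qscal (t - of_int n) v2 + w) \<le> qnorm v2 / 4 + qnorm w" using round_coefficient .
  obtain m :: int where m: "qnorm (qscal (s - of_int m) v1 + (qscal (t - of_int n) v2 + w)) \<le> qnorm v1 /
      4 + qnorm (qscal (t - of_int n) v2 + w)"
    using round_coefficient .
  have "qscal (s - of_int m) v1 + (qscal (t - of_int n) v2 + w) = v3 - qscal (of_int m) v1 - qscal (of_int n) v2"
    by (simp add: w_def qscal_diff_left)
  hence "D3 \<le> D1 / 4 + D2 / 4 + qnorm w" using min[of m n] m n unfolding D by simp
  \<comment> \<open>D1/4 + D2/4 is at most D3/2. Together with 3 D1 D2 <= 4 \<Delta> this is the
    origin of the constants 3 and 8.\<close>
  hence "D3 \<le> 2 * qnorm w" using le unfolding D by linarith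
  hence "D3 * (3 * (D1 * D2)) \<le> (2 * qnorm w) * (4 * \<Delta>)"
    using \<Delta> by (rule mult_mono) (use \<open>D1 * D2 > 0\<close> qnorm_nonneg in simp_all)
  hence "3 * (D1 * D2 * D3) \<le> 8 * (qnorm w * \<Delta>)" by (simp add: mult_ac)
  thus ?thesis unfolding G D xyz .
qed

text \<open>The linear map fixing \<open>1\<close> and sending each \<open>vi\<close> to \<open>wi\<close>, in Cramer coordinates.\<close>

definition transport :: "quat \<Rightarrow> quat \<Rightarrow> quat \<Rightarrow> quat \<Rightarrow> quat \<Rightarrow> quat \<Rightarrow> quat \<Rightarrow> quat" where
  "transport v1 v2 v3 w1 w2 w3 x = qcomb (q0 x) (vdet x v2 v3 / vdet v1 v2 v3) (vdet v1 x v3 / vdet v1 v2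
      v3) (vdet v1 v2 x / vdet v1 v2 v3) w1 w2 w3"

lemma transport_combination:
  assumes "vdet v1 v2 v3 \<noteq> 0" "q0 v1 = 0" "q0 v2 = 0" "q0 v3 = 0"
  shows "transport v1 v2 v3 w1 w2 w3 (qcomb c0 c1 c2 c3 v1 v2 v3)
    = qcomb c0 c1 c2 c3 w1 w2 w3"
proof -
  let ?x = "qcomb c0 c1 c2 c3 v1 v2 v3"
  have "vdet ?x v2 v3 = c1 * vdet v1 v2 v3" "vdet v1 ?x v3 = c2 * vdet v1 v2 v3"
    "vdet v1 v2 ?x = c3 * vdet v1 v2 v3" "q0 ?x = c0"
    using assms(2-4) by (simp_all add: vdet_def algebra_simps)
  thus ?thesis unfolding transport_def using assms(1) by simp
qed

lemma pure_basis_combination: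
  assumes "vdet v1 v2 v3 \<noteq> 0" "q0 v1 = 0" "q0 v2 = 0" "q0 v3 = 0"
  obtains c1 c2 c3 where "x = qcomb (q0 x) c1 c2 c3 v1 v2 v3"
proof -
  obtain c0 c1 c2 c3 where x: "x = qcomb c0 c1 c2 c3 v1 v2 v3"
    using vdet_cramer[OF assms(1), of x] by metis
  have "q0 x = c0" unfolding x using assms by simp
  thus ?thesis using that x by metis
qed

lemma qdot_mul:
  assumes "q0 z = 0"
  shows "qdot (x \<star> y) z = q0 x * qdot y z + q0 y * qdot x z + a * b * vdet x y z"
  using assms by (simp add: qdot_def vdet_def algebra_simps)

lemma q0_mul: "q0 (x \<star> y) = 2 * q0 x * q0 y - qdot x y"
  by (simp add: qdot_def algebra_simps)

end

text \<open>Equal Gram matrices give an isometry; equality of the two \<open>vdet\<close> adds that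
  it preserves orientation. With opposite signs the map would reverse products.\<close>

locale quat_isometry = quat_alg +
  fixes v1 v2 v3 w1 w2 w3 :: quat
  assumes pure_v: "q0 v1 = 0" "q0 v2 = 0" "q0 v3 = 0"
    and pure_w: "q0 w1 = 0" "q0 w2 = 0" "q0 w3 = 0"
    and gram: "qnorm v1 = qnorm w1" "qnorm v2 = qnorm w2" "qnorm v3 = qnorm w3"
      "qdot v1 v2 = qdot w1 w2" "qdot v1 v3 = qdot w1 w3" "qdot v2 v3 = qdot w2 w3"
    and vdet_nz: "vdet v1 v2 v3 \<noteq> 0" and vdet_eq: "vdet v1 v2 v3 = vdet w1 w2 w3"
begin

abbreviation F :: "quat \<Rightarrow> quat" where "F \<equiv> transport v1 v2 v3 w1 w2 w3"

lemmas F_combination = transport_combination[OF vdet_nz pure_v, of w1 w2 w3]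

lemma vdet_w_nz: "vdet w1 w2 w3 \<noteq> 0"
  using vdet_nz vdet_eq by simp

lemma combination:
  obtains c1 c2 c3 where "x = qcomb (q0 x) c1 c2 c3 v1 v2 v3"
    "F x = qcomb (q0 x) c1 c2 c3 w1 w2 w3"
  using pure_basis_combination[OF vdet_nz pure_v, of x] F_combination by metis

lemma F_q0 [simp]: "q0 (F x) = q0 x"
  using combination[of x] pure_w by (metis add.right_neutral fst_add mult.right_neutral mult_zero_right
      qone_coords(1) qscal_coords(1))

lemma F_one [simp]: "F qone = qone"
  using F_combination[of 1 0 0 0] by simp

lemma F_add: "F (x + y) = F x + F y"
  by (simp add: transport_def vdet_def quat_eq_iff add_divide_distrib diff_divide_distrib algebra_simps)

lemma F_scal: "F (qscal c x) = qscal c (F x)"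
proof -
  obtain c1 c2 c3 where c: "x = qcomb (q0 x) c1 c2 c3 v1 v2 v3"
    "F x = qcomb (q0 x) c1 c2 c3 w1 w2 w3" by (rule combination)
  have "F (qscal c x) = F (qcomb (c * q0 x) (c * c1) (c * c2) (c * c3) v1 v2 v3)"
    by (subst c(1)) (simp add: qscal_add_right)
  thus ?thesis unfolding F_combination c(2) by (simp add: qscal_add_right)
qed

lemma qdot_F: "qdot (F x) (F y) = qdot x y"
proof -
  obtain c1 c2 c3 where c: "x = qcomb (q0 x) c1 c2 c3 v1 v2 v3"
    "F x = qcomb (q0 x) c1 c2 c3 w1 w2 w3" by (rule combination)
  obtain d1 d2 d3 where d: "y = qcomb (q0 y) d1 d2 d3 v1 v2 v3"
    "F y = qcomb (q0 y) d1 d2 d3 w1 w2 w3" by (rule combination)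
  have one: "qdot qone u = q0 u" "qdot u qone = q0 u" for u by (simp_all add: qdot_def)
  have expand: "qdot (qcomb c0 c1 c2 c3 u1 u2 u3) (qcomb d0 d1 d2 d3 u1 u2 u3)
      = c0 * d0 + c1 * d1 * qnorm u1 + c2 * d2 * qnorm u2 + c3 * d3 * qnorm u3
      + (c1 * d2 + c2 * d1) * qdot u1 u2 + (c1 * d3 + c3 * d1) * qdot u1 u3 + (c2 * d3 + c3 * d2) * qdot u2 u3"
    if "q0 u1 = 0" "q0 u2 = 0" "q0 u3 = 0" for c0 d0 u1 u2 u3
    using that by (simp add: qdot_add_left qdot_add_right qdot_scal_left qdot_scal_right one
      qnorm_qdot qdot_sym[of u2 u1] qdot_sym[of u3 u1] qdot_sym[of u3 u2] algebra_simps)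
  have "qdot (F x) (F y) = qdot (qcomb (q0 x) c1 c2 c3 v1 v2 v3)
      (qcomb (q0 y) d1 d2 d3 v1 v2 v3)"
    unfolding c(2) d(2) expand[OF pure_v] expand[OF pure_w] gram ..
  thus ?thesis unfolding c(1)[symmetric] d(1)[symmetric] .
qed

lemma qnorm_F: "qnorm (F x) = qnorm x"
  by (simp add: qnorm_qdot qdot_F)

lemma vdet_F: "vdet (F x) (F y) (F z) = vdet x y z"
proof -
  obtain c1 c2 c3 where c: "x = qcomb (q0 x) c1 c2 c3 v1 v2 v3"
    "F x = qcomb (q0 x) c1 c2 c3 w1 w2 w3" by (rule combination)
  obtain d1 d2 d3 where d: "y = qcomb (q0 y) d1 d2 d3 v1 v2 v3"
    "F y = qcomb (q0 y) d1 d2 d3 w1 w2 w3" by (rule combination)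
  obtain e1 e2 e3 where e: "z = qcomb (q0 z) e1 e2 e3 v1 v2 v3"
    "F z = qcomb (q0 z) e1 e2 e3 w1 w2 w3" by (rule combination)
  have "vdet (F x) (F y) (F z) = (c1 * (d2 * e3 - d3 * e2) - c2 * (d1 * e3 - d3 * e1) + c3 * (d1 * e2 -
      d2 * e1)) * vdet w1 w2 w3"
    unfolding c(2) d(2) e(2) vdet_combination ..
  also have "\<dots> = vdet (qcomb (q0 x) c1 c2 c3 v1 v2 v3)
      (qcomb (q0 y) d1 d2 d3 v1 v2 v3) (qcomb (q0 z) e1 e2 e3 v1 v2 v3)"
    unfolding vdet_combination vdet_eq ..
  finally show ?thesis unfolding c(1)[symmetric] d(1)[symmetric] e(1)[symmetric] .
qed

text \<open>An isometry of determinant one respects products, because a product is determined by its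
  trace and its inner products with pure quaternions, and these are expressible by inner products and
  determinants.\<close>

lemma F_mul: "F (x \<star> y) = F x \<star> F y"
proof -
  define d where "d = F (x \<star> y) - F x \<star> F y"
  have d0: "q0 d = 0" by (simp only: d_def fst_diff F_q0 q0_mul qdot_F)
  have dF: "qdot d (F z) = 0" if "q0 z = 0" for z
    unfolding d_def qdot_diff_left qdot_F using that by (simp only: qdot_mul F_q0 qdot_F vdet_F)
  have Fv: "F v1 = w1" "F v2 = w2" "F v3 = w3"
    using F_combination[of 0 1 0 0] F_combination[of 0 0 1 0] F_combination[of 0 0 0 1] by simp_all
  have dw: "qdot d w1 = 0" "qdot d w2 = 0" "qdot d w3 = 0" using dF[of v1] dF[of v2] dF[of v3] pure_v Fv
      by simp_all
  obtain c1 c2 c3 where d: "d = qcomb (q0 d) c1 c2 c3 w1 w2 w3"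
    using pure_basis_combination[OF vdet_w_nz pure_w, of d] .
  have "qdot d d = qdot d (qcomb (q0 d) c1 c2 c3 w1 w2 w3)"
    using d by (rule arg_cong)
  also have "\<dots> = 0" by (simp only: qdot_add_right qdot_scal_right dw d0 mult_zero_left mult_zero_right add_0_right)
  finally have "d = 0" using qnorm_pos[of d] by (metis less_irrefl qnorm_qdot)
  thus ?thesis by (simp add: d_def)
qed

text \<open>An element is recovered from its Gross vector up to its trace. Choosing y in R2 whose
  Gross vector is the image of that of x, equality of the norms makes the squares of the traces of x
  and y congruent modulo 4; the traces have equal parity, so F x and y differ by an integer.\<close>

lemma F_maps_order:
  assumes R1: "ord_like R1" and R2: "ord_like R2" and w: "w1 \<in> gross ` R2" "w2 \<in> gross ` R2" "w3 \<in> gross ` R2"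
    and basis: "\<And>u. u \<in> gross ` R1 \<Longrightarrow> in_zspan u v1 v2 v3"
    and x: "x \<in> R1"
  shows "F x \<in> R2"
proof -
  have r1: "subring_quat R1" "\<And>x. x \<in> R1 \<Longrightarrow> qnorm x \<in> \<int>" and r2: "subring_quat R2" "\<And>x. x \<in> R2 \<Longrightarrow> qnorm x \<in> \<int>"
    using R1 R2 by (auto simp: ord_like_def)
  note r = subring_quatD[OF r2(1)]
  obtain n1 n2 n3 :: int where n: "gross x = qscal (of_int n1) v1 + qscal (of_int n2) v2 + qscal (of_int n3) v3"
    using basis x by blast
  obtain y1 y2 y3 where y123: "y1 \<in> R2" "w1 = gross y1" "y2 \<in> R2" "w2 = gross y2" "y3 \<in> R2" "w3 = gross
      y3" using w by blast
  define y where "y = qscal (of_int n1) y1 + qscal (of_int n2) y2 + qscal (of_int n3) y3"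
  have y: "y \<in> R2" unfolding y_def by (intro r y123)
  have gy: "F (gross x) = gross y"
    using F_combination[of 0 "of_int n1" "of_int n2" "of_int n3"]
    by (simp add: n y_def gross_add gross_scal y123)
  have half: "z = qscal (q0 z) qone + qscal (1 / 2) (gross z)" for z by (simp add: quat_eq_iff)
  have "F x = F (qscal (q0 x) qone + qscal (1 / 2) (gross x))" using half by (rule arg_cong)
  also have "\<dots> = qscal (q0 x) qone + qscal (1 / 2) (gross y)" by (simp add: F_add F_scal gy)
  also have "\<dots> = y + qscal (q0 x - q0 y) qone" by (simp add: quat_eq_iff)
  finally have Fx: "F x = y + qscal (q0 x - q0 y) qone" .
  obtain s t where st: "2 * q0 x = of_int s" "2 * q0 y = of_int t"
    using trace_int[OF r1 x] trace_int[OF r2 y] by (auto elim!: Ints_cases)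
  obtain k l where kl: "qnorm x = of_int k" "qnorm y = of_int l" using r1(2)[OF x] r2(2)[OF y] by (auto
      elim!: Ints_cases)
  have "qnorm (gross y) = qnorm (gross x)" unfolding gy[symmetric] by (rule qnorm_F)
  hence "(of_int (4 * l - t\<^sup>2) :: rat) = of_int (4 * k - s\<^sup>2)" unfolding qnorm_gross st kl by simp
  hence "4 * l - t\<^sup>2 = 4 * k - s\<^sup>2" by (simp only: of_int_eq_iff)
  hence "s\<^sup>2 = t\<^sup>2 + 4 * (k - l)" by simp
  hence "even (s\<^sup>2) = even (t\<^sup>2)" by presburger
  hence "even (s - t)" by simp
  then obtain j where j: "s - t = 2 * j" by blast
  have "2 * (q0 x - q0 y) = of_int (s - t)" by (simp add: st right_diff_distrib)
  hence "q0 x - q0 y = of_int j" unfolding j by simp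
  thus ?thesis unfolding Fx by (metis r(3) r(8) y)
qed

end

section \<open>Orders with equal successive minima\<close>

text \<open>The prime divides the difference or the sum of the absolute values. The difference is
  too small unless zero, and the sum is 0 or p; the factor 4 makes it even, which excludes
  p.\<close>

lemma square_determines_abs:
  fixes x y d p :: int
  assumes p: "prime p" "odd p" and x: "4 * p dvd d - x\<^sup>2" "\<bar>x\<bar> < p" and y: "4 * p dvd d - y\<^sup>2" "\<bar>y\<bar> < p"
  shows "\<bar>x\<bar> = \<bar>y\<bar>"
proof -
  have "4 * p dvd (d - y\<^sup>2) - (d - x\<^sup>2)" by (rule dvd_diff[OF y(1) x(1)])
  hence dv: "4 * p dvd \<bar>x\<bar>\<^sup>2 - \<bar>y\<bar>\<^sup>2" by simp
  hence "p dvd \<bar>x\<bar>\<^sup>2 - \<bar>y\<bar>\<^sup>2" by (rule dvd_mult_right)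
  hence "p dvd (\<bar>x\<bar> - \<bar>y\<bar>) * (\<bar>x\<bar> + \<bar>y\<bar>)" by (simp add: power2_eq_square algebra_simps)
  then consider "p dvd \<bar>x\<bar> - \<bar>y\<bar>" | "p dvd \<bar>x\<bar> + \<bar>y\<bar>" using p(1) prime_dvd_mult_iff by blast
  thus ?thesis
  proof cases
    case 1
    have "\<bar>\<bar>x\<bar> - \<bar>y\<bar>\<bar> < p" using x(2) y(2) by linarith
    thus ?thesis using 1 dvd_imp_le_int[of "\<bar>x\<bar> - \<bar>y\<bar>" p] by force
  next
    case 2
    then obtain k where k: "\<bar>x\<bar> + \<bar>y\<bar> = p * k" by blast
    have "p * k < p * 2" using x(2) y(2) k by linarith
    moreover have p0: "p > 0" using p(1) prime_gt_0_int by blast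
    ultimately have "k < 2" by simp
    have "0 \<le> p * k" using k by linarith
    hence "0 \<le> k" using p0 by (simp add: zero_le_mult_iff)
    have "even (4 * p)" by simp
    hence "even (\<bar>x\<bar>\<^sup>2 - \<bar>y\<bar>\<^sup>2)" using dv dvd_trans by blast
    hence "even (\<bar>x\<bar> + \<bar>y\<bar>)" by simp
    hence "even k" unfolding k using p(2) by simp
    hence "k = 0" using \<open>k < 2\<close> \<open>0 \<le> k\<close> by (cases "k = 1") auto
    thus ?thesis using k by simp
  qed
qed

lemma abs_eq_sign:
  fixes x y :: "'a :: linordered_idom"
  assumes "\<bar>x\<bar> = \<bar>y\<bar>"
  obtains s where "s = 1 \<or> s = - 1" "x = s * y"
  using assms that[of 1] that[of "- 1"] by (auto simp: abs_eq_iff)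

text \<open>Sign changes of three basis vectors alter the off-diagonal entries by signs of product
  1. If the product of the entries is nonzero its value forces this relation; otherwise a zero entry
  has a free sign that absorbs the discrepancy.\<close>

lemma adjust_signs:
  fixes x y z x' y' z' :: "'a :: linordered_idom"
  assumes "\<bar>x\<bar> = \<bar>x'\<bar>" "\<bar>y\<bar> = \<bar>y'\<bar>" "\<bar>z\<bar> = \<bar>z'\<bar>" "x * y * z = x' * y' * z'"
  obtains s t :: 'a where "s = 1 \<or> s = - 1" "t = 1 \<or> t = - 1" "x = s * x'" "y = t * y'" "z = s * t * z'"
proof -
  obtain s where s: "s = 1 \<or> s = - 1" "x = s * x'" using abs_eq_sign[OF assms(1)] .
  obtain t where t: "t = 1 \<or> t = - 1" "y = t * y'" using abs_eq_sign[OF assms(2)] .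
  obtain u where u: "u = 1 \<or> u = - 1" "z = u * z'" using abs_eq_sign[OF assms(3)] .
  show ?thesis
  proof (cases "u = s * t")
    case True
    thus ?thesis using that s t u by blast
  next
    case False
    hence us: "u = - (s * t)" using s(1) t(1) u(1) by auto
    have ss: "s * s = 1" "t * t = 1" using s(1) t(1) by auto
    have "x * y * z = s * t * u * (x' * y' * z')" by (simp add: s t u algebra_simps)
    also have "\<dots> = - ((s * s) * (t * t) * (x' * y' * z'))" by (simp add: us algebra_simps)
    finally have "x * y * z = - (x' * y' * z')" by (simp add: ss)
    hence "x' * y' * z' = 0" using assms(4) by simp
    then consider "x' = 0" | "y' = 0" | "z' = 0" by auto
    thus ?thesis
    proof cases
      case 1
      show ?thesis by (rule that[of "- s" t]) (use s t u us 1 in auto)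
    next
      case 2
      show ?thesis by (rule that[of s "- t"]) (use s t u us 2 in auto)
    next
      case 3
      show ?thesis by (rule that[of s t]) (use s t u us 3 in auto)
    qed
  qed
qed

section \<open>Reduced bases and comparison of two orders\<close>

context quat_ram
begin

lemma gram_minor_divisible:
  assumes R: "ord_like R" and u: "u \<in> gross ` R" and v: "v \<in> gross ` R"
    and eq: "qnorm u = of_int c" "qnorm v = of_int d"
  obtains x :: int where "qdot u v = of_int x" "4 * int p dvd c * d - x\<^sup>2"
proof -
  have ring: "subring_quat R" and norm: "\<And>x. x \<in> R \<Longrightarrow> qnorm x \<in> \<int>" using R by (auto simp: ord_like_def)
  note r = subring_quatD[OF ring]
  obtain \<alpha> \<beta> where \<alpha>\<beta>: "\<alpha> \<in> R" "u = gross \<alpha>" "\<beta> \<in> R" "v = gross \<beta>" using u v by blast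
  have "qdot u v \<in> \<int>"
    unfolding \<alpha>\<beta> qdot_gross
    by (intro Ints_diff[OF Ints_mult Ints_mult] Ints_diff trace_int[OF ring norm] norm r \<alpha>\<beta>) simp
  then obtain x where x: "qdot u v = of_int x" by (auto elim: Ints_cases)
  have "qnorm (\<alpha> \<star> \<beta> - \<beta> \<star> \<alpha>) \<in> \<int>" by (intro norm r \<alpha>\<beta>)
  then obtain k where k: "qnorm (\<alpha> \<star> \<beta> - \<beta> \<star> \<alpha>) = of_int k" by (auto elim: Ints_cases)
  have "int p dvd k"
    by (rule p_dvd_norm_commutator[OF _ _ k]) (intro loc_Ints[OF p_prime] norm \<alpha>\<beta>)+
  have "(of_int (c * d - x\<^sup>2) :: rat) = of_int (4 * k)"
    using gram_minor_gross[of \<alpha> \<beta>] unfolding \<alpha>\<beta>(2,4)[symmetric] eq x k by simp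
  hence "c * d - x\<^sup>2 = 4 * k" by (simp only: of_int_eq_iff)
  hence "4 * int p dvd c * d - x\<^sup>2" using \<open>int p dvd k\<close> by simp
  thus ?thesis using that x by blast
qed

text \<open>The Gross map doubles three coordinates, giving 8; the index contributes r, and the
  discriminant of M says 4 a b times its determinant is p. So a b times the determinant is 2 p r, up
  to the sign of a change of basis, whose determinant has an integral inverse.\<close>

lemma gross_lattice_covolume:
  assumes R: "ord_like R" and M: "ord_like M" and max: "\<And>S. ord_like S \<Longrightarrow> M \<subseteq> S \<Longrightarrow> S = M" and sub: "R \<subseteq> M"
    and v: "v1 \<in> gross ` R" "v2 \<in> gross ` R" "v3 \<in> gross ` R"
    and basis: "\<And>u. u \<in> gross ` R \<Longrightarrow> in_zspan u v1 v2 v3"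
  shows "(a * b * vdet v1 v2 v3)\<^sup>2 = (2 * of_nat p * of_nat (order_index R M))\<^sup>2" "order_index R M > 0"
proof -
  obtain e1 e2 e3 where te: "tri_basis M e1 e2 e3" using ord_like_imp_tri_basis[OF M] .
  obtain f1 f2 f3 where tf: "tri_basis R f1 f2 f3" using ord_like_imp_tri_basis[OF R] .
  have fpos: "vdet f1 f2 f3 > 0" using tri_basis_vdet[OF tf] tf by (simp add: tri_basis_def)
  have fe: "vdet f1 f2 f3 = of_nat (order_index R M) * vdet e1 e2 e3" by (rule order_index_vdet[OF M R sub te tf])
  show "order_index R M > 0" using fpos fe by (cases "order_index R M") auto
  have gf: "vdet (gross f1) (gross f2) (gross f3) = 8 * vdet f1 f2 f3"
    by (simp add: vdet_def algebra_simps)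
  have comb: "\<exists>n1 n2 n3 :: int. u = qscal 0 qone + qscal (of_int n1) (gross f1) + qscal (of_int n2)
      (gross f2) + qscal (of_int n3) (gross f3)"
    if u: "u \<in> gross ` R" for u
  proof -
    obtain x where x: "x \<in> R" "u = gross x" using u by blast
    obtain n0 n1 n2 n3 :: int where
      n: "x = zcomb n0 n1 n2 n3 f1 f2 f3"
      using tf x(1) unfolding tri_basis_def by (elim conjE) (simp only: mem_Collect_eq, elim exE conjE)
    show ?thesis unfolding x(2) n by (intro exI[of _ n1] exI[of _ n2] exI[of _ n3]) (simp add: gross_add
        gross_scal)
  qed
  have basis': "\<exists>n1 n2 n3 :: int. u = qcomb 0 (of_int n1) (of_int n2) (of_int n3) v1 v2 v3"
    if "u \<in> gross ` R" for u using basis[OF that] by simp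
  have multiple: "\<exists>k::int. vdet x y z = of_int k * vdet u1 u2 u3"
    if xyz: "\<exists>n1 n2 n3 :: int. x = qcomb 0 (of_int n1) (of_int n2) (of_int n3) u1 u2 u3"
      "\<exists>n1 n2 n3 :: int. y = qcomb 0 (of_int n1) (of_int n2) (of_int n3) u1 u2 u3"
      "\<exists>n1 n2 n3 :: int. z = qcomb 0 (of_int n1) (of_int n2) (of_int n3) u1 u2 u3"
    for x y z u1 u2 u3
  proof -
    obtain x1 x2 x3 :: int where x: "x = qcomb 0 (of_int x1) (of_int x2) (of_int x3) u1 u2 u3" using
        xyz(1) by blast
    obtain y1 y2 y3 :: int where y: "y = qcomb 0 (of_int y1) (of_int y2) (of_int y3) u1 u2 u3" using
        xyz(2) by blast
    obtain z1 z2 z3 :: int where z: "z = qcomb 0 (of_int z1) (of_int z2) (of_int z3) u1 u2 u3" using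
        xyz(3) by blast
    show ?thesis unfolding x y z vdet_combination
      by (intro exI[of _ "x1 * (y2 * z3 - y3 * z2) - x2 * (y1 * z3 - y3 * z1) + x3 * (y1 * z2 - y2 * z1)"]) simp
  qed
  obtain k :: int where k: "vdet v1 v2 v3 = of_int k * vdet (gross f1) (gross f2) (gross f3)"
    using multiple[OF comb[OF v(1)] comb[OF v(2)] comb[OF v(3)]] by (elim exE)
  have gR: "gross f1 \<in> gross ` R" "gross f2 \<in> gross ` R" "gross f3 \<in> gross ` R"
    by (intro imageI tri_basis_mem[OF tf])+
  obtain l :: int where l: "vdet (gross f1) (gross f2) (gross f3) = of_int l * vdet v1 v2 v3"
    using multiple[OF basis'[OF gR(1)] basis'[OF gR(2)] basis'[OF gR(3)]] by (elim exE)
  have nz: "vdet (gross f1) (gross f2) (gross f3) \<noteq> 0" using gf fpos by simp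
  from l[unfolded k] have "(of_int (l * k) :: rat) = of_int 1" using nz by simp
  hence "l * k = 1" by (simp only: of_int_eq_iff)
  hence "k = 1 \<or> k = - 1" by (auto simp: zmult_eq_1_iff)
  hence kk: "(of_int k :: rat)\<^sup>2 = 1" by auto
  have "4 * a * b * vdet e1 e2 e3 = of_nat p" using maximal_order_discriminant[OF M max te] by (simp add: trip_def)
  hence "a * b * vdet v1 v2 v3 = of_int k * (2 * of_nat p * of_nat (order_index R M))"
    unfolding k gf fe by (simp add: algebra_simps)
  thus "(a * b * vdet v1 v2 v3)\<^sup>2 = (2 * of_nat p * of_nat (order_index R M))\<^sup>2"
    by (simp add: power_mult_distrib kk)
qed

text \<open>Gathers what holds for a single order, with the Gram entries as integers, so that two
  orders can then be compared entry by entry.\<close>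

lemma gross_lattice_reduced_basis:
  fixes D :: "nat \<Rightarrow> rat"
  assumes R: "ord_like R" and M: "ord_like M" and max: "\<And>S. ord_like S \<Longrightarrow> M \<subseteq> S \<Longrightarrow> S = M" and sub: "R \<subseteq> M"
    and index: "order_index R M = r"
    and rank: "\<And>i. i \<in> {1, 2, 3} \<Longrightarrow> rank_at_least (zmod_gen {v \<in> gross ` R. qnorm v \<le> D i}) i"
    and least: "\<And>i D'. i \<in> {1, 2, 3} \<Longrightarrow> rank_at_least (zmod_gen {v \<in> gross ` R. qnorm v \<le> D'}) i \<Longrightarrow> D i \<le> D'"
    and D1: "D 1 \<ge> 8 * of_nat r ^ 2"
  obtains v1 v2 v3 and d1 d2 d3 x y z :: int where "v1 \<in> gross ` R" "v2 \<in> gross ` R" "v3 \<in> gross ` R"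
    "\<forall>u\<in>gross ` R. in_zspan u v1 v2 v3"
    "qnorm v1 = of_int d1" "qnorm v2 = of_int d2" "qnorm v3 = of_int d3" "D 1 = of_int d1" "D 2 = of_int
        d2" "D 3 = of_int d3"
    "qdot v1 v2 = of_int x" "qdot v1 v3 = of_int y" "qdot v2 v3 = of_int z"
    "4 * int p dvd d1 * d2 - x\<^sup>2" "4 * int p dvd d1 * d3 - y\<^sup>2" "4 * int p dvd d2 * d3 - z\<^sup>2"
    "\<bar>x\<bar> < int p" "\<bar>y\<bar> < int p" "\<bar>z\<bar> < int p"
    "(a * b * vdet v1 v2 v3)\<^sup>2 = (2 * of_nat p * of_nat r)\<^sup>2" "vdet v1 v2 v3 \<noteq> 0"
proof -
  have ring: "subring_quat R" and norm: "\<And>x. x \<in> R \<Longrightarrow> qnorm x \<in> \<int>" using R by (auto simp: ord_like_def)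
  note r = subring_quatD[OF ring]
  let ?L = "gross ` R"
  have pure: "q0 u = 0" if "u \<in> ?L" for u using that by auto
  have zero: "0 \<in> ?L" using r(1) gross_one by (metis image_eqI)
  have add: "u + v \<in> ?L" if "u \<in> ?L" "v \<in> ?L" for u v
    using that r(3) by (auto simp: gross_add[symmetric])
  have neg: "- u \<in> ?L" if "u \<in> ?L" for u
    using that r(2) by (auto simp: gross_neg[symmetric])
  have int: "qnorm u \<in> \<int>" if u: "u \<in> ?L" for u
  proof -
    obtain x where x: "x \<in> R" "u = gross x" using u by blast
    show ?thesis unfolding x(2) qnorm_gross
      by (intro Ints_diff Ints_mult[OF _ norm[OF x(1)]] Ints_power trace_int[OF ring norm x(1)]) simp
  qed
  obtain v1 v2 v3 where v: "v1 \<in> ?L" "v2 \<in> ?L" "v3 \<in> ?L" and N: "qnorm v1 = D 1" "qnorm v2 = D 2" "qnorm v3 = D 3"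
    and le: "D 1 \<le> D 2" "D 2 \<le> D 3" and ind: "quat.independent {v1, v2, v3}" "v1 \<noteq> v2" "v1 \<noteq> v3" "v2 \<noteq> v3"
    and min: "\<forall>w\<in>?L. w \<noteq> 0 \<longrightarrow> D 1 \<le> qnorm w" "\<forall>w\<in>?L. w \<notin> quat.span {v1} \<longrightarrow> D 2 \<le> qnorm w"
      "\<forall>w\<in>?L. w \<notin> quat.span {v1, v2} \<longrightarrow> D 3 \<le> qnorm w"
    by (rule successive_minima_vectors[OF zero add neg int rank least])
  have basis: "in_zspan u v1 v2 v3" if u: "u \<in> ?L" for u
  proof -
    obtain n1 n2 n3 :: int where "u = qscal (of_int n1) v1 + qscal (of_int n2) v2 + qscal (of_int n3) v3"
      by (rule successive_minima_basis[OF add neg pure v _ _ ind _ _ _ u])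
        (use N le min in auto)
    thus ?thesis by blast
  qed
  have nz: "vdet v1 v2 v3 \<noteq> 0" by (rule pure_independent_vdet[OF ind pure[OF v(1)] pure[OF v(2)] pure[OF v(3)]])
  have vol: "(a * b * vdet v1 v2 v3)\<^sup>2 = (2 * of_nat p * of_nat r)\<^sup>2" and r0: "r > 0"
    using gross_lattice_covolume[OF R M max sub v basis] index by simp_all
  obtain d1 where d1: "qnorm v1 = of_int d1" using int[OF v(1)] by (auto elim: Ints_cases)
  obtain d2 where d2: "qnorm v2 = of_int d2" using int[OF v(2)] by (auto elim: Ints_cases)
  obtain d3 where d3: "qnorm v3 = of_int d3" using int[OF v(3)] by (auto elim: Ints_cases)
  obtain x where x: "qdot v1 v2 = of_int x" "4 * int p dvd d1 * d2 - x\<^sup>2" using gram_minor_divisible[OF R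
      v(1,2) d1 d2] .
  obtain y where y: "qdot v1 v3 = of_int y" "4 * int p dvd d1 * d3 - y\<^sup>2" using gram_minor_divisible[OF R
      v(1,3) d1 d3] .
  obtain z where z: "qdot v2 v3 = of_int z" "4 * int p dvd d2 * d3 - z\<^sup>2" using gram_minor_divisible[OF R
      v(2,3) d2 d3] .
  have nat: "qscal (of_nat n) u \<in> ?L" if "u \<in> ?L" for n u
    by (induction n) (use zero add that in \<open>auto simp: qscal_add_left\<close>)
  have intm: "qscal (of_int n) u \<in> ?L" if "u \<in> ?L" for n u
    using nat[OF that, of "nat n"] neg[OF nat[OF that, of "nat (- n)"]] by (cases "n \<ge> 0") auto
  have ind3: "quat.independent (insert v3 {v1, v2})" "v3 \<notin> {v1, v2}"
    using ind by (auto simp: insert_commute)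
  have ind2: "quat.independent (insert v2 {v1})" "v2 \<notin> {v1}"
    using quat.independent_mono[OF ind(1), of "{v2, v1}"] ind by auto
  have min3: "qnorm v3 \<le> qnorm (v3 - qscal (of_int m) v1 - qscal (of_int n) v2)" for m n :: int
  proof -
    have eq: "v3 - qscal (of_int m) v1 - qscal (of_int n) v2 = qscal 1 v3 + (qscal (of_int (- m)) v1 +
        qscal (of_int (- n)) v2)" by simp
    have "v3 - qscal (of_int m) v1 - qscal (of_int n) v2 \<in> ?L"
      unfolding eq by (intro add intm v) (use v in simp)
    moreover have "v3 - qscal (of_int m) v1 - qscal (of_int n) v2 \<notin> quat.span {v1, v2}"
      unfolding eq by (intro notin_span_combination[OF ind3] quat.span_add quat.span_scale quat.span_base) auto
    ultimately show ?thesis unfolding N using min(3) by blast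
  qed
  have min2: "qnorm v2 \<le> qnorm (v2 - qscal (of_int m) v1)" for m :: int
  proof -
    have eq: "v2 - qscal (of_int m) v1 = qscal 1 v2 + qscal (of_int (- m)) v1" by simp
    have "v2 - qscal (of_int m) v1 \<in> ?L"
      unfolding eq by (intro add intm v) (use v in simp)
    moreover have "v2 - qscal (of_int m) v1 \<notin> quat.span {v1}"
      unfolding eq by (intro notin_span_combination[OF ind2] quat.span_scale quat.span_base) auto
    ultimately show ?thesis unfolding N using min(2) by blast
  qed
  \<comment> \<open>Adding or subtracting v1 does not shorten v2, which bounds twice the inner
    product by the norm of v1. The other two bounds arise in the same way.\<close>
  have absx: "2 * \<bar>qdot v1 v2\<bar> \<le> D 1"
    using min2[of 1] min2[of "- 1"] N by (simp add: qnorm_diff qnorm_add qdot_sym[of v2 v1])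
  have absy: "2 * \<bar>qdot v1 v3\<bar> \<le> D 1"
    using min3[of 1 0] min3[of "- 1" 0] N by (simp add: qnorm_diff qnorm_add qdot_sym[of v3 v1])
  have absz: "2 * \<bar>qdot v2 v3\<bar> \<le> D 2"
    using min3[of 0 1] min3[of 0 "- 1"] N by (simp add: qnorm_diff qnorm_add qdot_sym[of v3 v2])
  have rr: "(0::rat) < of_nat r ^ 2" using r0 by simp
  have D0: "0 < D 1" using D1 rr by linarith
  have "3 * (qnorm v1 * qnorm v2 * qnorm v3) \<le> 8 * (a * b * vdet v1 v2 v3)\<^sup>2"
    unfolding gram_det[OF pure[OF v(1)] pure[OF v(2)] pure[OF v(3)], symmetric]
    by (rule reduced_gram_det_lower_bound) (use N le D0 absx min3 in auto)
  \<comment> \<open>The determinant is 4 p^2 r^2, and 8 times 4 is 32. Bounding D1 below by 8 r^2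
    and D3 by D2 then cancels r.\<close>
  hence "3 * (D 1 * D 2 * D 3) \<le> 32 * ((of_nat p)\<^sup>2 * (of_nat r)\<^sup>2)"
    unfolding vol N by (simp add: power_mult_distrib)
  moreover have "(8 * (of_nat r)\<^sup>2) * (D 2)\<^sup>2 \<le> D 1 * (D 2 * D 3)"
    using D1 D0 le by (intro mult_mono) (auto simp: power2_eq_square intro!: mult_left_mono)
  ultimately have "24 * ((of_nat r)\<^sup>2 * (D 2)\<^sup>2) \<le> 32 * ((of_nat r)\<^sup>2 * (of_nat p)\<^sup>2)" by (simp add: mult_ac)
  hence "(of_nat r)\<^sup>2 * (24 * (D 2)\<^sup>2) \<le> (of_nat r)\<^sup>2 * (32 * (of_nat p)\<^sup>2)" by (simp add: mult_ac)
  hence "24 * (D 2)\<^sup>2 \<le> 32 * (of_nat p)\<^sup>2" using rr by (rule mult_left_le_imp_le)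
  moreover have "(0::rat) < (of_nat p)\<^sup>2" using p_prime prime_gt_0_nat by simp
  moreover have "(2 * of_nat p)\<^sup>2 = (4 * (of_nat p)\<^sup>2 :: rat)" by (simp add: power_mult_distrib)
  ultimately have "(D 2)\<^sup>2 < (2 * of_nat p)\<^sup>2" by linarith
  hence D2p: "D 2 < 2 * of_nat p" by (rule power2_less_imp_less) simp
  have "\<bar>of_int x\<bar> < (of_nat p :: rat)" "\<bar>of_int y\<bar> < (of_nat p :: rat)" "\<bar>of_int z\<bar> < (of_nat p :: rat)"
    using absx absy absz D2p le unfolding x y z by linarith+
  hence lt: "\<bar>x\<bar> < int p" "\<bar>y\<bar> < int p" "\<bar>z\<bar> < int p"
    by (metis of_int_abs of_int_less_iff of_int_of_nat_eq)+
  show ?thesis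
    by (rule that[OF v ballI[OF basis] d1 d2 d3 _ _ _ x(1) y(1) z(1) x(2) y(2) z(2) lt vol nz]) (use N d1
        d2 d3 in auto)
qed

theorem orders_isomorphic:
  fixes D :: "nat \<Rightarrow> rat"
  assumes R1: "ord_like R1" and M1: "ord_like M1" "\<And>S. ord_like S \<Longrightarrow> M1 \<subseteq> S \<Longrightarrow> S = M1" "R1 \<subseteq> M1"
      "order_index R1 M1 = r"
    and R2: "ord_like R2" and M2: "ord_like M2" "\<And>S. ord_like S \<Longrightarrow> M2 \<subseteq> S \<Longrightarrow> S = M2" "R2 \<subseteq> M2" "order_index
        R2 M2 = r"
    and min1: "\<And>i. i \<in> {1, 2, 3} \<Longrightarrow> rank_at_least (zmod_gen {v \<in> gross ` R1. qnorm v \<le> D i}) i"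
      "\<And>i D'. i \<in> {1, 2, 3} \<Longrightarrow> rank_at_least (zmod_gen {v \<in> gross ` R1. qnorm v \<le> D'}) i \<Longrightarrow> D i \<le> D'"
    and min2: "\<And>i. i \<in> {1, 2, 3} \<Longrightarrow> rank_at_least (zmod_gen {v \<in> gross ` R2. qnorm v \<le> D i}) i"
      "\<And>i D'. i \<in> {1, 2, 3} \<Longrightarrow> rank_at_least (zmod_gen {v \<in> gross ` R2. qnorm v \<le> D'}) i \<Longrightarrow> D i \<le> D'"
    and D1: "D 1 \<ge> 8 * of_nat r ^ 2"
  obtains f where "bij_betw f R1 R2" "f qone = qone" "\<forall>x y. f (x + y) = f x + f y" "\<forall>x y. f (x \<star> y) = f x \<star> f y"
proof -
  obtain v1 v2 v3 and d1 d2 d3 x y z :: int where v: "v1 \<in> gross ` R1" "v2 \<in> gross ` R1" "v3 \<in> gross ` R1"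
    and vb: "\<forall>u\<in>gross ` R1. in_zspan u v1 v2 v3"
    and vN: "qnorm v1 = of_int d1" "qnorm v2 = of_int d2" "qnorm v3 = of_int d3" "D 1 = of_int d1" "D 2 =
        of_int d2" "D 3 = of_int d3"
    and vd: "qdot v1 v2 = of_int x" "qdot v1 v3 = of_int y" "qdot v2 v3 = of_int z"
    and vdv: "4 * int p dvd d1 * d2 - x\<^sup>2" "4 * int p dvd d1 * d3 - y\<^sup>2" "4 * int p dvd d2 * d3 - z\<^sup>2"
    and vl: "\<bar>x\<bar> < int p" "\<bar>y\<bar> < int p" "\<bar>z\<bar> < int p"
    and vv: "(a * b * vdet v1 v2 v3)\<^sup>2 = (2 * of_nat p * of_nat r)\<^sup>2" "vdet v1 v2 v3 \<noteq> 0"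
    by (rule gross_lattice_reduced_basis[OF R1 M1 min1 D1])
  obtain w1 w2 w3 and d1' d2' d3' x' y' z' :: int where w: "w1 \<in> gross ` R2" "w2 \<in> gross ` R2" "w3 \<in> gross ` R2"
    and wb: "\<forall>u\<in>gross ` R2. in_zspan u w1 w2 w3"
    and wN': "qnorm w1 = of_int d1'" "qnorm w2 = of_int d2'" "qnorm w3 = of_int d3'" "D 1 = of_int d1'"
        "D 2 = of_int d2'" "D 3 = of_int d3'"
    and wd: "qdot w1 w2 = of_int x'" "qdot w1 w3 = of_int y'" "qdot w2 w3 = of_int z'"
    and wdv': "4 * int p dvd d1' * d2' - x'\<^sup>2" "4 * int p dvd d1' * d3' - y'\<^sup>2" "4 * int p dvd d2' * d3' - z'\<^sup>2"
    and wl: "\<bar>x'\<bar> < int p" "\<bar>y'\<bar> < int p" "\<bar>z'\<bar> < int p"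
    and wv: "(a * b * vdet w1 w2 w3)\<^sup>2 = (2 * of_nat p * of_nat r)\<^sup>2" "vdet w1 w2 w3 \<noteq> 0"
    by (rule gross_lattice_reduced_basis[OF R2 M2 min2 D1])
  have dd: "d1' = d1" "d2' = d2" "d3' = d3" using vN wN' by simp_all
  note wN = wN'[unfolded dd] and wdv = wdv'[unfolded dd]
  have pure_v: "q0 v1 = 0" "q0 v2 = 0" "q0 v3 = 0" and pure_w: "q0 w1 = 0" "q0 w2 = 0" "q0 w3 = 0" using
      v w by auto
  have pp: "prime (int p)" "odd (int p)" using p_prime p_odd by simp_all
  have abs: "\<bar>x\<bar> = \<bar>x'\<bar>" "\<bar>y\<bar> = \<bar>y'\<bar>" "\<bar>z\<bar> = \<bar>z'\<bar>"
    using square_determines_abs[OF pp vdv(1) vl(1) wdv(1) wl(1)] square_determines_abs[OF pp vdv(2) vl(2)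
        wdv(2) wl(2)]
      square_determines_abs[OF pp vdv(3) vl(3) wdv(3) wl(3)] .
  have sq: "x\<^sup>2 = x'\<^sup>2" "y\<^sup>2 = y'\<^sup>2" "z\<^sup>2 = z'\<^sup>2" using abs by (metis power2_abs)+
  have "(of_int (d1 * d2 * d3 + 2 * x * y * z - d1 * z\<^sup>2 - d2 * y\<^sup>2 - d3 * x\<^sup>2) :: rat)
      = of_int (d1 * d2 * d3 + 2 * x' * y' * z' - d1 * z'\<^sup>2 - d2 * y'\<^sup>2 - d3 * x'\<^sup>2)"
    using gram_det[OF pure_v] gram_det[OF pure_w] vv(1) wv(1) unfolding vN(1-3) wN(1-3) vd wd by simp
  hence "d1 * d2 * d3 + 2 * x * y * z - d1 * z\<^sup>2 - d2 * y\<^sup>2 - d3 * x\<^sup>2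
      = d1 * d2 * d3 + 2 * x' * y' * z' - d1 * z'\<^sup>2 - d2 * y'\<^sup>2 - d3 * x'\<^sup>2" by (simp only: of_int_eq_iff)
  \<comment> \<open>Diagonals and squares agree, so equality of the determinants leaves only the
    term 2 x y z.\<close>
  hence prod: "x * y * z = x' * y' * z'" unfolding sq by simp
  obtain s t :: int where st: "s = 1 \<or> s = - 1" "t = 1 \<or> t = - 1" and xyz: "x = s * x'" "y = t * y'" "z =
      s * t * z'"
    using adjust_signs[OF abs prod] .
  have "\<bar>vdet v1 v2 v3\<bar> = \<bar>of_int (s * t) * vdet w1 w2 w3\<bar>"
  proof -
    have "\<bar>a * b * vdet v1 v2 v3\<bar> = \<bar>a * b * vdet w1 w2 w3\<bar>" using vv(1) wv(1) by (metis power2_eq_iff abs_minus)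
    hence "\<bar>vdet v1 v2 v3\<bar> = \<bar>vdet w1 w2 w3\<bar>" using ab_nonzero by (simp add: abs_mult)
    moreover have "\<bar>of_int (s * t) :: rat\<bar> = 1" using st by auto
    ultimately show ?thesis unfolding abs_mult by simp
  qed
  then obtain \<epsilon> :: rat where "\<epsilon> = 1 \<or> \<epsilon> = - 1" and vdet_eq: "vdet v1 v2 v3 = \<epsilon> * (of_int (s * t) * vdet w1 w2 w3)"
    by (rule abs_eq_sign)
  \<comment> \<open>This sign compares orientations. Multiplying all three vectors by \<sigma>
    leaves the Gram matrix alone and multiplies the determinant by \<sigma>^3 = \<sigma>.\<close>
  then obtain \<sigma> :: int where \<sigma>: "\<sigma> = 1 \<or> \<sigma> = - 1" "\<epsilon> = of_int \<sigma>" by (metis of_int_1 of_int_minus)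
  have \<sigma>\<sigma>: "\<sigma> * \<sigma> = 1" using \<sigma>(1) by auto
  \<comment> \<open>The signs s and t on the second and third vector turn x', y', z' into s x', t
    y', s t z', the pattern delivered by \<open>adjust_signs\<close>.\<close>
  define u1 u2 u3 where "u1 = qscal (of_int \<sigma>) w1" "u2 = qscal (of_int (\<sigma> * s)) w2" "u3 = qscal (of_int
      (\<sigma> * t)) w3"
  note u_def = u1_u2_u3_def
  have L2: "qscal (of_int k) w \<in> gross ` R2" if w: "w \<in> gross ` R2" for k w
  proof -
    obtain y where "y \<in> R2" "w = gross y" using w by blast
    moreover have "subring_quat R2" using R2 by (simp add: ord_like_def)
    ultimately show ?thesis using subring_quatD(7) by (auto simp: gross_scal[symmetric])
  qed
  have u: "u1 \<in> gross ` R2" "u2 \<in> gross ` R2" "u3 \<in> gross ` R2" unfolding u_def by (intro L2 w)+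
  have ub: "in_zspan q u1 u2 u3" if q: "q \<in> gross ` R2" for q
  proof -
    obtain n1 n2 n3 :: int where n: "q = qscal (of_int n1) w1 + qscal (of_int n2) w2 + qscal (of_int n3)
        w3" using bspec[OF wb q] by blast
    have one: "n1 * \<sigma> * \<sigma> = n1" "n2 * \<sigma> * s * (\<sigma> * s) = n2" "n3 * \<sigma> * t * (\<sigma> * t) = n3"
      using \<sigma>(1) st by auto
    have "q = qscal (of_int (n1 * \<sigma>)) u1 + qscal (of_int (n2 * \<sigma> * s)) u2 + qscal (of_int (n3 * \<sigma> * t)) u3"
      unfolding n u_def qscal_simps(4) of_int_mult[symmetric] one ..
    thus ?thesis by blast
  qed
  have sgr: "(of_int s)\<^sup>2 = (1::rat)" "(of_int t)\<^sup>2 = (1::rat)" "(of_int \<sigma>)\<^sup>2 = (1::rat)" using st \<sigma>(1) by auto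
  interpret G: quat_isometry a b v1 v2 v3 u1 u2 u3
  proof
    show "q0 u1 = 0" "q0 u2 = 0" "q0 u3 = 0" using pure_w by (simp_all add: u_def)
    show "qnorm v1 = qnorm u1" "qnorm v2 = qnorm u2" "qnorm v3 = qnorm u3"
      by (simp_all add: u_def qnorm_scal power_mult_distrib sgr vN wN)
    have "(of_int \<sigma> :: rat) * of_int \<sigma> = 1" using sgr by (simp add: power2_eq_square)
    thus "qdot v1 v2 = qdot u1 u2" "qdot v1 v3 = qdot u1 u3" "qdot v2 v3 = qdot u2 u3"
      by (simp_all add: u_def qdot_scal_left qdot_scal_right vd wd xyz mult_ac)
    show "vdet v1 v2 v3 = vdet u1 u2 u3"
    proof -
      have "vdet u1 u2 u3 = of_int (\<sigma> * \<sigma> * \<sigma> * (s * t)) * vdet w1 w2 w3"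
        unfolding u_def by (simp add: vdet_def algebra_simps)
      thus ?thesis unfolding vdet_eq \<sigma>(2) \<sigma>\<sigma> by simp
    qed
  qed (rule pure_v vv(2))+
  \<comment> \<open>The inverse isometry meets the same hypotheses, so the inclusion argument
    applies in both directions and yields a bijection of the orders.\<close>
  interpret H: quat_isometry a b u1 u2 u3 v1 v2 v3
    by unfold_locales (use G.pure_v G.pure_w G.gram G.vdet_w_nz G.vdet_eq in simp_all)
  have GR: "G.F q \<in> R2" if "q \<in> R1" for q by (rule G.F_maps_order[OF R1 R2 u bspec[OF vb] that])
  have HR: "H.F q \<in> R1" if "q \<in> R2" for q by (rule H.F_maps_order[OF R2 R1 v ub that])
  have HG: "H.F (G.F q) = q" for q
  proof -
    obtain c1 c2 c3 where c: "q = qcomb (q0 q) c1 c2 c3 v1 v2 v3"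
      "G.F q = qcomb (q0 q) c1 c2 c3 u1 u2 u3" by (rule G.combination)
    show ?thesis unfolding c(2) H.F_combination by (rule c(1)[symmetric])
  qed
  have GH: "G.F (H.F q) = q" for q
  proof -
    obtain c1 c2 c3 where c: "q = qcomb (q0 q) c1 c2 c3 u1 u2 u3"
      "H.F q = qcomb (q0 q) c1 c2 c3 v1 v2 v3" by (rule H.combination)
    show ?thesis unfolding c(2) G.F_combination by (rule c(1)[symmetric])
  qed
  have "bij_betw G.F R1 R2"
    by (rule bij_betw_byWitness[of _ H.F]) (use HG GH GR HR in auto)
  thus ?thesis using that G.F_one G.F_add G.F_mul by blast
qed

end

theorem theorem1p3:
  fixes p r :: nat and O1 O2 :: "quat set" and D :: "nat \<Rightarrow> rat"
  assumes "prime p" and "odd p"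
    and "is_order p O1" and "is_order p O2"
    and "\<exists>M1. is_maximal_order p M1 \<and> O1 \<subseteq> M1 \<and> order_index O1 M1 = r"
    and "\<exists>M2. is_maximal_order p M2 \<and> O2 \<subseteq> M2 \<and> order_index O2 M2 = r"
    and "\<forall>i\<in>{1,2,3}. is_succ_min p (gross_lattice O1) i (D i)
                    \<and> is_succ_min p (gross_lattice O2) i (D i)"
    and "D 1 \<ge> 8 * of_nat r ^ 2"
  shows "order_iso p O1 O2"
proof -
  interpret quat_ram "Bp_a p" "Bp_b p" p by (rule quat_ram_Bp[OF assms(1,2)])
  have ord: "is_order p S \<longleftrightarrow> ord_like S" for S
    unfolding is_ord_iff[symmetric] is_ord_def is_order_def bmul_def ..
  have rnorm: "rnorm p = qnorm" by (simp add: fun_eq_iff rnorm_def qnorm_def bmul_def)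
  obtain M1 where M1: "ord_like M1" "\<And>S. ord_like S \<Longrightarrow> M1 \<subseteq> S \<Longrightarrow> S = M1" "O1 \<subseteq> M1" "order_index O1 M1 = r"
    using assms(5) unfolding is_maximal_order_def ord by blast
  obtain M2 where M2: "ord_like M2" "\<And>S. ord_like S \<Longrightarrow> M2 \<subseteq> S \<Longrightarrow> S = M2" "O2 \<subseteq> M2" "order_index O2 M2 = r"
    using assms(6) unfolding is_maximal_order_def ord by blast
  have min1: "rank_at_least (zmod_gen {v \<in> gross ` O1. qnorm v \<le> D i}) i"
      "rank_at_least (zmod_gen {v \<in> gross ` O1. qnorm v \<le> D'}) i \<Longrightarrow> D i \<le> D'"
    and min2: "rank_at_least (zmod_gen {v \<in> gross ` O2. qnorm v \<le> D i}) i"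
      "rank_at_least (zmod_gen {v \<in> gross ` O2. qnorm v \<le> D'}) i \<Longrightarrow> D i \<le> D'"
    if "i \<in> {1, 2, 3}" for i D'
    using bspec[OF assms(7) that] unfolding is_succ_min_def rnorm gross_lattice_eq by blast+
  obtain f where f: "bij_betw f O1 O2" "f qone = qone" "\<forall>x y. f (x + y) = f x + f y"
      "\<forall>x y. f (qmul (Bp_a p) (Bp_b p) x y) = qmul (Bp_a p) (Bp_b p) (f x) (f y)"
    by (rule orders_isomorphic[OF iffD1[OF ord assms(3)] M1 iffD1[OF ord assms(4)] M2 min1 min2 assms(8)])
  show ?thesis unfolding order_iso_def bmul_def using f by blast
qed

end
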